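(* Let $F(x;\tau,\gamma)$ be the limiting one-point distribution function of the periodic TASEP with periodic step initial condition, defined in the context. For every fixed $\tau>0$ and $\gamma\in(-\frac12,\frac12]$ there is a constant $c>0$ such that, as $x\to\infty$, $$1-F(x;\tau,\gamma)=\left(1-F_{\rm GUE}\left(\frac{x}{\tau^{1/3}}+\frac{\gamma^2}{4\tau^{4/3}}\right)\right)\left(1+O(e^{-cx^{1/2}})\right)\quad\text{if }-\tfrac12<\gamma<\tfrac12,$$ and $$1-F(x;\tau,\gamma)=2\left(1-F_{\rm GUE}\left(\frac{x}{\tau^{1/3}}+\frac{\gamma^2}{4\tau^{4/3}}\right)\right)\left(1+O(e^{-cx^{1/2}})\right)\quad\text{if }\gamma=\tfrac12 .$$
   Context: Roots and logarithms are principal. $F_{\rm GUE}$ is the GUE Tracy–Widom distribution, $F_{\rm GUE}(x)=\det(\mathbf I-\mathbf A_x^2)_{L^2(0,\infty)}$ with $\mathbf A_x$ having kernel $\mathrm{Ai}(s+x+t)$. $\mathrm{Li}_s(z)=\sum_{k\ge1}z^k/k^s$ for $|z|<1$, continued analytically to $\mathbb C\setminus[1,\infty)$. For $|z|<1$: $A_1(z)=-\frac1{\sqrt{2\pi}}\mathrm{Li}_{3/2}(z)$, $A_2(z)=-\frac1{\sqrt{2\pi}}\mathrm{Li}_{5/2}(z)$, $B(z)=\frac1{4\pi}\int_0^z\frac{(\mathrm{Li}_{1/2}(y))^2}{y}dy$. For $0<|z|<1$, $\mathcal S_-=\{\xi\in\mathbb C:e^{-\xi^2/2}=z,\ \mathrm{Re}\,\xi<0\}$,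 a subset of the sector $3\pi/4<\arg\xi<5\pi/4$; in that sector $Q(\xi)=\sqrt{2/\pi}\int_{-\infty}^\xi\mathrm{Li}_{1/2}(e^{-s^2/2})ds$ (path in the sector) and $\Phi(\xi)=\Phi(\xi;\tau,x)=-\frac13\tau\xi^3+x\xi-Q(\xi)$. $\mathbf K_z$ is the trace class operator on $\ell^2(\mathcal S_-)$ with kernel $$\mathbf K_z(\xi_1,\xi_2)=\sum_{\eta\in\mathcal S_-}\frac{e^{\frac12\Phi(\xi_1)+\Phi(\eta)+\frac12\Phi(\xi_2)+\frac\gamma4(\xi_1^2-2\eta^2+\xi_2^2)}}{\sqrt{-\xi_1}(-\eta)(\xi_1+\eta)(\eta+\xi_2)\sqrt{-\xi_2}}.$$ For $\tau>0$, $x,\gamma\in\mathbb R$, $$F(x;\tau,\gamma)=\oint_{|z|=R}e^{xA_1(z)+\tau A_2(z)+2B(z)}\det(\mathbf I-\mathbf K_z)\frac{dz}{2\pi iz},$$ with any $0<R<1$, counterclockwise. *)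

theory Defs
  imports "HOL-Complex_Analysis.Complex_Analysis" "Jordan_Normal_Form.Determinant"
begin

text \<open>
  Fredholm determinant \<open>det(I - K)\<close> on \<open>L\<^sup>2(M)\<close> of the integral operator with kernel \<open>K\<close>, given
  by the Fredholm series
  \<open>\<Sum>n. (-1)^n / n! * \<integral> det [K (x i) (x j)]\<^sub>i\<^sub>,\<^sub>j\<^sub><\<^sub>n dM(x 0) ... dM(x (n - 1))\<close>.
  The space \<open>\<ell>\<^sup>2(S)\<close> of a countable set \<open>S\<close> is the case \<open>M = count_space S\<close>.
  The name \<open>Determinant.det\<close> is qualified because the analysis library has its own \<open>det\<close>
  for matrices of a fixed dimension.
\<close>

definition fredholm_det ::
  "'a measure \<Rightarrow> ('a \<Rightarrow> 'a \<Rightarrow> 'b::{real_normed_field, banach, second_countable_topology}) \<Rightarrow> 'b" where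
  "fredholm_det M K =
     (\<Sum>n. (-1) ^ n / fact n *
        (\<integral>x. Determinant.det (Matrix.mat n n (\<lambda>(i, j). K (x i) (x j)))
           \<partial>(\<Pi>\<^sub>M i\<in>{..<n}. M)))"

definition kernel_comp ::
  "'a measure \<Rightarrow> ('a \<Rightarrow> 'a \<Rightarrow> 'b::{real_normed_field, banach, second_countable_topology}) \<Rightarrow>
   ('a \<Rightarrow> 'a \<Rightarrow> 'b) \<Rightarrow> 'a \<Rightarrow> 'a \<Rightarrow> 'b" where
  "kernel_comp M K L s t = (\<integral>u. K s u * L u t \<partial>M)"

text \<open>
  The integral below converges only conditionally; the Henstock-Kurzweil integral over the
  half-line is the improper integral.
\<close>

definition Ai :: "real \<Rightarrow> real" where
  "Ai x = integral {0..} (\<lambda>t. cos (t ^ 3 / 3 + x * t)) / pi"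

definition airy_op_kernel :: "real \<Rightarrow> real \<Rightarrow> real \<Rightarrow> real" where
  "airy_op_kernel x s t = Ai (s + x + t)"

definition F_GUE :: "real \<Rightarrow> real" where
  "F_GUE x =
     (let M = restrict_space lborel {0<..}
      in fredholm_det M (kernel_comp M (airy_op_kernel x) (airy_op_kernel x)))"

definition polylog_series :: "real \<Rightarrow> complex \<Rightarrow> complex" where
  "polylog_series s z = (\<Sum>k. z ^ Suc k / of_real (real (Suc k) powr s))"

text \<open>
  The second branch is the analytic continuation to the plane cut along \<open>[1,\<infinity>)\<close>, which is unique
  on that domain. All arguments that occur below lie in the open unit disc.
\<close>

definition polylog :: "real \<Rightarrow> complex \<Rightarrow> complex" where
  "polylog s z =
     (if norm z < 1 then polylog_series s z
      else (SOME f. f holomorphic_on (- complex_of_real ` {1..}) \<and>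
                    (\<forall>w. norm w < 1 \<longrightarrow> f w = polylog_series s w)) z)"

definition A1 :: "complex \<Rightarrow> complex" where
  "A1 z = - polylog (3/2) z / of_real (sqrt (2 * pi))"

definition A2 :: "complex \<Rightarrow> complex" where
  "A2 z = - polylog (5/2) z / of_real (sqrt (2 * pi))"

text \<open>At \<open>y = 0\<close> the integrand is \<open>0 / 0 = 0\<close>, its continuous extension.\<close>

definition B :: "complex \<Rightarrow> complex" where
  "B z = contour_integral (linepath 0 z) (\<lambda>y. (polylog (1/2) y)\<^sup>2 / y) / of_real (4 * pi)"

definition S_minus :: "complex \<Rightarrow> complex set" where
  "S_minus z = {\<xi>. exp (- \<xi>\<^sup>2 / 2) = z \<and> Re \<xi> < 0}"

text \<open>
  The path from \<open>-\<infinity>\<close> to \<open>\<xi>\<close> is the horizontal ray \<open>s = \<xi> - t\<close>, \<open>t \<ge> 0\<close>, which stays in the sector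
  \<open>3\<pi>/4 < arg s < 5\<pi>/4\<close> if \<open>\<xi>\<close> lies in it; there \<open>exp (- s\<^sup>2 / 2)\<close> has modulus less than 1.
\<close>

definition Q :: "complex \<Rightarrow> complex" where
  "Q \<xi> = of_real (sqrt (2 / pi)) *
     integral {0..} (\<lambda>t. polylog (1/2) (exp (- (\<xi> - of_real t)\<^sup>2 / 2)))"

definition Phi :: "real \<Rightarrow> real \<Rightarrow> complex \<Rightarrow> complex" where
  "Phi \<tau> x \<xi> = - (1/3) * of_real \<tau> * \<xi> ^ 3 + of_real x * \<xi> - Q \<xi>"

definition K_kernel ::
  "real \<Rightarrow> real \<Rightarrow> real \<Rightarrow> complex \<Rightarrow> complex \<Rightarrow> complex \<Rightarrow> complex" where
  "K_kernel x \<tau> \<gamma> z \<xi>\<^sub>1 \<xi>\<^sub>2 =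
     (\<Sum>\<^sub>\<infinity>\<eta>\<in>S_minus z.
        exp (1/2 * Phi \<tau> x \<xi>\<^sub>1 + Phi \<tau> x \<eta> + 1/2 * Phi \<tau> x \<xi>\<^sub>2
             + of_real \<gamma> / 4 * (\<xi>\<^sub>1\<^sup>2 - 2 * \<eta>\<^sup>2 + \<xi>\<^sub>2\<^sup>2))
        / (csqrt (- \<xi>\<^sub>1) * (- \<eta>) * (\<xi>\<^sub>1 + \<eta>) * (\<eta> + \<xi>\<^sub>2) * csqrt (- \<xi>\<^sub>2)))"

text \<open>
  The radius \<open>R\<close> of the integration circle is an explicit argument; the value is the same for all
  \<open>0 < R < 1\<close>. It is real, although the contour integral has type \<^typ>\<open>complex\<close>.
\<close>

definition F_per :: "real \<Rightarrow> real \<Rightarrow> real \<Rightarrow> real \<Rightarrow> complex" where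
  "F_per R x \<tau> \<gamma> = contour_integral (circlepath 0 R)
     (\<lambda>z. exp (of_real x * A1 z + of_real \<tau> * A2 z + 2 * B z)
          * fredholm_det (count_space (S_minus z)) (K_kernel x \<tau> \<gamma> z)
          / (2 * of_real pi * \<i> * z))"

end

theory Submission
  imports Defs
begin

text \<open>
  The integrand defining \<open>F_per\<close> is holomorphic in \<open>z\<close>, so the contour may be moved to
  \<open>\<bar>z\<bar> = exp (- x / (2 \<tau>))\<close>, on which the nodes \<open>\<xi> \<in> S_minus z\<close> pass through the saddle point
  \<open>- sqrt (x / \<tau>)\<close> of the cubic phase. There the Fredholm determinant is \<open>1 - Tr K\<close> up to a
  quadratically smaller remainder, and the weight and the function \<open>Q\<close> only contribute a relative
  error of order \<open>exp (- x / (2 \<tau>))\<close>, up to powers of \<open>x\<close>. Since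
  \<open>1 / (\<xi> + \<eta>)\<^sup>2 = \<integral> v exp (v (\<xi> + \<eta>)) dv\<close> over \<open>v > 0\<close>, what is left of the trace is a Laplace integral
  of a product of two theta sums over \<open>S_minus z\<close>. Their Laurent coefficients in \<open>z\<close> are Airy
  functions, and Parseval's identity on the circle turns the mean of the product into the sum over
  \<open>m \<in> \<int>\<close> of \<open>\<integral> v Ai(y\<^sub>m + v)\<^sup>2 dv\<close> with \<open>y\<^sub>m = x / \<tau> powr (1/3) + (\<gamma> - m)\<^sup>2 / (4 \<tau> powr (4/3))\<close>.
  The term \<open>m = 0\<close> is the leading term of \<open>1 - F_GUE y\<^sub>0\<close>; the others are smaller by a factor
  \<open>exp (- c sqrt x)\<close>, except that \<open>y\<^sub>1 = y\<^sub>0\<close> when \<open>\<gamma> = 1/2\<close>, whence the factor \<open>2\<close>.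
\<close>

section \<open>Fredholm series on a discrete space\<close>

text \<open>The circle has to depend on \<open>x\<close>: on a fixed circle the kernel estimate is
  only of size exp(-c x), far above the wanted exp(-(4/3) y^(3/2)). On the saddle circle absolute
  estimates are sharp up to powers of \<open>x\<close>. That suffices for the determinant remainder,
  for \<open>Q\<close> and for the weight, which all carry a further factor exp(-x / (2 \<tau>)) or
  better, but not for the leading term, which is therefore evaluated exactly. The weight has mean 1,
  so 1 - F is itself the mean of the weight times 1 minus the determinant. Neither side is expanded
  asymptotically: both are compared with the same number, \<open>airy_trace\<close> at y_0, for
  which a crude lower bound suffices. That bound loses a factor exp(O(sqrt x)), again absorbed by
  exp(-x / (2 \<tau>)), so the rate exp(-c sqrt x) comes solely from the distance of y_0 to the
  other y_m. The nodes are numbered by integers through \<zeta> = -2 log z: each node is holomorphic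
  in \<zeta>, while a turn of z around the circle shifts the numbering.\<close>

lemma uniform_limit_infsum:
  fixes f :: "'i \<Rightarrow> 'a \<Rightarrow> 'b::banach"
  assumes b: "\<And>i x. i \<in> I \<Longrightarrow> x \<in> U \<Longrightarrow> norm (f i x) \<le> M i" and M: "M summable_on I"
  shows "uniform_limit U (\<lambda>F x. \<Sum>i\<in>F. f i x) (\<lambda>x. \<Sum>\<^sub>\<infinity>i\<in>I. f i x) (finite_subsets_at_top I)"
proof (rule uniform_limitI)
  fix e :: real assume e: "e > 0"
  have "((\<lambda>F. sum M F) \<longlongrightarrow> infsum M I) (finite_subsets_at_top I)"
    using has_sum_infsum[OF M] by (simp add: has_sum_def)
  then have "\<forall>\<^sub>F F in finite_subsets_at_top I. dist (sum M F) (infsum M I) < e"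
    using e by (simp add: tendsto_iff)
  moreover have "\<forall>\<^sub>F F in finite_subsets_at_top I. finite F \<and> F \<subseteq> I"
    by (rule eventually_finite_subsets_at_top_weakI) auto
  ultimately show "\<forall>\<^sub>F F in finite_subsets_at_top I. \<forall>x\<in>U. dist (\<Sum>i\<in>F. f i x) (\<Sum>\<^sub>\<infinity>i\<in>I. f i x) < e"
  proof eventually_elim
    case (elim F)
    show ?case
    proof
      fix x assume x: "x \<in> U"
      have 1: "(\<lambda>i. norm (f i x)) summable_on I"
        by (rule Infinite_Sum.abs_summable_on_comparison_test'[OF M]) (use b x in auto)
      have fs: "(\<lambda>i. f i x) summable_on I" using 1 by (rule abs_summable_summable)
      have "(\<Sum>\<^sub>\<infinity>i\<in>I. f i x) - (\<Sum>i\<in>F. f i x) = (\<Sum>\<^sub>\<infinity>i\<in>I - F. f i x)"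
        using infsum_Diff[OF fs summable_on_finite] elim by (simp add: summable_on_finite)
      also have "norm \<dots> \<le> (\<Sum>\<^sub>\<infinity>i\<in>I - F. M i)"
      proof (rule norm_infsum_le)
        show "((\<lambda>i. f i x) has_sum (\<Sum>\<^sub>\<infinity>i\<in>I - F. f i x)) (I - F)"
          using fs summable_on_Diff elim by (meson has_sum_infsum summable_on_subset_banach Diff_subset)
        show "(M has_sum (\<Sum>\<^sub>\<infinity>i\<in>I - F. M i)) (I - F)"
          using M by (meson has_sum_infsum summable_on_subset_banach Diff_subset)
      qed (use b x in auto)
      also have "\<dots> = infsum M I - sum M F"
        using infsum_Diff[OF M summable_on_finite] elim by simp
      finally show "dist (\<Sum>i\<in>F. f i x) (\<Sum>\<^sub>\<infinity>i\<in>I. f i x) < e"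
        using elim by (simp add: dist_norm norm_minus_commute)
    qed
  qed
qed

lemma holomorphic_on_infsum:
  assumes U: "open U" and hol: "\<And>i. i \<in> I \<Longrightarrow> f i holomorphic_on U"
    and b: "\<And>i x. i \<in> I \<Longrightarrow> x \<in> U \<Longrightarrow> norm (f i x) \<le> M i" and M: "M summable_on I"
  shows "(\<lambda>z. \<Sum>\<^sub>\<infinity>i\<in>I. f i z) holomorphic_on U"
proof -
  have "(\<lambda>z. \<Sum>\<^sub>\<infinity>i\<in>I. f i z) field_differentiable at z" if z: "z \<in> U" for z
  proof -
    obtain r where r: "r > 0" "cball z r \<subseteq> U" using U z open_contains_cball by blast
    have ul: "uniform_limit (cball z r) (\<lambda>F x. \<Sum>i\<in>F. f i x) (\<lambda>x. \<Sum>\<^sub>\<infinity>i\<in>I. f i x) (finite_subsets_at_top I)"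
      using uniform_limit_infsum[OF b M] r(2) by (rule uniform_limit_on_subset)
    have "\<forall>\<^sub>F F in finite_subsets_at_top I. F \<subseteq> I"
      by (rule eventually_finite_subsets_at_top_weakI) auto
    then have ev: "\<forall>\<^sub>F F in finite_subsets_at_top I.
        continuous_on (cball z r) (\<lambda>x. \<Sum>i\<in>F. f i x) \<and> (\<lambda>x. \<Sum>i\<in>F. f i x) holomorphic_on ball z r"
    proof eventually_elim
      case (elim F)
      have h: "(\<lambda>x. \<Sum>i\<in>F. f i x) holomorphic_on U"
        using hol elim by (intro holomorphic_on_sum) auto
      then show ?case using r(2)
        by (meson ball_subset_cball holomorphic_on_imp_continuous_on holomorphic_on_subset order_trans)
    qed
    obtain "(\<lambda>z. \<Sum>\<^sub>\<infinity>i\<in>I. f i z) holomorphic_on ball z r"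
      using holomorphic_uniform_limit[OF ev ul] by auto
    then show ?thesis using r(1) holomorphic_on_imp_differentiable_at by force
  qed
  then show ?thesis using field_differentiable_at_within holomorphic_on_def by blast
qed

lemma continuous_on_infsum:
  fixes f :: "'i \<Rightarrow> 'a::topological_space \<Rightarrow> 'b::banach"
  assumes hol: "\<And>i. i \<in> I \<Longrightarrow> continuous_on U (f i)"
    and b: "\<And>i x. i \<in> I \<Longrightarrow> x \<in> U \<Longrightarrow> norm (f i x) \<le> M i" and M: "M summable_on I"
  shows "continuous_on U (\<lambda>z. \<Sum>\<^sub>\<infinity>i\<in>I. f i z)"
proof (rule uniform_limit_theorem[OF _ uniform_limit_infsum[OF b M]])
  have "\<forall>\<^sub>F F in finite_subsets_at_top I. F \<subseteq> I"
    by (rule eventually_finite_subsets_at_top_weakI) auto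
  then show "\<forall>\<^sub>F F in finite_subsets_at_top I. continuous_on U (\<lambda>x. \<Sum>i\<in>F. f i x)"
    by eventually_elim (use hol in \<open>auto intro!: continuous_on_sum\<close>)
qed auto

section \<open>Leibniz bound and Fredholm terms over a fixed index type\<close>

text \<open>Along a permutation the product of u i * u (p i) is the product of (u i)^2, so all n!
  terms of the Leibniz expansion have the same bound. The factorial cancels the 1/n! of the Fredholm
  series, which is thereby dominated by a geometric series.\<close>

lemma norm_det_le:
  fixes a :: "nat \<Rightarrow> nat \<Rightarrow> 'b::real_normed_field"
  assumes a: "\<And>i j. i < n \<Longrightarrow> j < n \<Longrightarrow> norm (a i j) \<le> u i * u j"
  shows "norm (Determinant.det (Matrix.mat n n (\<lambda>(i, j). a i j))) \<le> fact n * (\<Prod>i<n. (u i)\<^sup>2)"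
proof -
  let ?P = "{p. p permutes {0..<n}}"
  have "norm (Determinant.det (Matrix.mat n n (\<lambda>(i, j). a i j)))
      \<le> (\<Sum>p\<in>?P. norm (signof p * (\<Prod>i = 0..<n. a i (p i)) :: 'b))"
    by (subst det_def') (auto intro!: order_trans[OF norm_sum] sum_mono simp: norm_mult prod_norm[symmetric]
        permutes_in_image intro!: prod.cong)
  also have "\<dots> \<le> (\<Sum>p\<in>?P. (\<Prod>i = 0..<n. (u i)\<^sup>2))"
  proof (rule sum_mono)
    fix p assume p: "p \<in> ?P"
    have "norm (signof p * (\<Prod>i = 0..<n. a i (p i)) :: 'b) = (\<Prod>i = 0..<n. norm (a i (p i)))"
      by (simp add: norm_mult prod_norm sign_def)
    also have "\<dots> \<le> (\<Prod>i = 0..<n. u i * u (p i))"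
      using p by (intro prod_mono) (auto intro!: a simp: permutes_in_image)
    also have "\<dots> = (\<Prod>i = 0..<n. u i) * (\<Prod>i = 0..<n. u (p i))" by (simp add: prod.distrib)
    also have "(\<Prod>i = 0..<n. u (p i)) = (\<Prod>i = 0..<n. u i)"
      using p prod.permute[of p "{0..<n}" u] by (simp add: o_def)
    finally show "norm (signof p * (\<Prod>i = 0..<n. a i (p i)) :: 'b) \<le> (\<Prod>i = 0..<n. (u i)\<^sup>2)"
      by (simp add: power2_eq_square prod.distrib)
  qed
  also have "\<dots> = fact n * (\<Prod>i<n. (u i)\<^sup>2)"
    using card_permutations[of "{0..<n}" n] by (simp add: atLeast0LessThan)
  finally show ?thesis .
qed

text \<open>The n-th integral of the Fredholm series, without sign and factorial, over a fixed index
  type. The node set \<open>S_minus z\<close> moves with z, so holomorphy in z and conjugation are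
  studied after its points have been numbered.\<close>

definition fredholm_term :: "('i \<Rightarrow> 'i \<Rightarrow> complex) \<Rightarrow> nat \<Rightarrow> complex" where
  "fredholm_term K n =
     (\<Sum>\<^sub>\<infinity>\<kappa>\<in>PiE {..<n} (\<lambda>_. UNIV). Determinant.det (Matrix.mat n n (\<lambda>(i, j). K (\<kappa> i) (\<kappa> j))))"

lemma summable_on_prod_square:
  fixes u :: "'i::countable \<Rightarrow> real"
  assumes "(\<lambda>k. (u k)\<^sup>2) summable_on UNIV"
  shows "(\<lambda>\<kappa>. \<Prod>i<n. (u (\<kappa> i))\<^sup>2) summable_on PiE {..<n} (\<lambda>_. UNIV)"
    and "(\<Sum>\<^sub>\<infinity>\<kappa>\<in>PiE {..<n} (\<lambda>_. UNIV). \<Prod>i<n. (u (\<kappa> i))\<^sup>2) = (\<Sum>\<^sub>\<infinity>k. (u k)\<^sup>2) ^ n"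
proof -
  have "(\<lambda>k. norm ((u k)\<^sup>2)) summable_on UNIV" using assms by simp
  then have 1: "Infinite_Set_Sum.abs_summable_on (\<lambda>\<kappa>. \<Prod>i<n. (u (\<kappa> i))\<^sup>2) (PiE {..<n} (\<lambda>_. UNIV))"
    by (intro Infinite_Set_Sum.abs_summable_on_prod_PiE) (use assms in \<open>auto simp flip: abs_summable_equivalent\<close>)
  then have "(\<lambda>\<kappa>. norm (\<Prod>i<n. (u (\<kappa> i))\<^sup>2)) summable_on PiE {..<n} (\<lambda>_. UNIV)"
    by (simp only: abs_summable_equivalent)
  then show 2: "(\<lambda>\<kappa>. \<Prod>i<n. (u (\<kappa> i))\<^sup>2) summable_on PiE {..<n} (\<lambda>_. UNIV)"
    by (rule abs_summable_summable)
  show "(\<Sum>\<^sub>\<infinity>\<kappa>\<in>PiE {..<n} (\<lambda>_. UNIV). \<Prod>i<n. (u (\<kappa> i))\<^sup>2) = (\<Sum>\<^sub>\<infinity>k. (u k)\<^sup>2) ^ n"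
    using infsum_prod_PiE[OF _ _ 2[simplified]] assms by simp
qed

context
  fixes K :: "'i::countable \<Rightarrow> 'i \<Rightarrow> complex" and u :: "'i \<Rightarrow> real"
  assumes bound: "\<And>k l. norm (K k l) \<le> u k * u l"
    and u2: "(\<lambda>k. (u k)\<^sup>2) summable_on UNIV"
begin

lemma norm_fredholm_det_summand_le:
  "norm (Determinant.det (Matrix.mat n n (\<lambda>(i, j). K (\<kappa> i) (\<kappa> j)))) \<le> fact n * (\<Prod>i<n. (u (\<kappa> i))\<^sup>2)"
  by (rule norm_det_le) (rule bound)

lemma abs_summable_fredholm_term:
  "(\<lambda>\<kappa>. norm (Determinant.det (Matrix.mat n n (\<lambda>(i, j). K (\<kappa> i) (\<kappa> j))))) summable_on PiE {..<n} (\<lambda>_. UNIV)"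
  by (rule Infinite_Sum.abs_summable_on_comparison_test'
      [OF summable_on_cmult_right[OF summable_on_prod_square(1)[OF u2]]])
    (rule norm_fredholm_det_summand_le)

lemma norm_fredholm_term_le: "norm (fredholm_term K n) \<le> fact n * (\<Sum>\<^sub>\<infinity>k. (u k)\<^sup>2) ^ n"
  unfolding fredholm_term_def summable_on_prod_square(2)[OF u2, symmetric]
  by (subst infsum_cmult_right'[symmetric])
    (rule norm_infsum_le[OF has_sum_infsum has_sum_infsum norm_fredholm_det_summand_le],
     rule abs_summable_summable, rule abs_summable_fredholm_term,
     rule summable_on_cmult_right[OF summable_on_prod_square(1)[OF u2]])

lemma fredholm_term_0: "fredholm_term K 0 = 1"
  by (simp add: fredholm_term_def det_def)

lemma fredholm_term_1: "fredholm_term K (Suc 0) = (\<Sum>\<^sub>\<infinity>k. K k k)"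
proof -
  have b: "bij_betw (\<lambda>k. \<lambda>i\<in>{..<Suc 0}. k) UNIV (PiE {..<Suc 0} (\<lambda>_. UNIV :: 'i set))"
    by (rule bij_betwI[where g = "\<lambda>\<kappa>. \<kappa> 0"]) (auto simp: fun_eq_iff PiE_def extensional_def)
  show ?thesis unfolding fredholm_term_def
    by (subst infsum_reindex_bij_betw[OF b, symmetric])
      (auto simp: det_def sign_def intro!: infsum_cong)
qed

text \<open>A finite product of counting measures on a countable set is the counting measure on the
  extensional functions, its Bochner integral is an unordered sum, and the enumeration
  \<open>g\<close> carries that sum to the index type. Any enumeration will do, a freedom used for
  the conjugate node set.\<close>

lemma fredholm_det_count_space:
  assumes g: "bij_betw g UNIV S" and L: "\<And>k l. L (g k) (g l) = K k l"
  shows "fredholm_det (count_space S) L = (\<Sum>n. (-1) ^ n / fact n * fredholm_term K n)"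
proof -
  have S: "countable S" using g by (metis bij_betw_imp_surj_on countableI_type countable_image)
  have gS: "g k \<in> S" for k using g by (auto simp: bij_betw_def)
  have inj: "inj g" using g by (auto simp: bij_betw_def)
  have "(\<integral>x. Determinant.det (Matrix.mat n n (\<lambda>(i, j). L (x i) (x j))) \<partial>(\<Pi>\<^sub>M i\<in>{..<n}. count_space S))
     = fredholm_term K n" for n
  proof -
    let ?B = "PiE {..<n} (\<lambda>_. UNIV :: 'i set)"
    have b: "bij_betw (\<lambda>\<kappa>. restrict (g \<circ> \<kappa>) {..<n}) ?B (PiE {..<n} (\<lambda>_. S))"
    proof (rule bij_betwI[where g = "\<lambda>\<kappa>. restrict (inv_into UNIV g \<circ> \<kappa>) {..<n}"])
      show "restrict (inv_into UNIV g \<circ> restrict (g \<circ> x) {..<n}) {..<n} = x" if "x \<in> ?B" for x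
        using that inj by (auto simp: fun_eq_iff PiE_def extensional_def)
      show "restrict (g \<circ> restrict (inv_into UNIV g \<circ> x) {..<n}) {..<n} = x" if "x \<in> PiE {..<n} (\<lambda>_. S)" for x
        using that g by (auto simp: fun_eq_iff PiE_def extensional_def bij_betw_def f_inv_into_f Pi_def)
    qed (use gS in auto)
    have d: "Determinant.det (Matrix.mat n n (\<lambda>(i, j). L (restrict (g \<circ> \<kappa>) {..<n} i) (restrict (g \<circ> \<kappa>) {..<n} j)))
       = Determinant.det (Matrix.mat n n (\<lambda>(i, j). K (\<kappa> i) (\<kappa> j)))" for \<kappa>
      by (intro arg_cong[where f = Determinant.det] cong_mat) (auto simp: L)
    have "(\<integral>x. Determinant.det (Matrix.mat n n (\<lambda>(i, j). L (x i) (x j))) \<partial>(\<Pi>\<^sub>M i\<in>{..<n}. count_space S))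
       = infsetsum (\<lambda>x. Determinant.det (Matrix.mat n n (\<lambda>(i, j). L (x i) (x j)))) (PiE {..<n} (\<lambda>_. S))"
      using S by (subst count_space_PiM_finite) (auto simp: infsetsum_def)
    also have "\<dots> = infsetsum (\<lambda>\<kappa>. Determinant.det (Matrix.mat n n (\<lambda>(i, j). K (\<kappa> i) (\<kappa> j)))) ?B"
      by (subst infsetsum_reindex_bij_betw[OF b, symmetric]) (simp only: d)
    also have "\<dots> = fredholm_term K n"
      unfolding fredholm_term_def using abs_summable_fredholm_term
      by (intro infsetsum_infsum) (simp only: abs_summable_equivalent)
    finally show ?thesis .
  qed
  then show ?thesis unfolding fredholm_det_def by simp
qed

text \<open>The terms n = 0 and n = 1 are 1 and minus the trace; what is bounded is the geometric
  tail from n = 2 on.\<close>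

lemma fredholm_series_bound:
  assumes "(\<Sum>\<^sub>\<infinity>k. (u k)\<^sup>2) \<le> s" "s < 1"
  shows "norm ((\<Sum>n. (-1) ^ n / fact n * fredholm_term K n) - 1 + (\<Sum>\<^sub>\<infinity>k. K k k)) \<le> s\<^sup>2 / (1 - s)"
    and "summable (\<lambda>n. (-1) ^ n / fact n * fredholm_term K n)"
proof -
  let ?f = "\<lambda>n. (-1) ^ n / fact n * fredholm_term K n"
  have u0: "0 \<le> (\<Sum>\<^sub>\<infinity>k. (u k)\<^sup>2)" by (rule infsum_nonneg) auto
  have s0: "0 \<le> s" using assms u0 by linarith
  have b: "norm (?f n) \<le> s ^ n" for n
  proof -
    have "norm (?f n) = norm (fredholm_term K n) / fact n" by (simp add: norm_mult norm_divide norm_power)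
    also have "\<dots> \<le> (\<Sum>\<^sub>\<infinity>k. (u k)\<^sup>2) ^ n" using norm_fredholm_term_le[of n] by (simp add: field_simps)
    also have "\<dots> \<le> s ^ n" using assms u0 by (intro power_mono)
    finally show ?thesis .
  qed
  have sg: "summable (\<lambda>n. s ^ n)" using s0 assms by (intro summable_geometric) auto
  show sm: "summable ?f" using sg by (rule summable_comparison_test'[where N = 0]) (rule b)
  have "suminf ?f = (\<Sum>n. ?f (n + 2)) + sum ?f {..<2}" using sm by (rule suminf_split_initial_segment)
  also have "sum ?f {..<2} = 1 - (\<Sum>\<^sub>\<infinity>k. K k k)"
    by (simp add: numeral_2_eq_2 fredholm_term_0 fredholm_term_1)
  finally have "suminf ?f - 1 + (\<Sum>\<^sub>\<infinity>k. K k k) = (\<Sum>n. ?f (n + 2))" by simp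
  also have "norm \<dots> \<le> (\<Sum>n. s ^ (n + 2))"
    by (rule norm_suminf_le[OF b]) (use sg in \<open>simp only: summable_iff_shift\<close>)
  also have "\<dots> = s\<^sup>2 / (1 - s)"
    using s0 assms by (simp add: power_add suminf_mult suminf_geometric summable_geometric power2_eq_square mult.commute)
  finally show "norm (suminf ?f - 1 + (\<Sum>\<^sub>\<infinity>k. K k k)) \<le> s\<^sup>2 / (1 - s)" .
qed

end

text \<open>The majorant \<open>u\<close> does not depend on z, so it controls both the sum inside
  each term and the series over n uniformly on \<open>U\<close>.\<close>

lemma holomorphic_fredholm_series:
  fixes K :: "complex \<Rightarrow> 'i::countable \<Rightarrow> 'i \<Rightarrow> complex"
  assumes U: "open U" and hol: "\<And>k l. (\<lambda>z. K z k l) holomorphic_on U"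
    and bound: "\<And>z k l. z \<in> U \<Longrightarrow> norm (K z k l) \<le> u k * u l"
    and u2: "(\<lambda>k. (u k)\<^sup>2) summable_on UNIV" and s: "(\<Sum>\<^sub>\<infinity>k. (u k)\<^sup>2) < 1"
  shows "(\<lambda>z. \<Sum>n. (-1) ^ n / fact n * fredholm_term (K z) n) holomorphic_on U"
proof -
  let ?s = "(\<Sum>\<^sub>\<infinity>k. (u k)\<^sup>2)"
  let ?f = "\<lambda>n z. (-1) ^ n / fact n * fredholm_term (K z) n"
  have u0: "0 \<le> ?s" by (rule infsum_nonneg) auto
  have ht: "(\<lambda>z. fredholm_term (K z) n) holomorphic_on U" for n
    unfolding fredholm_term_def
  proof (rule holomorphic_on_infsum[OF U])
    show "(\<lambda>z. Determinant.det (Matrix.mat n n (\<lambda>(i, j). K z (\<kappa> i) (\<kappa> j)))) holomorphic_on U" for \<kappa>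
    proof -
      have "(\<lambda>z. \<Sum>p\<in>{p. p permutes {0..<n}}. signof p * (\<Prod>i = 0..<n. K z (\<kappa> i) (\<kappa> (p i)))) holomorphic_on U"
        by (intro holomorphic_intros hol)
      then show ?thesis
        by (rule holomorphic_transform)
          (subst det_def', auto intro!: sum.cong prod.cong simp: permutes_in_image)
    qed
  next
    show "norm (Determinant.det (Matrix.mat n n (\<lambda>(i, j). K z (\<kappa> i) (\<kappa> j)))) \<le> fact n * (\<Prod>i<n. (u (\<kappa> i))\<^sup>2)"
      if "z \<in> U" for \<kappa> z using that by (intro norm_fredholm_det_summand_le[OF bound u2])
    show "(\<lambda>\<kappa>. fact n * (\<Prod>i<n. (u (\<kappa> i))\<^sup>2)) summable_on PiE {..<n} (\<lambda>_. UNIV)"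
      by (rule summable_on_cmult_right[OF summable_on_prod_square(1)[OF u2]])
  qed
  have b: "norm (?f n z) \<le> ?s ^ n" if "z \<in> U" for n z
    using norm_fredholm_term_le[of "K z" u n, OF bound[OF that] u2]
    by (simp add: norm_mult norm_divide norm_power field_simps)
  have sg: "summable (\<lambda>n. ?s ^ n)" using u0 s by (intro summable_geometric) auto
  have "(\<lambda>z. \<Sum>\<^sub>\<infinity>n. ?f n z) holomorphic_on U"
  proof (rule holomorphic_on_infsum[OF U _ b])
    show "(\<lambda>n. ?s ^ n) summable_on UNIV"
      using sg u0 by (subst summable_on_UNIV_nonneg_real_iff) auto
  qed (intro holomorphic_intros ht)
  then show ?thesis
  proof (rule holomorphic_transform)
    fix z assume z: "z \<in> U"
    have "(\<lambda>n. ?f n z) summable_on UNIV"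
      using sg by (intro norm_summable_imp_summable_on summable_comparison_test'[OF sg, where N = 0])
        (use b z in simp)
    then show "(\<Sum>\<^sub>\<infinity>n. ?f n z) = (\<Sum>n. ?f n z)"
      by (intro sums_unique has_sum_imp_sums has_sum_infsum)
  qed
qed

section \<open>The Airy function on the positive half line\<close>

text \<open>Hake's theorem on a half line: a box containing a large ball cuts {0..} down to {0..b}
  with b large. It serves to evaluate the conditionally convergent integral in
  \<open>Ai\<close>.\<close>

lemma has_integral_improper_right:
  fixes f :: "real \<Rightarrow> 'a::banach"
  assumes c: "continuous_on {0..} f" and l: "((\<lambda>Y. integral {0..Y} f) \<longlongrightarrow> L) at_top"
  shows "(f has_integral L) {0..}"
  unfolding has_integral_alt'
proof safe
  show "(\<lambda>x. if x \<in> {0..} then f x else 0) integrable_on cbox a b" for a b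
  proof -
    have "f integrable_on {max 0 a..b}"
      by (intro integrable_continuous_real continuous_on_subset[OF c]) auto
    moreover have "{max 0 a..b} = {0..} \<inter> cbox a b" by auto
    ultimately have "f integrable_on ({0..} \<inter> cbox a b)" by metis
    then show ?thesis
      using integrable_restrict_Int[of "{0..}" f "cbox a b"] by (metis Int_commute)
  qed
  fix e :: real assume "e > 0"
  then obtain N where N: "\<And>Y. Y \<ge> N \<Longrightarrow> dist (integral {0..Y} f) L < e"
    using l by (auto simp: tendsto_iff eventually_at_top_linorder)
  show "\<exists>B>0. \<forall>a b. ball 0 B \<subseteq> cbox a b \<longrightarrow>
      norm (integral (cbox a b) (\<lambda>x. if x \<in> {0..} then f x else 0) - L) < e"
  proof (intro exI[of _ "max N 1"] conjI allI impI)
    fix a b :: real assume b: "ball 0 (max N 1) \<subseteq> cbox a b"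
    then have b2: "cball 0 (max N 1) \<subseteq> cbox a (b::real)"
      using closure_minimal[OF b closed_cbox] by (simp add: closure_ball)
    have "max N 1 \<in> cball 0 (max N 1)" "0 \<in> cball 0 (max N 1)" by auto
    then have "max N 1 \<in> cbox a b" "0 \<in> cbox a b" using b2 by blast+
    then have "a \<le> 0" "N \<le> b" by auto
    then have "{0..b} = {0..} \<inter> cbox a b" by auto
    then have "integral (cbox a b) (\<lambda>x. if x \<in> {0..} then f x else 0) = integral {0..b} f"
      using integral_restrict_Int[of "cbox a b" "{0..}" f] by (metis Int_commute)
    then show "norm (integral (cbox a b) (\<lambda>x. if x \<in> {0..} then f x else 0) - L) < e"
      using N[OF \<open>N \<le> b\<close>] by (simp add: dist_norm)
  qed auto
qed

text \<open>With a global primitive, moving a contour becomes comparing values of \<open>F\<close>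
  at its end points.\<close>

lemma exp_cubic_primitive:
  obtains F :: "complex \<Rightarrow> complex"
  where "\<And>u. (F has_field_derivative exp (u ^ 3 / 3 - of_real y * u)) (at u)"
proof -
  have "(\<lambda>u::complex. exp (u ^ 3 / 3 - of_real y * u)) holomorphic_on UNIV" by (intro holomorphic_intros) auto
  from holomorphic_convex_primitive'[OF convex_UNIV open_UNIV this]
  obtain g :: "complex \<Rightarrow> complex" where "\<And>u. u \<in> UNIV \<Longrightarrow> (g has_field_derivative exp (u ^ 3 / 3 - of_real y * u)) (at u within UNIV)"
    by blast
  then show ?thesis by (intro that[of g]) simp
qed

text \<open>Upper bound: exp(-u) \<le> 1/(1 + u) turns the Gaussian into the derivative of an
  arctangent. Lower bound: cos v \<ge> 1 - v for v \<ge> 0, so the integral is at least the Gaussian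
  integral minus a third of its cubic moment. With q = sqrt s \<ge> 1 the former is at least 1/(3 q)
  and the latter costs at most 1/(6 s^2) \<le> 1/(6 q).\<close>

lemma integral_exp_neg_square_cos_bounds:
  fixes s Y :: real
  assumes s: "s \<ge> 1" and Y: "Y \<ge> 1"
  shows "integral {0..Y} (\<lambda>t. exp (- (s * t\<^sup>2)) * cos (t ^ 3 / 3)) \<le> 2 / sqrt s"
    and "1 / (6 * sqrt s) \<le> integral {0..Y} (\<lambda>t. exp (- (s * t\<^sup>2)) * cos (t ^ 3 / 3))"
proof -
  define q where "q = sqrt s"
  have q: "q \<ge> 1" "q\<^sup>2 = s" using s by (auto simp: q_def)
  have "((\<lambda>t. 1 / (1 + (q * t)\<^sup>2)) has_integral (arctan (q * Y) / q - arctan (q * 0) / q)) {0..Y}"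
  proof (intro fundamental_theorem_of_calculus)
    fix t :: real
    have "((\<lambda>t. arctan (q * t)) has_real_derivative inverse (1 + (q * t)\<^sup>2) * q) (at t)"
      by (rule DERIV_chain2[OF DERIV_arctan]) (auto intro!: derivative_eq_intros)
    from DERIV_cdivide[OF this, of q]
    have "((\<lambda>t. arctan (q * t) / q) has_vector_derivative inverse (1 + (q * t)\<^sup>2) * q / q) (at t)"
      by (simp only: has_real_derivative_iff_has_vector_derivative)
    moreover have "inverse (1 + (q * t)\<^sup>2) * q / q = 1 / (1 + (q * t)\<^sup>2)"
      using q by (simp add: inverse_eq_divide)
    ultimately show "((\<lambda>t. arctan (q * t) / q) has_vector_derivative 1 / (1 + (q * t)\<^sup>2)) (at t within {0..Y})"
      by (metis has_vector_derivative_at_within)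
  qed (use Y in simp)
  then have i: "integral {0..Y} (\<lambda>t. 1 / (1 + (q * t)\<^sup>2)) = arctan (q * Y) / q"
    by (simp add: integral_unique)
  have "integral {0..Y} (\<lambda>t. exp (- (s * t\<^sup>2)) * cos (t ^ 3 / 3)) \<le> integral {0..Y} (\<lambda>t. 1 / (1 + (q * t)\<^sup>2))"
  proof (rule integral_le)
    show "(\<lambda>t. 1 / (1 + (q * t)\<^sup>2)) integrable_on {0..Y}"
      by (intro integrable_continuous_real continuous_intros ballI) (simp add: add_nonneg_eq_0_iff)
    fix t assume "t \<in> {0..Y}"
    have "exp (- (s * t\<^sup>2)) * cos (t ^ 3 / 3) \<le> exp (- (s * t\<^sup>2)) * 1"
      by (intro mult_left_mono) auto
    also have "\<dots> = 1 / exp (s * t\<^sup>2)" by (simp add: exp_minus field_simps)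
    also have "\<dots> \<le> 1 / (1 + s * t\<^sup>2)"
    proof -
      have "1 + s * t\<^sup>2 \<le> exp (s * t\<^sup>2)" "0 \<le> s * t\<^sup>2" using s by auto
      then show ?thesis by (intro divide_left_mono mult_pos_pos) (auto intro: add_pos_nonneg)
    qed
    finally show "exp (- (s * t\<^sup>2)) * cos (t ^ 3 / 3) \<le> 1 / (1 + (q * t)\<^sup>2)"
      by (simp add: power_mult_distrib q)
  qed (auto intro!: integrable_continuous_real continuous_intros)
  also have "\<dots> \<le> 2 / q" unfolding i
    using arctan_ubound[of "q * Y"] pi_half_less_two q by (intro divide_right_mono) auto
  finally show "integral {0..Y} (\<lambda>t. exp (- (s * t\<^sup>2)) * cos (t ^ 3 / 3)) \<le> 2 / sqrt s" by (simp add: q_def)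
next
  define q where "q = sqrt s"
  have q: "q \<ge> 1" "q\<^sup>2 = s" using s by (auto simp: q_def)
  have qY: "1 / q \<le> Y" "0 \<le> 1 / q" using q Y order_trans[of "1 / q" 1 Y] by auto
  let ?G = "\<lambda>t::real. - ((t\<^sup>2 / (2 * s) + 1 / (2 * s\<^sup>2)) * exp (- (s * t\<^sup>2)))"
  have "((\<lambda>t. exp (- (s * t\<^sup>2)) * t ^ 3) has_integral (?G Y - ?G 0)) {0..Y}"
  proof (intro fundamental_theorem_of_calculus)
    fix t :: real
    have "((\<lambda>t. - ((t\<^sup>2 * k + c) * exp (- (s * t\<^sup>2)))) has_real_derivative
        - ((2 * t * k) * exp (- (s * t\<^sup>2)) + (t\<^sup>2 * k + c) * (exp (- (s * t\<^sup>2)) * (- (s * (2 * t)))))) (at t)" for c k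
      by (auto intro!: derivative_eq_intros)
    from this[of "1 / (2 * s)" "1 / (2 * s\<^sup>2)"]
    have "(?G has_real_derivative - ((2 * t / (2 * s)) * exp (- (s * t\<^sup>2))
        + (t\<^sup>2 / (2 * s) + 1 / (2 * s\<^sup>2)) * (exp (- (s * t\<^sup>2)) * (- (s * (2 * t)))))) (at t)"
      by simp
    also have "- ((2 * t / (2 * s)) * exp (- (s * t\<^sup>2)) + (t\<^sup>2 / (2 * s) + 1 / (2 * s\<^sup>2)) * (exp (- (s * t\<^sup>2)) * (- (s * (2 * t)))))
       = exp (- (s * t\<^sup>2)) * t ^ 3" (is "?l = _")
    proof -
      have "?l = exp (- (s * t\<^sup>2)) * ((t\<^sup>2 / (2 * s) + 1 / (2 * s\<^sup>2)) * (s * (2 * t)) - 2 * t / (2 * s))"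
        by (simp add: algebra_simps)
      also have "(t\<^sup>2 / (2 * s) + 1 / (2 * s\<^sup>2)) * (s * (2 * t)) - 2 * t / (2 * s) = t ^ 3"
        using s by (simp add: power2_eq_square power3_eq_cube distrib_right)
      finally show ?thesis .
    qed
    finally show "(?G has_vector_derivative exp (- (s * t\<^sup>2)) * t ^ 3) (at t within {0..Y})"
      by (simp add: has_real_derivative_iff_has_vector_derivative has_vector_derivative_at_within)
  qed (use Y in simp)
  then have i: "integral {0..Y} (\<lambda>t. exp (- (s * t\<^sup>2)) * t ^ 3) = ?G Y - ?G 0" by (rule integral_unique)
  have "?G Y \<le> 0" using s by auto
  then have i2: "integral {0..Y} (\<lambda>t. exp (- (s * t\<^sup>2)) * t ^ 3) \<le> 1 / (2 * s\<^sup>2)" unfolding i by simp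
  \<comment> \<open>On {0..1/q} the exponent s t^2 is at most 1, and exp(-1) \<ge> 1/3.\<close>
  have "1 / 3 * (1 / q) = integral {0..1/q} (\<lambda>t. 1 / 3)" using q by simp
  also have "\<dots> \<le> integral {0..1/q} (\<lambda>t. exp (- (s * t\<^sup>2)))"
  proof (rule integral_le)
    show "(\<lambda>t. exp (- (s * t\<^sup>2))) integrable_on {0..1 / q}"
      by (intro integrable_continuous_real continuous_intros)
    fix t assume t: "t \<in> {0..1/q}"
    have "q * t \<le> 1" "0 \<le> q * t" using t q by (auto simp: field_simps)
    then have "(q * t)\<^sup>2 \<le> 1" by (simp add: power_le_one)
    then have "exp (- 1) \<le> exp (- (s * t\<^sup>2))" by (simp add: power_mult_distrib q)
    moreover have "1 / 3 \<le> exp (- 1 :: real)" using exp_le by (simp add: exp_minus field_simps)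
    ultimately show "1 / 3 \<le> exp (- (s * t\<^sup>2))" by linarith
  qed (auto intro!: integrable_continuous_real)
  also have "\<dots> \<le> integral {0..Y} (\<lambda>t. exp (- (s * t\<^sup>2)))"
    using qY by (intro integral_subset_le) (auto intro!: integrable_continuous_real continuous_intros)
  finally have 1: "1 / 3 * (1 / q) \<le> integral {0..Y} (\<lambda>t. exp (- (s * t\<^sup>2)))" .
  have "integral {0..Y} (\<lambda>t. exp (- (s * t\<^sup>2))) - (1/3) * integral {0..Y} (\<lambda>t. exp (- (s * t\<^sup>2)) * t ^ 3)
      = integral {0..Y} (\<lambda>t. exp (- (s * t\<^sup>2)) - (1/3) * (exp (- (s * t\<^sup>2)) * t ^ 3))"
    by (subst Henstock_Kurzweil_Integration.integral_diff) (auto intro!: integrable_continuous_real continuous_intros)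
  also have "\<dots> \<le> integral {0..Y} (\<lambda>t. exp (- (s * t\<^sup>2)) * cos (t ^ 3 / 3))"
  proof (rule integral_le)
    fix t assume t: "t \<in> {0..Y}"
    have "\<bar>cos (t ^ 3 / 3) - cos 0\<bar> \<le> \<bar>t ^ 3 / 3 - 0\<bar>"
      using field_differentiable_bound[of UNIV cos "\<lambda>x. - sin x" 1 "t ^ 3 / 3" 0] DERIV_cos by auto
    then have "1 - t ^ 3 / 3 \<le> cos (t ^ 3 / 3)" using t by (auto simp: abs_if split: if_splits)
    then have "exp (- (s * t\<^sup>2)) * (1 - t ^ 3 / 3) \<le> exp (- (s * t\<^sup>2)) * cos (t ^ 3 / 3)"
      by (intro mult_left_mono) auto
    then show "exp (- (s * t\<^sup>2)) - 1 / 3 * (exp (- (s * t\<^sup>2)) * t ^ 3) \<le> exp (- (s * t\<^sup>2)) * cos (t ^ 3 / 3)"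
      by (simp add: algebra_simps)
  qed (auto intro!: integrable_continuous_real continuous_intros)
  finally have 2: "1 / 3 * (1 / q) - 1 / 6 / s\<^sup>2 \<le> integral {0..Y} (\<lambda>t. exp (- (s * t\<^sup>2)) * cos (t ^ 3 / 3))"
    using 1 i2 by (simp add: field_simps)
  have "1 / s\<^sup>2 \<le> 1 / q"
  proof (rule divide_left_mono)
    have "q * 1 \<le> q * q ^ 3" using q by (intro mult_left_mono one_le_power) auto
    then show "q \<le> s\<^sup>2" unfolding q(2)[symmetric] by (simp add: power2_eq_square power3_eq_cube mult.assoc)
  qed (use q s in auto)
  then have "1 / (6 * q) \<le> 1 / 3 * (1 / q) - 1 / 6 / s\<^sup>2" by (simp add: field_simps)
  with 2 show "1 / (6 * sqrt s) \<le> integral {0..Y} (\<lambda>t. exp (- (s * t\<^sup>2)) * cos (t ^ 3 / 3))"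
    by (simp add: q_def)
qed

section \<open>Contour shifts for the Airy integrand\<close>

context
  fixes F :: "complex \<Rightarrow> complex" and y :: real
  assumes F: "\<And>u. (F has_field_derivative exp (u ^ 3 / 3 - of_real y * u)) (at u)" and y: "y > 0"
begin

lemma has_vector_derivative_vertical:
  "((\<lambda>t. F (of_real s + c * \<i> * of_real t)) has_vector_derivative
     exp ((of_real s + c * \<i> * of_real t) ^ 3 / 3 - of_real y * (of_real s + c * \<i> * of_real t)) * (c * \<i>)) (at t within A)"
proof -
  have "((\<lambda>t. of_real s + c * \<i> * of_real t :: complex) has_vector_derivative (c * \<i>)) (at t)"
    by (auto intro!: derivative_eq_intros simp: has_vector_derivative_def fun_eq_iff scaleR_conv_of_real mult_ac)
  from field_vector_diff_chain_at[OF this F] show ?thesis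
    by (simp add: o_def mult.commute has_vector_derivative_at_within)
qed

text \<open>The two halves of the line Re u = s are conjugate, which leaves a cosine. The choice s =
  0 gives the integrand of \<open>Ai\<close>, the choice s = sqrt y removes the linear term of the
  phase.\<close>

lemma vertical_difference:
  assumes Y: "Y \<ge> 0"
  shows "F (of_real s + \<i> * of_real Y) - F (of_real s - \<i> * of_real Y)
    = 2 * \<i> * of_real (exp (s ^ 3 / 3 - y * s) *
        integral {0..Y} (\<lambda>t. exp (- (s * t\<^sup>2)) * cos (t ^ 3 / 3 + (y - s\<^sup>2) * t)))"
proof -
  let ?g = "\<lambda>t. exp (s ^ 3 / 3 - y * s) * (exp (- (s * t\<^sup>2)) * cos (t ^ 3 / 3 + (y - s\<^sup>2) * t))"
  have e: "exp ((of_real s + 1 * \<i> * of_real t) ^ 3 / 3 - of_real y * (of_real s + 1 * \<i> * of_real t)) * (1 * \<i>)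
     - exp ((of_real s + (-1) * \<i> * of_real t) ^ 3 / 3 - of_real y * (of_real s + (-1) * \<i> * of_real t)) * ((-1) * \<i>)
     = 2 * \<i> * complex_of_real (?g t)" for t
  proof -
    define b where "b = t ^ 3 / 3 + (y - s\<^sup>2) * t"
    have 1: "(of_real s + c * \<i> * of_real t) ^ 3 / 3 - of_real y * (of_real s + c * \<i> * of_real t)
       = complex_of_real (s ^ 3 / 3 - y * s - s * t\<^sup>2) - c * \<i> * of_real b" if "c = 1 \<or> c = -1" for c :: complex
    proof -
      \<comment> \<open>One expansion of the cube serves the upper and the lower half line, j = \<i>
        and j = -\<i>.\<close>
      have j: "j * j = - 1 \<Longrightarrow> (S + j * T) ^ 3 = S ^ 3 - 3 * S * T\<^sup>2 + j * (3 * S\<^sup>2 * T - T ^ 3)" for j S T :: complex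
      proof -
        assume j: "j * j = - 1"
        have jj: "j * (j * x) = - x" for x by (simp add: j flip: mult.assoc)
        show ?thesis by (simp add: power3_eq_cube power2_eq_square algebra_simps jj j)
      qed
      have "(c * \<i>) * (c * \<i>) = - 1" using that by auto
      show ?thesis unfolding j[OF \<open>(c * \<i>) * (c * \<i>) = - 1\<close>] b_def
        by (simp add: add_divide_distrib diff_divide_distrib algebra_simps)
    qed
    have "exp (complex_of_real a - \<i> * of_real b) + exp (complex_of_real a + \<i> * of_real b) = of_real (2 * exp a * cos b)" for a
      by (simp add: complex_eq_iff Re_exp Im_exp)
    note 2 = this[of "s ^ 3 / 3 - y * s - s * t\<^sup>2"]
    have 3: "?g t = exp (s ^ 3 / 3 - y * s - s * t\<^sup>2) * cos b"
      unfolding b_def diff_conv_add_uminus[of "s ^ 3 / 3 - y * s"] exp_add by (simp only: mult.assoc)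
    have "exp (complex_of_real (s ^ 3 / 3 - y * s - s * t\<^sup>2) - 1 * \<i> * of_real b) * (1 * \<i>)
       - exp (complex_of_real (s ^ 3 / 3 - y * s - s * t\<^sup>2) - (- 1) * \<i> * of_real b) * ((- 1) * \<i>)
       = \<i> * (exp (complex_of_real (s ^ 3 / 3 - y * s - s * t\<^sup>2) - \<i> * of_real b) + exp (complex_of_real (s ^ 3 / 3 - y * s - s * t\<^sup>2) + \<i> * of_real b))"
      by (simp add: algebra_simps)
    also have "\<dots> = 2 * \<i> * complex_of_real (?g t)" unfolding 2 3 by simp
    finally show ?thesis by (simp only: 1[of 1, OF disjI1[OF refl]] 1[of "-1", OF disjI2[OF refl]])
  qed
  have "((\<lambda>t. 2 * \<i> * complex_of_real (?g t)) has_integral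
     (F (of_real s + 1 * \<i> * of_real Y) - F (of_real s + (-1) * \<i> * of_real Y)
      - (F (of_real s + 1 * \<i> * of_real 0) - F (of_real s + (-1) * \<i> * of_real 0)))) {0..Y}"
  proof (rule fundamental_theorem_of_calculus[OF Y])
    fix t
    show "((\<lambda>t. F (of_real s + 1 * \<i> * of_real t) - F (of_real s + (-1) * \<i> * of_real t))
        has_vector_derivative 2 * \<i> * complex_of_real (?g t)) (at t within {0..Y})"
      using has_vector_derivative_diff[OF has_vector_derivative_vertical[of s 1 t "{0..Y}"]
          has_vector_derivative_vertical[of s "-1" t "{0..Y}"]]
      unfolding e .
  qed
  then have 1: "((\<lambda>t. 2 * \<i> * complex_of_real (?g t)) has_integral
     (F (of_real s + \<i> * of_real Y) - F (of_real s - \<i> * of_real Y))) {0..Y}"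
    by (simp only: mult_1_left mult_minus_left of_real_0 mult_zero_right add_0_right minus_zero diff_self diff_zero add_uminus_conv_diff)
  have "(?g has_integral integral {0..Y} ?g) {0..Y}"
    by (intro integrable_integral integrable_continuous_real continuous_intros) auto
  from has_integral_mult_right[OF has_integral_of_real[OF this], of "2 * \<i>"]
  have "((\<lambda>t. 2 * \<i> * complex_of_real (?g t)) has_integral (2 * \<i> * complex_of_real (integral {0..Y} ?g))) {0..Y}" .
  from has_integral_unique[OF 1 this] show ?thesis
    by (simp only: Henstock_Kurzweil_Integration.integral_mult_right)
qed

text \<open>At height Y the real part of the phase is t (t^2/3 - Y^2 - y). For t \<le> |Y| + C and 2
  C \<le> |Y| one has t^2 \<le> (5/2) Y^2, so this is at most -t Y^2/6, and the segment contributes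
  at most the integral of exp(-t Y^2/6). The slack C is there for contours that leave along the
  diagonal up to a bounded shift.\<close>

lemma horizontal_difference:
  assumes p: "p \<ge> 0" "p \<le> \<bar>Y\<bar> + C" and C: "C \<ge> 0" and Y: "\<bar>Y\<bar> \<ge> 2 * C" "Y \<noteq> 0"
  shows "norm (F (of_real p + \<i> * of_real Y) - F (\<i> * of_real Y)) \<le> 6 / Y\<^sup>2"
proof (cases "p = 0")
  case False
  then have p0: "0 < p" using p by simp
  let ?\<phi> = "\<lambda>t. - (6 / Y\<^sup>2) * exp (- (t * Y\<^sup>2 / 6))"
  have Y2: "Y\<^sup>2 > 0" using Y by auto
  have "norm (F (of_real p + \<i> * of_real Y) - F (of_real 0 + \<i> * of_real Y)) \<le> ?\<phi> p - ?\<phi> 0"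
  proof (rule differentiable_bound_general[OF p0])
    have d: "((\<lambda>t. F (of_real t + \<i> * of_real Y)) has_vector_derivative
       exp ((of_real t + \<i> * of_real Y) ^ 3 / 3 - of_real y * (of_real t + \<i> * of_real Y))) (at t)" for t
    proof -
      have "((\<lambda>t. of_real t + \<i> * of_real Y :: complex) has_vector_derivative 1) (at t)"
        by (auto intro!: derivative_eq_intros simp: has_vector_derivative_def fun_eq_iff scaleR_conv_of_real)
      from field_vector_diff_chain_at[OF this F] show ?thesis by (simp add: o_def)
    qed
    show "((\<lambda>t. F (of_real t + \<i> * of_real Y)) has_vector_derivative
       exp ((of_real t + \<i> * of_real Y) ^ 3 / 3 - of_real y * (of_real t + \<i> * of_real Y))) (at t)" for t by (rule d)
    show "continuous_on {0..p} (\<lambda>t. F (of_real t + \<i> * of_real Y))"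
      by (rule continuous_on_vector_derivative) (rule has_vector_derivative_at_within[OF d])
    show "(?\<phi> has_vector_derivative exp (- (t * Y\<^sup>2 / 6))) (at t)" for t
      using Y2 Y by (auto intro!: derivative_eq_intros simp: power2_eq_square simp flip: has_real_derivative_iff_has_vector_derivative)
    show "continuous_on {0..p} ?\<phi>" by (intro continuous_intros) auto
    show "norm (exp ((of_real t + \<i> * of_real Y) ^ 3 / 3 - of_real y * (of_real t + \<i> * of_real Y))) \<le> exp (- (t * Y\<^sup>2 / 6))"
      if t: "0 < t" "t < p" for t
    proof -
      have "Re ((of_real t + \<i> * of_real Y) ^ 3 / 3 - of_real y * (of_real t + \<i> * of_real Y)) = t * (t\<^sup>2 / 3 - Y\<^sup>2 - y)"
        by (simp add: power3_eq_cube power2_eq_square field_simps)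
      also have "\<dots> \<le> t * (- (Y\<^sup>2 / 6))"
      proof (rule mult_left_mono)
        have "t\<^sup>2 \<le> (\<bar>Y\<bar> + C)\<^sup>2" using t p by (intro power_mono) auto
        also have "\<dots> \<le> 2 * Y\<^sup>2 + 2 * C\<^sup>2"
          using sum_squares_ge_zero[of "\<bar>Y\<bar> - C" 0] by (simp add: power2_eq_square algebra_simps)
        also have "C\<^sup>2 \<le> Y\<^sup>2 / 4"
          using power_mono[of "2 * C" "\<bar>Y\<bar>" 2] C Y by simp
        finally show "t\<^sup>2 / 3 - Y\<^sup>2 - y \<le> - (Y\<^sup>2 / 6)" using y by simp
      qed (use t in simp)
      finally show ?thesis by simp
    qed
  qed
  also have "\<dots> \<le> 6 / Y\<^sup>2" using Y2 by simp
  finally show ?thesis by simp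
qed simp

lemma sector_difference_le:
  assumes p: "0 \<le> p" "p \<le> Y + C" and C: "C \<ge> 0" and Y: "2 * C \<le> Y" "0 < Y"
  shows "norm ((F (of_real p + \<i> * of_real Y) - F (of_real p - \<i> * of_real Y))
      - (F (\<i> * of_real Y) - F (- (\<i> * of_real Y)))) \<le> 12 / Y\<^sup>2"
proof -
  have "norm (F (of_real p + \<i> * of_real Y) - F (\<i> * of_real Y)) \<le> 6 / Y\<^sup>2"
    using assms by (intro horizontal_difference[where C = C]) auto
  moreover have "norm (F (of_real p + \<i> * of_real (- Y)) - F (\<i> * of_real (- Y))) \<le> 6 / (- Y)\<^sup>2"
    using assms by (intro horizontal_difference[where C = C]) auto
  ultimately have "norm ((F (of_real p + \<i> * of_real Y) - F (\<i> * of_real Y))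
      - (F (of_real p + \<i> * of_real (- Y)) - F (\<i> * of_real (- Y)))) \<le> 6 / Y\<^sup>2 + 6 / (- Y)\<^sup>2"
    by (rule norm_triangle_le_diff[OF add_mono])
  also have "(F (of_real p + \<i> * of_real Y) - F (\<i> * of_real Y))
      - (F (of_real p + \<i> * of_real (- Y)) - F (\<i> * of_real (- Y)))
      = (F (of_real p + \<i> * of_real Y) - F (of_real p - \<i> * of_real Y))
      - (F (\<i> * of_real Y) - F (- (\<i> * of_real Y)))" by simp
  finally show ?thesis by simp
qed

text \<open>Replaces the ends of the imaginary axis, which bounds the sector where exp(u^3/3)
  decays, by any conjugate end points with 0 \<le> Re u \<le> |Im u| + C. The hyperbola of nodes
  ends at such points.\<close>

lemma tendsto_sector_difference:
  assumes lim: "((\<lambda>Y. F (\<i> * of_real Y) - F (- (\<i> * of_real Y))) \<longlongrightarrow> l) at_top"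
    and p: "\<forall>\<^sub>F t in G. 0 \<le> p t \<and> p t \<le> Y t + C" and C: "C \<ge> 0" and Y: "filterlim Y at_top G"
  shows "((\<lambda>t. F (of_real (p t) + \<i> * of_real (Y t)) - F (of_real (p t) - \<i> * of_real (Y t))) \<longlongrightarrow> l) G"
proof -
  have "\<forall>\<^sub>F t in G. 2 * C < Y t"
    using Y by (simp add: filterlim_at_top_dense)
  with p have "\<forall>\<^sub>F t in G. norm ((F (of_real (p t) + \<i> * of_real (Y t)) - F (of_real (p t) - \<i> * of_real (Y t)))
      - (F (\<i> * of_real (Y t)) - F (- (\<i> * of_real (Y t))))) \<le> 12 / (Y t)\<^sup>2"
    by eventually_elim (use C in \<open>auto intro!: sector_difference_le[where C = C]\<close>)
  moreover have "((\<lambda>t. 12 / (Y t)\<^sup>2) \<longlongrightarrow> 0) G"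
    using Y by (intro tendsto_divide_0[OF tendsto_const] filterlim_at_top_imp_at_infinity filterlim_pow_at_top) auto
  ultimately have "((\<lambda>t. (F (of_real (p t) + \<i> * of_real (Y t)) - F (of_real (p t) - \<i> * of_real (Y t)))
      - (F (\<i> * of_real (Y t)) - F (- (\<i> * of_real (Y t))))) \<longlongrightarrow> 0) G"
    by (rule Lim_null_comparison)
  from tendsto_add[OF this filterlim_compose[OF lim Y]] show ?thesis by simp
qed

end

lemma integral_tendsto_improper:
  fixes f :: "real \<Rightarrow> 'a::banach"
  assumes "f integrable_on {0..}"
  shows "((\<lambda>Y. integral {0..Y} f) \<longlongrightarrow> integral {0..} f) at_top"
proof (rule tendstoI)
  fix e :: real assume e: "e > 0"
  from integrable_integral[OF assms, unfolded has_integral_alt'] e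
  obtain B where B: "B > 0" "\<And>a b. ball 0 B \<subseteq> cbox a b \<Longrightarrow>
      norm (integral (cbox a b) (\<lambda>x. if x \<in> {0..} then f x else 0) - integral {0..} f) < e"
    by blast
  show "\<forall>\<^sub>F Y in at_top. dist (integral {0..Y} f) (integral {0..} f) < e"
    using eventually_ge_at_top[of B]
  proof eventually_elim
    case (elim Y)
    have i: "{0..Y} = {0..} \<inter> cbox (- Y) Y" using elim B(1) by auto
    have "integral (cbox (- Y) Y) (\<lambda>x. if x \<in> {0..} then f x else 0) = integral {0..Y} f"
      using integral_restrict_Int[of "cbox (- Y) Y" "{0..}" f] i by (metis Int_commute)
    moreover have "ball 0 B \<subseteq> cbox (- Y) Y" using elim by (auto simp: dist_real_def)
    ultimately show ?case using B(2)[of "- Y" Y] by (simp add: dist_norm)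
  qed
qed

section \<open>Two-sided Airy bounds\<close>

text \<open>The leading asymptotics of Ai at +infinity, without the factor 1/(2 sqrt pi).\<close>

definition airy_decay :: "real \<Rightarrow> real" where
  "airy_decay y = exp (- (2/3) * sqrt y ^ 3) / sqrt (sqrt y)"

lemma airy_decay_pos: "y > 0 \<Longrightarrow> airy_decay y > 0"
  by (simp add: airy_decay_def)

text \<open>Tangent line inequality for the convex function (2/3) y^(3/2), whose derivative is sqrt
  y. In terms of s = sqrt y and s' = sqrt y' the gap is (2/3) (s' - s)^2 (s' + s/2).\<close>

lemma airy_decay_mono:
  assumes "1 \<le> y" "y \<le> y'"
  shows "airy_decay y' \<le> airy_decay y * exp (- sqrt y * (y' - y))"
proof -
  define s s' where "s = sqrt y" and "s' = sqrt y'"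
  have s: "1 \<le> s" "s \<le> s'" "y = s\<^sup>2" "y' = s'\<^sup>2" using assms by (auto simp: s_def s'_def)
  have "0 \<le> (s' - s)\<^sup>2 * (s' + s / 2)" using s by auto
  then have "s * (s'\<^sup>2 - s\<^sup>2) \<le> 2/3 * s' ^ 3 - 2/3 * s ^ 3"
    by (simp add: power2_eq_square power3_eq_cube algebra_simps)
  then have "exp (- (2/3) * s' ^ 3) \<le> exp (- (2/3) * s ^ 3) * exp (- s * (s'\<^sup>2 - s\<^sup>2))"
    unfolding exp_add[symmetric] by simp
  moreover have "1 / sqrt s' \<le> 1 / sqrt s" using s by (intro divide_left_mono) auto
  ultimately have "exp (- (2/3) * s' ^ 3) * (1 / sqrt s') \<le> (exp (- (2/3) * s ^ 3) * exp (- s * (s'\<^sup>2 - s\<^sup>2))) * (1 / sqrt s)"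
    using s by (intro mult_mono) auto
  then show ?thesis
    unfolding airy_decay_def s_def[symmetric] s'_def[symmetric] s(3,4)[symmetric] by (simp add: mult_ac)
qed

text \<open>
  The contour is moved from the imaginary axis to \<open>Re u = sqrt y\<close>, the saddle point, where the
  linear term of the phase vanishes and the integrand is a Gaussian times \<open>cos (t ^ 3 / 3)\<close>.
\<close>

lemma Ai_as_limit:
  assumes y: "y \<ge> 1"
    and F: "\<And>u. (F has_field_derivative exp (u ^ 3 / 3 - complex_of_real y * u)) (at u)"
  shows "((\<lambda>Y. F (\<i> * of_real Y) - F (- (\<i> * of_real Y))) \<longlongrightarrow> 2 * of_real pi * \<i> * of_real (Ai y)) at_top"
    and "((\<lambda>Y. integral {0..Y} (\<lambda>t. cos (t ^ 3 / 3 + y * t))) \<longlongrightarrow> pi * Ai y) at_top"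
    and "airy_decay y / (6 * pi) \<le> Ai y" and "Ai y \<le> 2 / pi * airy_decay y"
proof -
  define s where "s = sqrt y"
  have s: "s \<ge> 1" "s\<^sup>2 = y" using y by (auto simp: s_def)
  have y0: "y > 0" using y by simp
  let ?f = "\<lambda>t. exp (- (s * t\<^sup>2)) * cos (t ^ 3 / 3)"
  have "?f integrable_on {0..}"
  proof (rule measurable_bounded_by_integrable_imp_integrable)
    show "?f \<in> borel_measurable (lebesgue_on {0..})"
      by (intro continuous_imp_measurable_on_sets_lebesgue continuous_intros) auto
    show "(\<lambda>t. exp 1 * exp (- 1 * t)) integrable_on {0::real..}"
      using integrable_cmul[OF integrable_on_exp_minus_to_infinity[of 1 0], of "exp 1"] by simp
    show "norm (?f t) \<le> exp 1 * exp (- 1 * t)" if "t \<in> {0..}" for t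
    proof -
      have "norm (?f t) \<le> exp (- (s * t\<^sup>2)) * 1"
        unfolding norm_mult by (intro mult_mono) auto
      also have "\<dots> \<le> exp (1 - t)"
      proof -
        have "1 * t\<^sup>2 \<le> s * t\<^sup>2" using s by (intro mult_right_mono) auto
        moreover have "0 \<le> (t - 1/2)\<^sup>2" by simp
        ultimately have "t \<le> 1 + s * t\<^sup>2" by (simp add: power2_eq_square algebra_simps)
        then show ?thesis by simp
      qed
      finally show ?thesis by (simp flip: exp_add)
    qed
  qed auto
  define L where "L = integral {0..} ?f"
  have L: "((\<lambda>Y. integral {0..Y} ?f) \<longlongrightarrow> L) at_top"
    unfolding L_def by (rule integral_tendsto_improper) fact
  have ev: "\<forall>\<^sub>F Y::real in at_top. Y \<ge> 1" by (rule eventually_ge_at_top)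
  have L1: "L \<le> 2 / sqrt s"
    by (rule tendsto_upperbound[OF L eventually_mono[OF ev integral_exp_neg_square_cos_bounds(1)]]) (use s in auto)
  have L2: "1 / (6 * sqrt s) \<le> L"
    by (rule tendsto_lowerbound[OF L eventually_mono[OF ev integral_exp_neg_square_cos_bounds(2)]]) (use s in auto)
  define c where "c = exp (s ^ 3 / 3 - y * s)"
  have c: "c = exp (- (2/3) * s ^ 3)"
    unfolding c_def s(2)[symmetric] by (simp add: power2_eq_square power3_eq_cube)
  have "((\<lambda>Y. F (of_real s + \<i> * of_real Y) - F (of_real s - \<i> * of_real Y)) \<longlongrightarrow> 2 * \<i> * of_real (c * L)) at_top"
  proof (rule Lim_transform_eventually)
    show "((\<lambda>Y. 2 * \<i> * of_real (c * integral {0..Y} ?f)) \<longlongrightarrow> 2 * \<i> * of_real (c * L)) at_top"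
      by (intro tendsto_intros L)
    show "\<forall>\<^sub>F Y in at_top. 2 * \<i> * of_real (c * integral {0..Y} ?f)
        = F (of_real s + \<i> * of_real Y) - F (of_real s - \<i> * of_real Y)"
      using ev by eventually_elim (simp add: vertical_difference[OF F y0] s c_def)
  qed
  moreover have "((\<lambda>Y. (F (of_real s + \<i> * of_real Y) - F (of_real s - \<i> * of_real Y))
      - (F (\<i> * of_real Y) - F (- (\<i> * of_real Y)))) \<longlongrightarrow> 0) at_top"
  proof (rule Lim_null_comparison)
    show "((\<lambda>Y::real. 12 / Y\<^sup>2) \<longlongrightarrow> 0) at_top" by real_asymp
    show "\<forall>\<^sub>F Y in at_top. norm ((F (of_real s + \<i> * of_real Y) - F (of_real s - \<i> * of_real Y))
      - (F (\<i> * of_real Y) - F (- (\<i> * of_real Y)))) \<le> 12 / Y\<^sup>2"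
      using eventually_ge_at_top[of "2 * s"]
    proof eventually_elim
      case (elim Y)
      show ?case using sector_difference_le[OF F y0, of s Y s] elim s by simp
    qed
  qed
  ultimately have 1: "((\<lambda>Y. F (\<i> * of_real Y) - F (- (\<i> * of_real Y))) \<longlongrightarrow> 2 * \<i> * of_real (c * L)) at_top"
    using tendsto_diff by fastforce
  have "((\<lambda>Y. Im (F (\<i> * of_real Y) - F (- (\<i> * of_real Y))) / 2) \<longlongrightarrow> c * L) at_top"
    using tendsto_divide[OF tendsto_Im[OF 1] tendsto_const[of 2]] by simp
  then have 2: "((\<lambda>Y. integral {0..Y} (\<lambda>t. cos (t ^ 3 / 3 + y * t))) \<longlongrightarrow> c * L) at_top"
  proof (rule Lim_transform_eventually)
    show "\<forall>\<^sub>F Y in at_top. Im (F (\<i> * of_real Y) - F (- (\<i> * of_real Y))) / 2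
        = integral {0..Y} (\<lambda>t. cos (t ^ 3 / 3 + y * t))"
      using ev
    proof eventually_elim
      case (elim Y)
      from vertical_difference[OF F y0, of Y 0] elim show ?case by simp
    qed
  qed
  \<comment> \<open>Here the integral defining \<open>Ai\<close> is seen to converge, so that
    \<open>Ai y\<close> is not a default value.\<close>
  have "((\<lambda>t. cos (t ^ 3 / 3 + y * t)) has_integral c * L) {0..}"
    by (rule has_integral_improper_right[OF _ 2]) (auto intro!: continuous_intros)
  then have A: "Ai y = c * L / pi" unfolding Ai_def by (simp add: integral_unique)
  show "((\<lambda>Y. F (\<i> * of_real Y) - F (- (\<i> * of_real Y))) \<longlongrightarrow> 2 * of_real pi * \<i> * of_real (Ai y)) at_top"
    using 1 by (simp add: A mult_ac)
  show "((\<lambda>Y. integral {0..Y} (\<lambda>t. cos (t ^ 3 / 3 + y * t))) \<longlongrightarrow> pi * Ai y) at_top"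
    using 2 by (simp add: A)
  have d: "airy_decay y = c * (1 / sqrt s)" by (simp add: airy_decay_def c s_def)
  have c0: "c \<ge> 0" by (simp add: c_def)
  show "Ai y \<le> 2 / pi * airy_decay y"
    using mult_left_mono[OF L1 c0] unfolding A d by (simp add: field_simps)
  show "airy_decay y / (6 * pi) \<le> Ai y"
    using mult_left_mono[OF L2 c0] unfolding A d by (simp add: field_simps)
qed

lemma Ai_lower: "y \<ge> 1 \<Longrightarrow> airy_decay y / (6 * pi) \<le> Ai y"
  and Ai_upper: "y \<ge> 1 \<Longrightarrow> Ai y \<le> 2 / pi * airy_decay y"
  by (rule exp_cubic_primitive[of y], rule Ai_as_limit, assumption+)+

lemma Ai_pos: "y \<ge> 1 \<Longrightarrow> Ai y > 0"
  by (rule less_le_trans[OF _ Ai_lower]) (auto intro!: divide_pos_pos airy_decay_pos)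

lemma Ai_le_decay: "y \<ge> 1 \<Longrightarrow> Ai y \<le> airy_decay y"
  using Ai_upper[of y] airy_decay_pos[of y] pi_gt3
  by (auto intro!: order_trans[OF Ai_upper] mult_left_le_one_le simp: field_simps)

text \<open>For y \<ge> 1 the value \<open>Ai y\<close> is a limit of truncated integrals, which are
  continuous in y; below 1 the function is cut to 0.\<close>

lemma Ai_measurable: "(\<lambda>y. if y \<ge> 1 then Ai y else 0) \<in> borel_measurable borel"
proof (rule borel_measurable_LIMSEQ_real)
  let ?g = "\<lambda>n y. if y \<ge> 1 then integral {0..real n} (\<lambda>t. cos (t ^ 3 / 3 + y * t)) / pi else 0"
  show "(\<lambda>n. ?g n y) \<longlonglongrightarrow> (if y \<ge> 1 then Ai y else 0)" for y
  proof (cases "y \<ge> 1")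
    case True
    obtain F where F: "\<And>u. (F has_field_derivative exp (u ^ 3 / 3 - complex_of_real y * u)) (at u)"
      using exp_cubic_primitive[of y] by blast
    have "(\<lambda>n. integral {0..real n} (\<lambda>t. cos (t ^ 3 / 3 + y * t))) \<longlonglongrightarrow> pi * Ai y"
      using filterlim_compose[OF Ai_as_limit(2)[OF True F] filterlim_real_sequentially] by simp
    from tendsto_divide[OF this tendsto_const[of pi]] show ?thesis using True by simp
  qed simp
  show "?g n \<in> borel_measurable borel" for n
  proof -
    have "continuous_on UNIV (\<lambda>y. integral (cbox 0 (real n)) (\<lambda>t. cos (t ^ 3 / 3 + y * t)))"
      by (rule integral_continuous_on_param) (auto intro!: continuous_intros simp: case_prod_unfold)
    then have "(\<lambda>y. integral {0..real n} (\<lambda>t. cos (t ^ 3 / 3 + y * t))) \<in> borel_measurable borel"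
      by (simp add: borel_measurable_continuous_onI)
    then show ?thesis by measurable
  qed
qed

section \<open>The tail of the GUE Tracy--Widom distribution\<close>

abbreviation pos_lborel :: "real measure" where "pos_lborel \<equiv> restrict_space lborel {0<..}"

text \<open>The trace of A_y^2: with v = s + u the double integral of Ai(s + y + u)^2 over s, u > 0
  collapses to a single one, and the factor v is the length of the fibre.\<close>

definition airy_trace :: "real \<Rightarrow> real" where
  "airy_trace y = (\<integral>v. v * (Ai (y + v))\<^sup>2 \<partial>pos_lborel)"

text \<open>If \<open>f\<close> is not integrable, its Bochner integral is 0 by convention and the
  bound still holds. Kernels and determinants can thus be estimated from pointwise bounds
  alone.\<close>

lemma norm_integral_le:
  fixes f :: "'a \<Rightarrow> 'b::{banach, second_countable_topology}"
  assumes g: "integrable M g" and b: "\<And>x. x \<in> space M \<Longrightarrow> norm (f x) \<le> g x"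
  shows "norm (\<integral>x. f x \<partial>M) \<le> (\<integral>x. g x \<partial>M)"
proof (cases "integrable M f")
  case True
  have "norm (\<integral>x. f x \<partial>M) \<le> (\<integral>x. norm (f x) \<partial>M)" by (rule Bochner_Integration.integral_norm_bound)
  also have "\<dots> \<le> (\<integral>x. g x \<partial>M)" by (rule integral_mono[OF integrable_norm[OF True] g b])
  finally show ?thesis .
next
  case False
  have "0 \<le> (\<integral>x. g x \<partial>M)"
    by (rule Bochner_Integration.integral_nonneg) (meson b norm_ge_zero order_trans)
  then show ?thesis using False by (simp add: not_integrable_integral_eq)
qed

lemma nn_integral_pos_lborel:
  "f \<in> borel_measurable borel \<Longrightarrow> (\<integral>\<^sup>+v. f v \<partial>pos_lborel) = (\<integral>\<^sup>+v. f v * indicator {0..} v \<partial>lborel)"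
  unfolding nn_integral_restrict_space[of "{0<..}" lborel f, simplified]
proof (rule nn_integral_cong_AE)
  have "AE v in lborel. (v::real) \<noteq> 0" by (rule AE_lborel_singleton)
  then show "AE x in lborel. f x * indicator {0<..} x = f x * indicator {0..} x"
    by eventually_elim (auto simp: indicator_def)
qed

lemma has_bochner_integral_pos_lborel:
  assumes f: "f \<in> borel_measurable borel" and F: "\<And>x. 0 \<le> x \<Longrightarrow> (F has_real_derivative f x) (at x)"
    and nonneg: "\<And>x. 0 \<le> x \<Longrightarrow> 0 \<le> f x" and lim: "(F \<longlongrightarrow> T) at_top"
  shows "has_bochner_integral pos_lborel f (T - F 0)"
proof (rule has_bochner_integral_nn_integral)
  show "f \<in> borel_measurable pos_lborel" using f by (auto intro: measurable_restrict_space1)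
  show "AE x in pos_lborel. 0 \<le> f x" by (rule AE_I2) (use nonneg in \<open>auto simp: space_restrict_space\<close>)
  have "F 0 \<le> F x" if "x \<ge> 0" for x
    by (rule DERIV_nonneg_imp_nondecreasing[OF that]) (use F nonneg in auto)
  then show "0 \<le> T - F 0"
    using tendsto_lowerbound[OF lim, of "F 0"] eventually_mono[OF eventually_ge_at_top[of 0], of "\<lambda>x. F 0 \<le> F x"] by simp
  show "(\<integral>\<^sup>+x. ennreal (f x) \<partial>pos_lborel) = ennreal (T - F 0)"
    using f by (subst nn_integral_pos_lborel) (auto intro!: nn_integral_FTC_atLeast F nonneg lim)
qed

lemma has_bochner_integral_exp_ray:
  fixes a :: real
  assumes "a > 0"
  shows "has_bochner_integral pos_lborel (\<lambda>v. exp (- (a * v))) (1 / a)"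
    and "has_bochner_integral pos_lborel (\<lambda>v. v * exp (- (a * v))) (1 / a\<^sup>2)"
proof -
  have "has_bochner_integral pos_lborel (\<lambda>v. exp (- (a * v))) (0 - (\<lambda>v. - (1 / a) * exp (- (a * v))) 0)"
  proof (rule has_bochner_integral_pos_lborel)
    show "((\<lambda>v. - (1 / a) * exp (- (a * v))) \<longlongrightarrow> 0) at_top" using assms by real_asymp
  qed (use assms in \<open>auto intro!: derivative_eq_intros\<close>)
  then show "has_bochner_integral pos_lborel (\<lambda>v. exp (- (a * v))) (1 / a)" by simp
  have "has_bochner_integral pos_lborel (\<lambda>v. v * exp (- (a * v))) (0 - (\<lambda>v. - (v * (1 / a) + 1 / a\<^sup>2) * exp (- (a * v))) 0)"
  proof (rule has_bochner_integral_pos_lborel)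
    show "((\<lambda>v. - (v * (1 / a) + 1 / a\<^sup>2) * exp (- (a * v))) \<longlongrightarrow> 0) at_top" using assms by real_asymp
    fix v :: real
    have "((\<lambda>v. - (v * k + c) * exp (- (a * v))) has_real_derivative (- k * exp (- (a * v)) + (v * k + c) * a * exp (- (a * v)))) (at v)" for k c
      by (auto intro!: derivative_eq_intros simp: algebra_simps)
    from this[of "1 / a" "1 / a\<^sup>2"] assms
    show "((\<lambda>v. - (v * (1 / a) + 1 / a\<^sup>2) * exp (- (a * v))) has_real_derivative v * exp (- (a * v))) (at v)"
      by (simp add: power2_eq_square field_simps)
  qed auto
  then show "has_bochner_integral pos_lborel (\<lambda>v. v * exp (- (a * v))) (1 / a\<^sup>2)" by simp
qed

lemma Ai_shift_le:
  assumes "y \<ge> 1" "v \<ge> 0"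
  shows "0 < Ai (y + v)" "Ai (y + v) \<le> airy_decay y * exp (- v)"
proof -
  show "0 < Ai (y + v)" using assms by (intro Ai_pos) auto
  have "Ai (y + v) \<le> airy_decay (y + v)" using assms by (intro Ai_le_decay) auto
  also have "\<dots> \<le> airy_decay y * exp (- sqrt y * (y + v - y))" using assms by (intro airy_decay_mono) auto
  also have "\<dots> \<le> airy_decay y * exp (- v)"
    using assms airy_decay_pos[of y] mult_right_mono[of 1 "sqrt y" v] by (intro mult_left_mono) auto
  finally show "Ai (y + v) \<le> airy_decay y * exp (- v)" .
qed

lemma Ai_shift_measurable:
  assumes "y \<ge> 1"
  shows "(\<lambda>v. Ai (y + v)) \<in> borel_measurable pos_lborel"
proof -
  have "(\<lambda>v. if y + v \<ge> 1 then Ai (y + v) else 0) \<in> borel_measurable borel"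
    using measurable_compose[OF _ Ai_measurable, of "\<lambda>v. y + v" borel] by measurable
  then have "(\<lambda>v. if y + v \<ge> 1 then Ai (y + v) else 0) \<in> borel_measurable pos_lborel"
    by (auto intro: measurable_restrict_space1)
  then show ?thesis
    by (rule measurable_cong[THEN iffD1, rotated]) (use assms in \<open>auto simp: space_restrict_space\<close>)
qed

lemma integrable_airy_trace:
  assumes y: "y \<ge> 1"
  shows "integrable pos_lborel (\<lambda>v. v * (Ai (y + v))\<^sup>2)"
proof (rule Bochner_Integration.integrable_bound)
  show "integrable pos_lborel (\<lambda>v. (airy_decay y)\<^sup>2 * (v * exp (- (2 * v))))"
    using has_bochner_integral_exp_ray(2)[of 2] by (auto simp: has_bochner_integral_iff)
  show "(\<lambda>v. v * (Ai (y + v))\<^sup>2) \<in> borel_measurable pos_lborel"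
  proof -
    note [measurable] = Ai_shift_measurable[OF y]
    have [measurable]: "(\<lambda>v. v) \<in> borel_measurable pos_lborel" by (auto intro: measurable_restrict_space1)
    show ?thesis by measurable
  qed
  show "AE v in pos_lborel. norm (v * (Ai (y + v))\<^sup>2) \<le> norm ((airy_decay y)\<^sup>2 * (v * exp (- (2 * v))))"
  proof (rule AE_I2)
    fix v assume "v \<in> space pos_lborel"
    then have v: "v > 0" by (auto simp: space_restrict_space)
    have "(Ai (y + v))\<^sup>2 \<le> (airy_decay y * exp (- v))\<^sup>2"
      using Ai_shift_le[OF y, of v] v by (intro power_mono) auto
    also have "\<dots> = (airy_decay y)\<^sup>2 * exp (- (2 * v))"
      by (simp add: power_mult_distrib flip: exp_double)
    finally show "norm (v * (Ai (y + v))\<^sup>2) \<le> norm ((airy_decay y)\<^sup>2 * (v * exp (- (2 * v))))"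
      using v by (simp add: abs_mult mult.left_commute)
  qed
qed

text \<open>Only 1 < v < 2 is kept. There \<open>Ai (y + v)\<close> is at least
  \<open>airy_decay (y + 2)\<close> divided by 6 pi, and 6 pi \<le> 20 gives 400 = 20^2. The shift
  by 2 costs a factor exp(O(sqrt y)), which the later comparison can afford.\<close>

lemma airy_trace_lower:
  assumes y: "y \<ge> 1"
  shows "(airy_decay (y + 2))\<^sup>2 / 400 \<le> airy_trace y"
proof -
  define c where "c = (airy_decay (y + 2))\<^sup>2 / 400"
  have c0: "c \<ge> 0" by (simp add: c_def)
  have i12: "{1<..<2} \<inter> {0<..} = {1<..<2::real}" by auto
  have m: "emeasure pos_lborel {1<..<2::real} = ennreal 1"
    by (subst emeasure_restrict_space) auto
  have i: "integrable pos_lborel (\<lambda>v. c * indicator {1<..<2::real} v)"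
    by (intro integrable_mult_right integrable_real_indicator) (auto simp: m sets_restrict_space)
  have "c = (\<integral>v. c * indicator {1<..<2::real} v \<partial>pos_lborel)"
    using m by (simp add: measure_def space_restrict_space i12)
  also have "\<dots> \<le> airy_trace y" unfolding airy_trace_def
  proof (rule integral_mono[OF i integrable_airy_trace[OF y]])
    fix v assume "v \<in> space pos_lborel"
    then have v: "v > 0" by (auto simp: space_restrict_space)
    show "c * indicator {1<..<2::real} v \<le> v * (Ai (y + v))\<^sup>2"
    proof (cases "v \<in> {1<..<2}")
      case True
      have pp: "pi * 6 \<le> 20" using pi_less_4 pi_approx by simp
      have d: "airy_decay (y + 2) > 0" using y by (intro airy_decay_pos) auto
      have "airy_decay (y + 2) \<le> airy_decay (y + v) * exp (- sqrt (y + v) * ((y + 2) - (y + v)))"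
        using True y by (intro airy_decay_mono) auto
      also have "\<dots> \<le> airy_decay (y + v) * 1"
        using True y airy_decay_pos[of "y + v"] by (intro mult_left_mono) (auto simp: mult_nonneg_nonneg)
      finally have "airy_decay (y + 2) / 20 \<le> airy_decay (y + v) / (6 * pi)"
        using pp d by (intro frac_le) auto
      also have "\<dots> \<le> Ai (y + v)" using True y by (intro Ai_lower) auto
      finally have "(airy_decay (y + 2) / 20)\<^sup>2 \<le> (Ai (y + v))\<^sup>2" using d by (intro power_mono) auto
      then have "c \<le> (Ai (y + v))\<^sup>2" by (simp add: c_def power_divide)
      also have "\<dots> \<le> v * (Ai (y + v))\<^sup>2" using True mult_right_mono[of 1 v "(Ai (y + v))\<^sup>2"] by auto
      finally show ?thesis using True by simp
    qed (use v in auto)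
  qed
  finally show ?thesis by (simp add: c_def)
qed

text \<open>Tonelli on the region 0 \<le> s \<le> v after the substitution v = s + u, with the
  squared Airy function extended by 0 to a nonnegative function \<open>g\<close> on the line.
  Measurability of the diagonal is a separate conclusion because evaluating the one-fold product
  integral asks for it.\<close>

lemma airy_trace_eq:
  assumes y: "y \<ge> 1"
  shows "(\<lambda>s. \<integral>u. Ai (s + y + u) * Ai (u + y + s) \<partial>pos_lborel) \<in> borel_measurable pos_lborel"
    and "(\<integral>s. (\<integral>u. Ai (s + y + u) * Ai (u + y + s) \<partial>pos_lborel) \<partial>pos_lborel) = airy_trace y"
proof -
  define g where "g = (\<lambda>v. ennreal ((if v \<ge> 0 then Ai (y + v) else 0)\<^sup>2))"
  have "(\<lambda>v. if v \<ge> 0 then Ai (y + v) else 0) \<in> borel_measurable borel"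
  proof -
    have "(\<lambda>v. if y + v \<ge> 1 then Ai (y + v) else 0) \<in> borel_measurable borel"
      using measurable_compose[OF _ Ai_measurable, of "\<lambda>v. y + v" borel] by measurable
    then have "(\<lambda>v. if v \<ge> 0 then (if y + v \<ge> 1 then Ai (y + v) else 0) else 0) \<in> borel_measurable borel"
      by measurable
    also have "(\<lambda>v. if v \<ge> 0 then (if y + v \<ge> 1 then Ai (y + v) else 0) else 0) = (\<lambda>v. if v \<ge> 0 then Ai (y + v) else 0)"
      using y by (auto simp: fun_eq_iff)
    finally show ?thesis .
  qed
  then have g[measurable]: "g \<in> borel_measurable borel" unfolding g_def by measurable
  have inner_int: "integrable pos_lborel (\<lambda>u. Ai (s + y + u) * Ai (u + y + s))"
    and inner_nn: "(\<integral>\<^sup>+u. ennreal (Ai (s + y + u) * Ai (u + y + s)) \<partial>pos_lborel) = (\<integral>\<^sup>+v. g v * indicator {s..} v \<partial>lborel)"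
    if s: "s > 0" for s
  proof -
    have eq: "Ai (s + y + u) * Ai (u + y + s) = (Ai (y + s + u))\<^sup>2" for u
      by (simp add: power2_eq_square add_ac)
    show "integrable pos_lborel (\<lambda>u. Ai (s + y + u) * Ai (u + y + s))"
      unfolding eq
    proof (rule Bochner_Integration.integrable_bound)
      show "integrable pos_lborel (\<lambda>v. (airy_decay (y + s))\<^sup>2 * exp (- (2 * v)))"
        using has_bochner_integral_exp_ray(1)[of 2] by (auto simp: has_bochner_integral_iff)
      show "(\<lambda>u. (Ai (y + s + u))\<^sup>2) \<in> borel_measurable pos_lborel"
        using borel_measurable_power[OF Ai_shift_measurable[of "y + s"], of 2] y s by simp
      show "AE v in pos_lborel. norm ((Ai (y + s + v))\<^sup>2) \<le> norm ((airy_decay (y + s))\<^sup>2 * exp (- (2 * v)))"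
      proof (rule AE_I2)
        fix v assume "v \<in> space pos_lborel"
        then have v: "v > 0" by (auto simp: space_restrict_space)
        have "(Ai (y + s + v))\<^sup>2 \<le> (airy_decay (y + s) * exp (- v))\<^sup>2"
          using Ai_shift_le[of "y + s" v] v y s by (intro power_mono) auto
        also have "\<dots> = (airy_decay (y + s))\<^sup>2 * exp (- (2 * v))"
          by (simp add: power_mult_distrib flip: exp_double)
        finally show "norm ((Ai (y + s + v))\<^sup>2) \<le> norm ((airy_decay (y + s))\<^sup>2 * exp (- (2 * v)))"
          by (simp add: abs_mult)
      qed
    qed
    have "(\<integral>\<^sup>+u. ennreal (Ai (s + y + u) * Ai (u + y + s)) \<partial>pos_lborel) = (\<integral>\<^sup>+u. g (s + u) \<partial>pos_lborel)"
      using s by (intro nn_integral_cong) (auto simp: space_restrict_space g_def add_ac power2_eq_square)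
    also have "\<dots> = (\<integral>\<^sup>+u. g (s + u) * indicator {0..} u \<partial>lborel)"
      by (subst nn_integral_pos_lborel) auto
    also have "\<dots> = (\<integral>\<^sup>+u. g (s + u) * indicator {s..} (s + u) \<partial>lborel)"
      by (intro nn_integral_cong) (auto simp: indicator_def)
    also have "\<dots> = (\<integral>\<^sup>+v. g v * indicator {s..} v \<partial>lborel)"
      using nn_integral_real_affine[of "\<lambda>v. g v * indicator {s..} v" 1 s] by simp
    finally show "(\<integral>\<^sup>+u. ennreal (Ai (s + y + u) * Ai (u + y + s)) \<partial>pos_lborel) = (\<integral>\<^sup>+v. g v * indicator {s..} v \<partial>lborel)" .
  qed
  have nn: "0 \<le> Ai (s + y + u) * Ai (u + y + s)" for s u by (simp add: add_ac flip: power2_eq_square)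
  have inner: "ennreal (\<integral>u. Ai (s + y + u) * Ai (u + y + s) \<partial>pos_lborel) = (\<integral>\<^sup>+v. g v * indicator {s..} v \<partial>lborel)"
    if "s > 0" for s
    unfolding inner_nn[OF that, symmetric] by (rule nn_integral_eq_integral[symmetric, OF inner_int[OF that]]) (auto simp: nn)
  have m: "(\<lambda>s. \<integral>\<^sup>+v. g v * indicator {s..} v \<partial>lborel) \<in> borel_measurable borel"
  proof -
    have "(\<lambda>(s, v). g v * indicator {p. fst p \<le> snd p} (s, v)) \<in> borel_measurable (borel \<Otimes>\<^sub>M lborel)"
      by measurable
    from lborel.borel_measurable_nn_integral[OF this] show ?thesis by (simp add: indicator_def)
  qed
  have nn2: "0 \<le> (\<integral>u. Ai (s + y + u) * Ai (u + y + s) \<partial>pos_lborel)" for s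
    by (rule Bochner_Integration.integral_nonneg) (rule nn)
  have meas: "(\<lambda>s. \<integral>u. Ai (s + y + u) * Ai (u + y + s) \<partial>pos_lborel) \<in> borel_measurable pos_lborel"
  proof -
    have "(\<lambda>s. enn2real (\<integral>\<^sup>+v. g v * indicator {s..} v \<partial>lborel)) \<in> borel_measurable pos_lborel"
      using m by (auto intro: measurable_restrict_space1)
    then show ?thesis
      by (rule measurable_cong[THEN iffD1, rotated])
        (auto simp: space_restrict_space inner[symmetric] nn2)
  qed
  then show "(\<lambda>s. \<integral>u. Ai (s + y + u) * Ai (u + y + s) \<partial>pos_lborel) \<in> borel_measurable pos_lborel" .
  have "(\<integral>s. (\<integral>u. Ai (s + y + u) * Ai (u + y + s) \<partial>pos_lborel) \<partial>pos_lborel)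
     = enn2real (\<integral>\<^sup>+s. ennreal (\<integral>u. Ai (s + y + u) * Ai (u + y + s) \<partial>pos_lborel) \<partial>pos_lborel)"
    by (rule integral_eq_nn_integral[OF meas]) (auto simp: nn2)
  also have "(\<integral>\<^sup>+s. ennreal (\<integral>u. Ai (s + y + u) * Ai (u + y + s) \<partial>pos_lborel) \<partial>pos_lborel)
     = (\<integral>\<^sup>+s. (\<integral>\<^sup>+v. g v * indicator {s..} v \<partial>lborel) \<partial>pos_lborel)"
    by (intro nn_integral_cong) (auto simp: space_restrict_space inner)
  also have "\<dots> = (\<integral>\<^sup>+s. (\<integral>\<^sup>+v. g v * indicator {p. fst p \<le> snd p \<and> 0 \<le> fst p} (s, v) \<partial>lborel) \<partial>lborel)"
    unfolding nn_integral_pos_lborel[OF m]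
    by (intro nn_integral_cong, subst nn_integral_multc[symmetric]) (auto intro!: nn_integral_cong simp: indicator_def)
  also have "\<dots> = (\<integral>\<^sup>+v. (\<integral>\<^sup>+s. g v * indicator {p. fst p \<le> snd p \<and> 0 \<le> fst p} (s, v) \<partial>lborel) \<partial>lborel)"
    by (rule lborel_pair.Fubini'[symmetric]) measurable
  also have "\<dots> = (\<integral>\<^sup>+v. ennreal (v * (Ai (y + v))\<^sup>2) * indicator {0..} v \<partial>lborel)"
  proof (rule nn_integral_cong)
    fix v :: real
    have "(\<integral>\<^sup>+s. g v * indicator {p. fst p \<le> snd p \<and> 0 \<le> fst p} (s, v) \<partial>lborel) = (\<integral>\<^sup>+s. g v * indicator {0..v} s \<partial>lborel)"
      by (intro nn_integral_cong) (auto simp: indicator_def)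
    also have "\<dots> = g v * emeasure lborel {0..v}" by (rule nn_integral_cmult_indicator) auto
    also have "\<dots> = ennreal (v * (Ai (y + v))\<^sup>2) * indicator {0..} v"
      by (auto simp: indicator_def g_def mult.commute simp flip: ennreal_mult')
    finally show "(\<integral>\<^sup>+s. g v * indicator {p. fst p \<le> snd p \<and> 0 \<le> fst p} (s, v) \<partial>lborel) = ennreal (v * (Ai (y + v))\<^sup>2) * indicator {0..} v" .
  qed
  also have "\<dots> = (\<integral>\<^sup>+v. ennreal (v * (Ai (y + v))\<^sup>2) \<partial>pos_lborel)"
    using nn_integral_cong_AE[OF AE_mp[OF AE_lborel_singleton[of 0] AE_I2], of "\<lambda>v. ennreal (v * (Ai (y + v))\<^sup>2) * indicator {0..} v" "\<lambda>v. ennreal (v * (Ai (y + v))\<^sup>2) * indicator {0<..} v"]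
    by (subst nn_integral_restrict_space) (auto simp: indicator_def)
  also have "enn2real \<dots> = airy_trace y" unfolding airy_trace_def
    using integrable_airy_trace[OF y]
    by (intro integral_eq_nn_integral[symmetric]) (auto simp: space_restrict_space)
  finally show "(\<integral>s. (\<integral>u. Ai (s + y + u) * Ai (u + y + s) \<partial>pos_lborel) \<partial>pos_lborel) = airy_trace y" .
qed

text \<open>The kernel of A_y^2 is dominated by u s * u t, so the n-th Fredholm term is at most q^n,
  where q is the integral of u^2. The 1/4 in q comes from two integrals of exp(-2 w), one from
  composing the kernels and one from squaring \<open>u\<close>.\<close>

lemma F_GUE_expansion:
  assumes y: "y \<ge> 1"
  defines "q \<equiv> (airy_decay y)\<^sup>2 / 4"
  assumes q: "q < 1"
  shows "\<bar>1 - F_GUE y - airy_trace y\<bar> \<le> q\<^sup>2 / (1 - q)"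
proof -
  define K where "K = kernel_comp pos_lborel (airy_op_kernel y) (airy_op_kernel y)"
  define u where "u = (\<lambda>s. airy_decay y / sqrt 2 * exp (- s))"
  interpret product_sigma_finite "\<lambda>_::nat. pos_lborel"
    by (intro product_sigma_finite.intro sigma_finite_measure_restrict_space) (auto intro: sigma_finite_lborel)
  have d: "airy_decay y > 0" using y by (intro airy_decay_pos) auto
  have K: "\<bar>K s t\<bar> \<le> u s * u t" if "s > 0" "t > 0" for s t
  proof -
    have "norm (K s t) \<le> (\<integral>w. (airy_decay y)\<^sup>2 * exp (- s) * exp (- t) * exp (- (2 * w)) \<partial>pos_lborel)"
      unfolding K_def kernel_comp_def airy_op_kernel_def
    proof (rule norm_integral_le)
      show "integrable pos_lborel (\<lambda>w. (airy_decay y)\<^sup>2 * exp (- s) * exp (- t) * exp (- (2 * w)))"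
        using has_bochner_integral_exp_ray(1)[of 2] by (auto simp: has_bochner_integral_iff)
      show "norm (Ai (s + y + w) * Ai (w + y + t)) \<le> (airy_decay y)\<^sup>2 * exp (- s) * exp (- t) * exp (- (2 * w))"
        if w: "w \<in> space pos_lborel" for w
      proof -
        have w0: "w > 0" using w by (auto simp: space_restrict_space)
        have a: "Ai (s + y + w) \<le> airy_decay y * exp (- (s + w))" "0 < Ai (s + y + w)"
          using Ai_shift_le[OF y, of "s + w"] w0 \<open>s > 0\<close> by (auto simp: add_ac)
        have b: "Ai (w + y + t) \<le> airy_decay y * exp (- (t + w))" "0 < Ai (w + y + t)"
          using Ai_shift_le[OF y, of "t + w"] w0 \<open>t > 0\<close> by (auto simp: add_ac)
        have "norm (Ai (s + y + w) * Ai (w + y + t)) \<le> (airy_decay y * exp (- (s + w))) * (airy_decay y * exp (- (t + w)))"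
          using a b d by (simp add: abs_mult mult_mono)
        also have "\<dots> = (airy_decay y)\<^sup>2 * exp (- s) * exp (- t) * exp (- (2 * w))"
        proof -
          have "exp (- (s + w)) * exp (- (t + w)) = exp (- s) * exp (- t) * exp (- (2 * w))"
            by (simp flip: exp_add)
          then show ?thesis by (simp add: power2_eq_square mult_ac) 
        qed
        finally show ?thesis .
      qed
    qed
    also have "\<dots> = u s * u t"
      using has_bochner_integral_exp_ray(1)[of 2]
      by (simp add: has_bochner_integral_iff u_def power2_eq_square field_simps)
    finally show ?thesis by simp
  qed
  have u2: "has_bochner_integral pos_lborel (\<lambda>s. (u s)\<^sup>2) q"
  proof -
    have "(u s)\<^sup>2 = (airy_decay y)\<^sup>2 / 2 * exp (- (2 * s))" for s
      by (simp add: u_def power_mult_distrib power_divide exp_double[symmetric])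
    moreover have "has_bochner_integral pos_lborel (\<lambda>s. (airy_decay y)\<^sup>2 / 2 * exp (- (2 * s))) ((airy_decay y)\<^sup>2 / 2 * (1 / 2))"
      by (rule has_bochner_integral_mult_right) (rule has_bochner_integral_exp_ray(1), simp)
    ultimately show ?thesis unfolding q_def by (simp only: mult.assoc times_divide_times_eq mult_1_right) simp
  qed
  let ?f = "\<lambda>n. (-1) ^ n / fact n * (\<integral>x. Determinant.det (Matrix.mat n n (\<lambda>(i, j). K (x i) (x j))) \<partial>(\<Pi>\<^sub>M i\<in>{..<n}. pos_lborel))"
  have F: "F_GUE y = suminf ?f"
    by (simp add: F_GUE_def fredholm_det_def K_def Let_def)
  have q0: "q \<ge> 0" by (simp add: q_def)
  have b: "norm (?f n) \<le> q ^ n" for n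
  proof -
    have "norm (\<integral>x. Determinant.det (Matrix.mat n n (\<lambda>(i, j). K (x i) (x j))) \<partial>(\<Pi>\<^sub>M i\<in>{..<n}. pos_lborel))
      \<le> (\<integral>x. fact n * (\<Prod>i<n. (u (x i))\<^sup>2) \<partial>(\<Pi>\<^sub>M i\<in>{..<n}. pos_lborel))"
    proof (rule norm_integral_le)
      show "integrable (\<Pi>\<^sub>M i\<in>{..<n}. pos_lborel) (\<lambda>x. fact n * (\<Prod>i<n. (u (x i))\<^sup>2))"
        using u2 by (intro integrable_mult_right product_integrable_prod) (auto simp: has_bochner_integral_iff)
      show "norm (Determinant.det (Matrix.mat n n (\<lambda>(i, j). K (x i) (x j)))) \<le> fact n * (\<Prod>i<n. (u (x i))\<^sup>2)"
        if "x \<in> space (\<Pi>\<^sub>M i\<in>{..<n}. pos_lborel)" for x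
        using that by (intro norm_det_le) (auto simp: space_PiM space_restrict_space intro!: K)
    qed
    also have "\<dots> = fact n * q ^ n"
      using u2 by (subst integral_mult_right_zero, subst product_integral_prod) (auto simp: has_bochner_integral_iff)
    finally show ?thesis by (simp add: abs_mult field_simps)
  qed
  have sg: "summable (\<lambda>n. q ^ n)" using q0 q by (intro summable_geometric) auto
  have sm: "summable ?f" using sg by (rule summable_comparison_test'[where N = 0]) (rule b)
  have f0: "?f 0 = 1" by (simp add: det_def PiM_empty)
  have f1: "?f (Suc 0) = - airy_trace y"
  proof -
    have mK: "(\<lambda>s. K s s) \<in> borel_measurable pos_lborel"
      using airy_trace_eq(1)[OF y] by (simp add: K_def kernel_comp_def airy_op_kernel_def)
    have "Determinant.det (Matrix.mat (Suc 0) (Suc 0) (\<lambda>(i, j). K (x i) (x j))) = K (x 0) (x 0)" for x :: "nat \<Rightarrow> real"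
      by (simp add: det_def sign_def)
    moreover have "{..<Suc 0} = {0::nat}" by auto
    ultimately have "?f (Suc 0) = - (\<integral>x. K (x 0) (x 0) \<partial>(\<Pi>\<^sub>M i\<in>{0::nat}. pos_lborel))" by simp
    also have "(\<integral>x. K (x 0) (x 0) \<partial>(\<Pi>\<^sub>M i\<in>{0::nat}. pos_lborel)) = (\<integral>s. K s s \<partial>pos_lborel)"
      by (rule product_integral_singleton[OF mK])
    also have "\<dots> = airy_trace y"
      using airy_trace_eq(2)[OF y] by (simp add: K_def kernel_comp_def airy_op_kernel_def)
    finally show ?thesis .
  qed
  have "suminf ?f = (\<Sum>n. ?f (n + 2)) + sum ?f {..<2}" using sm by (rule suminf_split_initial_segment)
  then have "1 - F_GUE y - airy_trace y = - (\<Sum>n. ?f (n + 2))" using f0 f1 F by (simp add: numeral_2_eq_2)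
  moreover have "norm (\<Sum>n. ?f (n + 2)) \<le> (\<Sum>n. q ^ (n + 2))"
    by (rule norm_suminf_le[OF b]) (use sg in \<open>simp only: summable_iff_shift\<close>)
  moreover have "(\<Sum>n. q ^ (n + 2)) = q\<^sup>2 / (1 - q)"
    using q0 q by (simp add: power_add suminf_mult suminf_geometric summable_geometric power2_eq_square mult.commute)
  ultimately show ?thesis by simp
qed

section \<open>Laurent coefficients and Parseval on a circle\<close>

definition annulus :: "real \<Rightarrow> real \<Rightarrow> complex set" where
  "annulus r s = {z. r < norm z \<and> norm z < s}"

text \<open>The contour integral against dz/(2 pi i z), in the form in which \<open>F_per\<close> is
  given.\<close>

definition circle_mean :: "real \<Rightarrow> (complex \<Rightarrow> complex) \<Rightarrow> complex" where
  "circle_mean R f = contour_integral (circlepath 0 R) (\<lambda>z. f z / (2 * of_real pi * \<i> * z))"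

lemma open_annulus: "open (annulus r s)"
  unfolding annulus_def by (intro open_Collect_conj open_Collect_less continuous_intros)

lemma circle_mean_eq_integral:
  assumes "R > 0"
  shows "circle_mean R f = integral {0..1} (\<lambda>t. f (of_real R * exp (2 * of_real pi * \<i> * of_real t)))"
  unfolding circle_mean_def contour_integral_integral vector_derivative_circlepath
  unfolding circlepath using assms by (intro integral_cong) simp

lemma circle_mean_cong:
  assumes "R > 0" "\<And>z. norm z = R \<Longrightarrow> f z = g z"
  shows "circle_mean R f = circle_mean R g"
  using assms unfolding circle_mean_eq_integral[OF assms(1)] by (intro integral_cong) (simp add: norm_mult)

lemma continuous_on_circle:
  assumes "continuous_on (sphere 0 R) f" "R > 0"
  shows "continuous_on A (\<lambda>t. f (of_real R * exp (2 * of_real pi * \<i> * of_real t)))"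
proof -
  have "continuous_on A (\<lambda>t. of_real R * exp (2 * of_real pi * \<i> * complex_of_real t))"
    by (intro continuous_intros)
  moreover have "of_real R * exp (2 * of_real pi * \<i> * complex_of_real t) \<in> sphere 0 R" for t
    using assms(2) by (simp add: norm_mult)
  ultimately show ?thesis by (intro continuous_on_compose2[OF assms(1)]) blast+
qed

lemma norm_circle_mean_le:
  assumes "R > 0" "continuous_on (sphere 0 R) f" "\<And>z. norm z = R \<Longrightarrow> norm (f z) \<le> C"
  shows "norm (circle_mean R f) \<le> C"
proof -
  have "norm (integral {0..1} (\<lambda>t. f (of_real R * exp (2 * of_real pi * \<i> * of_real t)))) \<le> C * (1 - 0)"
    using assms by (intro integral_bound continuous_on_circle) (auto simp: norm_mult)
  then show ?thesis by (simp add: circle_mean_eq_integral assms)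
qed

lemma circle_mean_add:
  assumes "R > 0" "continuous_on (sphere 0 R) f" "continuous_on (sphere 0 R) g"
  shows "circle_mean R (\<lambda>z. f z + g z) = circle_mean R f + circle_mean R g"
    and "circle_mean R (\<lambda>z. f z - g z) = circle_mean R f - circle_mean R g"
  using assms by (auto simp: circle_mean_eq_integral intro!: Henstock_Kurzweil_Integration.integral_add
      Henstock_Kurzweil_Integration.integral_diff integrable_continuous_real continuous_on_circle)

lemma circle_mean_cmult:
  assumes "R > 0"
  shows "circle_mean R (\<lambda>z. c * f z) = c * circle_mean R f"
  by (simp add: circle_mean_eq_integral assms)

lemma circle_mean_shift:
  assumes f: "f holomorphic_on annulus r s" and r: "0 \<le> r" and R: "r < R" "R < s" and R': "r < R'" "R' < s"
  shows "circle_mean R f = circle_mean R' f"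
  unfolding circle_mean_def
proof (rule Cauchy_theorem_homotopic_loops[where S = "annulus r s"])
  show "(\<lambda>z. f z / (2 * of_real pi * \<i> * z)) holomorphic_on annulus r s"
    using r by (intro holomorphic_intros f) (auto simp: annulus_def)
  show "homotopic_loops (annulus r s) (circlepath 0 R) (circlepath 0 R')"
  proof (rule homotopic_loops_linear)
    fix t :: real assume "t \<in> {0..1}"
    show "closed_segment (circlepath 0 R t) (circlepath 0 R' t) \<subseteq> annulus r s"
    proof
      fix w assume "w \<in> closed_segment (circlepath 0 R t) (circlepath 0 R' t)"
      then obtain u where u: "0 \<le> u" "u \<le> 1" "w = (1 - u) *\<^sub>R circlepath 0 R t + u *\<^sub>R circlepath 0 R' t"
        by (auto simp: in_segment)
      have "w = of_real ((1 - u) * R + u * R') * exp (2 * of_real pi * \<i> * of_real t)"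
        unfolding u(3) circlepath by (simp add: scaleR_conv_of_real algebra_simps)
      moreover have "0 \<le> (1 - u) * R + u * R'" using u R R' r by (intro add_nonneg_nonneg mult_nonneg_nonneg) auto
      ultimately have w: "norm w = (1 - u) * R + u * R'"
        by (simp only: norm_mult norm_of_real norm_exp_eq_Re) simp
      have "(1 - u) * r + u * r < (1 - u) * R + u * R'"
        using u R R' by (cases "u = 1") (auto intro!: add_less_le_mono mult_left_mono mult_strict_left_mono)
      moreover have "(1 - u) * R + u * R' < (1 - u) * s + u * s"
        using u R R' by (cases "u = 1") (auto intro!: add_less_le_mono mult_left_mono mult_strict_left_mono)
      ultimately show "w \<in> annulus r s" by (simp add: w annulus_def algebra_simps)
    qed
  qed auto
qed (auto simp: open_annulus)

lemma circle_mean_powi: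
  assumes "R > 0"
  shows "circle_mean R (\<lambda>z. z powi m) = (if m = 0 then 1 else 0)"
proof (cases "m = 0")
  case False
  let ?c = "2 * of_real pi * \<i> * of_int m :: complex"
  have c: "?c \<noteq> 0" using False by simp
  have "((\<lambda>t. exp (?c * of_real t)) has_integral (exp (?c * of_real 1) / ?c - exp (?c * of_real 0) / ?c)) {0..1}"
  proof (rule fundamental_theorem_of_calculus)
    fix t :: real
    have "((\<lambda>z. exp (?c * z) / ?c) has_field_derivative exp (?c * of_real t)) (at (of_real t))"
      using c by (auto intro!: derivative_eq_intros)
    then show "((\<lambda>t. exp (?c * of_real t) / ?c) has_vector_derivative exp (?c * of_real t)) (at t within {0..1})"
      by (rule has_vector_derivative_real_field)
  qed simp
  moreover have "exp ?c = 1" by (simp add: exp_eq_1)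
  ultimately have "integral {0..1} (\<lambda>t. exp (?c * of_real t)) = 0" by (simp add: integral_unique)
  moreover have "(of_real R * exp (2 * of_real pi * \<i> * of_real t)) powi m = of_real R powi m * exp (?c * of_real t)" for t
    by (simp add: power_int_mult_distrib exp_power_int mult_ac)
  ultimately show ?thesis using False assms by (simp add: circle_mean_eq_integral)
qed (use assms in \<open>simp add: circle_mean_eq_integral\<close>)

definition laurent_coeff :: "real \<Rightarrow> (complex \<Rightarrow> complex) \<Rightarrow> int \<Rightarrow> complex" where
  "laurent_coeff R f m = circle_mean R (\<lambda>z. f z * z powi (- m))"

lemma summable_on_int:
  fixes f :: "int \<Rightarrow> real"
  assumes "\<And>k. 0 \<le> f k" "summable (\<lambda>n. f (int n))" "summable (\<lambda>n. f (- int n))"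
  shows "f summable_on UNIV"
proof -
  have "(\<lambda>n. f (int n)) summable_on UNIV" "(\<lambda>n. f (- int n)) summable_on UNIV"
    using assms by (auto intro!: summable_nonneg_imp_summable_on)
  then have "f summable_on range int" "f summable_on range (\<lambda>n. - int n)"
    by (auto simp: summable_on_reindex o_def inj_on_def)
  then have "f summable_on (range int \<union> range (\<lambda>n. - int n))" by (rule summable_on_union)
  moreover have "range int \<union> range (\<lambda>n. - int n) = UNIV"
    by (auto simp: image_iff) (metis int_cases2)
  ultimately show ?thesis by simp
qed

text \<open>The second window starts at 1 - N because integrals over {-k..1 - k}, summed over it,
  telescope to the symmetric end points -N and N.\<close>

lemma has_sum_int_symmetric:
  fixes f :: "int \<Rightarrow> 'a::{comm_monoid_add, topological_space}"
  assumes "(f has_sum S) UNIV"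
  shows "(\<lambda>N. \<Sum>m\<in>{- int N..int N}. f m) \<longlonglongrightarrow> S"
    and "(\<lambda>N. \<Sum>m\<in>{1 - int N..int N}. f m) \<longlonglongrightarrow> S"
proof -
  have *: "\<forall>\<^sub>F N in sequentially. finite {c - int N..int N} \<and> X \<subseteq> {c - int N..int N} \<and> {c - int N..int N} \<subseteq> UNIV"
    if X: "finite X" and c: "c = 0 \<or> c = 1" for X c
  proof -
    obtain B where B: "\<And>x. x \<in> X \<Longrightarrow> \<bar>x\<bar> \<le> int B"
      using finite_nat_set_iff_bounded_le[of "nat ` abs ` X"] X by (auto simp: nat_le_iff) 
    show ?thesis using eventually_ge_at_top[of "Suc B"]
    proof eventually_elim
      case (elim N)
      have "c - int N \<le> x \<and> x \<le> int N" if "x \<in> X" for x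
        using B[OF that] elim c by (auto simp: abs_le_iff)
      then show ?case by auto
    qed
  qed
  have "filterlim (\<lambda>N. {c - int N..int N}) (finite_subsets_at_top UNIV) sequentially" if "c = 0 \<or> c = 1" for c
    unfolding filterlim_finite_subsets_at_top using *[OF _ that] by blast
  from filterlim_compose[OF assms[unfolded has_sum_def] this[of 0]] filterlim_compose[OF assms[unfolded has_sum_def] this[of 1]]
  show "(\<lambda>N. \<Sum>m\<in>{- int N..int N}. f m) \<longlonglongrightarrow> S" "(\<lambda>N. \<Sum>m\<in>{1 - int N..int N}. f m) \<longlonglongrightarrow> S"
    by auto
qed

context
  fixes f :: "complex \<Rightarrow> complex" and r s R :: real
  assumes f: "f holomorphic_on annulus r s" and r: "0 \<le> r" and R: "r < R" "R < s"
begin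

lemma sphere_subset_annulus: "r < R' \<Longrightarrow> R' < s \<Longrightarrow> sphere 0 R' \<subseteq> annulus r s"
  by (auto simp: annulus_def)

lemma holomorphic_laurent_integrand: "(\<lambda>z. f z * z powi m) holomorphic_on annulus r s"
  using r by (intro holomorphic_intros f) (auto simp: annulus_def)

lemma laurent_coeff_shift:
  assumes "r < R'" "R' < s"
  shows "laurent_coeff R f m = laurent_coeff R' f m"
  unfolding laurent_coeff_def by (rule circle_mean_shift[OF holomorphic_laurent_integrand r R assms])

lemma norm_laurent_coeff_le:
  assumes R': "r < R'" "R' < s"
  obtains C where "C > 0" "\<And>m. norm (laurent_coeff R f m) \<le> C * R' powi (- m)"
proof -
  have "continuous_on (sphere 0 R') f"
    using f sphere_subset_annulus[OF R'] holomorphic_on_imp_continuous_on continuous_on_subset by blast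
  then have "bounded (f ` sphere 0 R')" by (intro compact_imp_bounded compact_continuous_image) auto
  then obtain C where C: "C > 0" "\<And>z. norm z = R' \<Longrightarrow> norm (f z) \<le> C"
    by (auto simp: bounded_pos)
  show ?thesis
  proof (rule that[OF C(1)])
    fix m
    have "norm (laurent_coeff R' f m) \<le> C * R' powi (- m)"
      unfolding laurent_coeff_def
    proof (rule norm_circle_mean_le)
      show "continuous_on (sphere 0 R') (\<lambda>z. f z * z powi - m)"
        using holomorphic_on_imp_continuous_on[OF holomorphic_laurent_integrand] sphere_subset_annulus[OF R']
        by (rule continuous_on_subset)
      show "norm (f z * z powi - m) \<le> C * R' powi - m" if "norm z = R'" for z
        using C(2)[OF that] r R' that by (auto simp: norm_mult norm_power_int intro!: mult_right_mono)
    qed (use r R' in simp)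
    then show "norm (laurent_coeff R f m) \<le> C * R' powi (- m)"
      using laurent_coeff_shift[OF R'] by simp
  qed
qed

text \<open>Cauchy estimates on a slightly larger circle give geometric decay for m \<ge> 0, on a
  slightly smaller one for m \<le> 0.\<close>

lemma laurent_coeff_abs_summable:
  "(\<lambda>m. norm (laurent_coeff R f m) * R powi m) summable_on UNIV"
proof -
  define R1 R2 where "R1 = (r + R) / 2" and "R2 = (R + s) / 2"
  have R12: "r < R1" "R1 < R" "R < R2" "R2 < s" "0 < R1" "0 < R" using R r by (auto simp: R1_def R2_def)
  obtain C1 where C1: "C1 > 0" "\<And>m. norm (laurent_coeff R f m) \<le> C1 * R1 powi (- m)"
    using norm_laurent_coeff_le[of R1] R12 R by auto
  obtain C2 where C2: "C2 > 0" "\<And>m. norm (laurent_coeff R f m) \<le> C2 * R2 powi (- m)"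
    using norm_laurent_coeff_le[of R2] R12 R by auto
  show ?thesis
  proof (rule summable_on_int)
    show "summable (\<lambda>n. norm (laurent_coeff R f (int n)) * R powi int n)"
    proof (rule summable_comparison_test'[where N = 0])
      show "summable (\<lambda>n. C2 * (R / R2) ^ n)" using R12 by (intro summable_mult summable_geometric) auto
      show "norm (norm (laurent_coeff R f (int n)) * R powi int n) \<le> C2 * (R / R2) ^ n" for n
        using mult_right_mono[OF C2(2)[of "int n"], of "R ^ n"] R12
        by (simp add: power_int_minus field_simps power_divide)
    qed
    show "summable (\<lambda>n. norm (laurent_coeff R f (- int n)) * R powi (- int n))"
    proof (rule summable_comparison_test'[where N = 0])
      show "summable (\<lambda>n. C1 * (R1 / R) ^ n)" using R12 by (intro summable_mult summable_geometric) auto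
      show "norm (norm (laurent_coeff R f (- int n)) * R powi - int n) \<le> C1 * (R1 / R) ^ n" for n
        using mult_right_mono[OF C1(2)[of "- int n"], of "inverse (R ^ n)"] R12
        by (simp add: power_int_minus field_simps power_divide)
    qed
  qed (use R r in auto)
qed

end

text \<open>Let \<open>g\<close> be the difference quotient of \<open>f\<close> at z0, holomorphic
  on the annulus. By f z = f z0 + (z - z0) g z, each coefficient of \<open>f\<close> is, up to the
  constant term, a shifted coefficient of \<open>g\<close> minus z0 times the unshifted one. The
  partial sums at z0 therefore telescope, and the boundary terms vanish because the Laurent terms of
  \<open>g\<close> are summable on the circle.\<close>

lemma laurent_expansion:
  assumes f: "f holomorphic_on annulus r s" and r: "0 \<le> r" and R: "r < R" "R < s" and z0: "norm z0 = R"
  shows "((\<lambda>m. laurent_coeff R f m * z0 powi m) has_sum f z0) UNIV"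
proof -
  let ?c = "laurent_coeff R"
  define g where "g = (\<lambda>z. if z = z0 then deriv f z0 else (f z - f z0) / (z - z0))"
  have R0: "R > 0" using r R by simp
  have z00: "z0 \<noteq> 0" using z0 R0 by auto
  have g: "g holomorphic_on annulus r s"
    unfolding g_def by (rule pole_lemma_open[OF f open_annulus])
  have fg: "f z = f z0 + (z - z0) * g z" for z by (simp add: g_def)
  have cont: "continuous_on (sphere 0 R) (\<lambda>z. g z * z powi k)" for k
    using holomorphic_on_imp_continuous_on[OF holomorphic_laurent_integrand[OF g r R]] sphere_subset_annulus[OF f r R, of R] R
    by (auto intro: continuous_on_subset)
  have contp: "continuous_on (sphere 0 R) (\<lambda>z::complex. z powi k)" for k
    using R0 by (auto intro!: continuous_intros)
  have step: "?c f m = (if m = 0 then f z0 else 0) + ?c g (m - 1) - z0 * ?c g m" for m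
  proof -
    have "?c f m = circle_mean R (\<lambda>z. (f z0 * z powi (- m) + g z * z powi (- (m - 1))) - z0 * (g z * z powi (- m)))"
      unfolding laurent_coeff_def
    proof (rule circle_mean_cong[OF R0])
      fix z :: complex assume "norm z = R"
      then have "z \<noteq> 0" using R0 by auto
      then have "z powi (- (m - 1)) = z * z powi (- m)" using power_int_add[of z 1 "- m"] by simp
      then show "f z * z powi - m = f z0 * z powi - m + g z * z powi - (m - 1) - z0 * (g z * z powi - m)"
        by (subst fg) (simp add: algebra_simps)
    qed
    also have "\<dots> = f z0 * circle_mean R (\<lambda>z. z powi (- m)) + ?c g (m - 1) - z0 * ?c g m"
      unfolding laurent_coeff_def
      by (subst circle_mean_add, use R0 in simp, (intro continuous_intros cont contp)+,
          subst circle_mean_add, use R0 in simp, (intro continuous_intros cont contp)+)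
        (simp add: circle_mean_cmult[OF R0])
    also have "circle_mean R (\<lambda>z. z powi (- m)) = (if m = 0 then 1 else 0)"
      using circle_mean_powi[OF R0, of "- m"] by simp
    finally show ?thesis by simp
  qed
  have tele: "(\<Sum>m\<in>{- int N..int N}. ?c f m * z0 powi m) = f z0 + ?c g (- int N - 1) * z0 powi (- int N) - ?c g (int N) * z0 powi (int N + 1)" for N
  proof (induction N)
    case 0
    show ?case by (simp add: step[of 0])
  next
    case (Suc N)
    have e: "{- int (Suc N)..int (Suc N)} = insert (- int N - 1) (insert (int N + 1) {- int N..int N})" by auto
    have p1: "z0 powi (- int N) = z0 * z0 powi (- int N - 1)" using power_int_add[of z0 1 "- int N - 1"] z00 by simp
    have p2: "z0 powi (int N + 1 + 1) = z0 * z0 powi (int N + 1)" using power_int_add[of z0 1 "int N + 1"] z00 by (simp add: add_ac)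
    have "(\<Sum>m\<in>{- int (Suc N)..int (Suc N)}. ?c f m * z0 powi m)
      = ?c f (- int N - 1) * z0 powi (- int N - 1) + (?c f (int N + 1) * z0 powi (int N + 1)
          + (\<Sum>m\<in>{- int N..int N}. ?c f m * z0 powi m))"
      unfolding e by simp
    also have "\<dots> = f z0 + ?c g (- int N - 1 - 1) * z0 powi (- int N - 1) - ?c g (int N + 1) * z0 powi (int N + 1 + 1)"
      unfolding Suc.IH step[of "- int N - 1"] step[of "int N + 1"] p1 p2 by (simp add: ring_distribs)
    finally have "(\<Sum>m\<in>{- int (Suc N)..int (Suc N)}. ?c f m * z0 powi m)
      = f z0 + ?c g (- int N - 1 - 1) * z0 powi (- int N - 1) - ?c g (int N + 1) * z0 powi (int N + 1 + 1)" .
    moreover have "- int (Suc N) = - int N - 1" "int (Suc N) = int N + 1" by auto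
    ultimately show ?case by (simp only:)
  qed
  have sg: "(\<lambda>m. norm (?c g m) * R powi m) summable_on UNIV" by (rule laurent_coeff_abs_summable[OF g r R])
  have sf: "(\<lambda>m. norm (?c f m * z0 powi m)) summable_on UNIV"
    using laurent_coeff_abs_summable[OF f r R] by (simp only: norm_mult norm_power_int z0)
  obtain S where S: "((\<lambda>m. ?c f m * z0 powi m) has_sum S) UNIV"
    by (rule that[OF has_sum_infsum[OF abs_summable_summable[OF sf]]])
  have g0: "(\<lambda>n. norm (?c g (h n)) * R powi (h n)) \<longlonglongrightarrow> 0" if h: "inj h" for h :: "nat \<Rightarrow> int"
  proof -
    have "(\<lambda>m. norm (?c g m) * R powi m) summable_on range h" using sg by (rule summable_on_subset_banach) auto
    then have "(\<lambda>n. norm (?c g (h n)) * R powi (h n)) summable_on UNIV"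
      by (simp add: summable_on_reindex[OF h] o_def)
    then show ?thesis using R0 by (intro summable_LIMSEQ_zero summable_on_imp_summable)
  qed
  have "(\<lambda>N. \<Sum>m\<in>{- int N..int N}. ?c f m * z0 powi m) \<longlonglongrightarrow> f z0 + 0 - 0"
    unfolding tele
  proof (intro tendsto_intros)
    have 1: "norm (?c g (- int N - 1) * z0 powi (- int N)) = R * (norm (?c g (- int N - 1)) * R powi (- int N - 1))" for N
      using power_int_add[of R 1 "- int N - 1"] R0 by (simp add: norm_mult norm_power_int z0)
    show "(\<lambda>N. ?c g (- int N - 1) * z0 powi (- int N)) \<longlonglongrightarrow> 0"
      by (rule tendsto_norm_zero_cancel, unfold 1)
        (use tendsto_mult_left[OF g0[of "\<lambda>N. - int N - 1"], of R] in \<open>simp add: inj_on_def\<close>)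
    have 2: "norm (?c g (int N) * z0 powi (int N + 1)) = R * (norm (?c g (int N)) * R powi (int N))" for N
      using power_int_add[of R 1 "int N"] R0 by (simp add: norm_mult norm_power_int z0 add.commute)
    show "(\<lambda>N. ?c g (int N) * z0 powi (int N + 1)) \<longlonglongrightarrow> 0"
      by (rule tendsto_norm_zero_cancel, unfold 2)
        (use tendsto_mult_left[OF g0[of "\<lambda>N. int N"], of R] in \<open>simp add: inj_on_def\<close>)
  qed
  with has_sum_int_symmetric(1)[OF S] have "S = f z0" using LIMSEQ_unique by auto
  then show ?thesis using S by simp
qed

lemma has_sum_integral:
  fixes f :: "'i \<Rightarrow> real \<Rightarrow> complex"
  assumes c: "\<And>i. i \<in> I \<Longrightarrow> continuous_on {a..b} (f i)"
    and b: "\<And>i x. i \<in> I \<Longrightarrow> x \<in> {a..b} \<Longrightarrow> norm (f i x) \<le> M i" and M: "M summable_on I"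
  shows "((\<lambda>i. integral {a..b} (f i)) has_sum integral {a..b} (\<lambda>x. \<Sum>\<^sub>\<infinity>i\<in>I. f i x)) I"
proof -
  define h where "h = (\<lambda>F x. \<Sum>i\<in>F \<inter> I. f i x)"
  have ev: "\<forall>\<^sub>F F in finite_subsets_at_top I. finite F \<and> F \<subseteq> I"
    by (rule eventually_finite_subsets_at_top_weakI) auto
  have ul: "uniform_limit {a..b} h (\<lambda>x. \<Sum>\<^sub>\<infinity>i\<in>I. f i x) (finite_subsets_at_top I)"
  proof (rule uniform_limit_cong[THEN iffD1, rotated 2, OF uniform_limit_infsum[OF b M]])
    show "\<forall>\<^sub>F F in finite_subsets_at_top I. \<forall>x\<in>{a..b}. (\<Sum>i\<in>F. f i x) = h F x"
      using ev by eventually_elim (auto simp: h_def Int_absorb2)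
  qed auto
  have hc: "continuous_on {a..b} (h F)" for F unfolding h_def by (intro continuous_intros c) auto
  obtain I1 J where IJ: "\<And>F. (h F has_integral I1 F) {a..b}" "((\<lambda>x. \<Sum>\<^sub>\<infinity>i\<in>I. f i x) has_integral J) {a..b}"
    "(I1 \<longlongrightarrow> J) (finite_subsets_at_top I)"
    using uniform_limit_integral[OF ul hc] by auto
  have 1: "(I1 \<longlongrightarrow> integral {a..b} (\<lambda>x. \<Sum>\<^sub>\<infinity>i\<in>I. f i x)) (finite_subsets_at_top I)"
    using IJ by (simp add: integral_unique)
  have 2: "\<forall>\<^sub>F F in finite_subsets_at_top I. I1 F = (\<Sum>i\<in>F. integral {a..b} (f i))"
    using ev
  proof eventually_elim
    case (elim F)
    have "I1 F = integral {a..b} (\<lambda>x. \<Sum>i\<in>F. f i x)"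
      using IJ(1)[of F] elim by (simp add: h_def Int_absorb2 integral_unique)
    also have "\<dots> = (\<Sum>i\<in>F. integral {a..b} (f i))"
      using elim by (intro integral_sum integrable_continuous_real c) auto
    finally show ?case .
  qed
  show ?thesis unfolding has_sum_def by (rule Lim_transform_eventually[OF 1 2])
qed

text \<open>Only \<open>h\<close> is expanded; \<open>f\<close> stays as a bounded factor and the
  series is integrated term by term. The pairing is bilinear, without conjugation, hence m against
  -m.\<close>

lemma circle_mean_parseval:
  assumes f: "f holomorphic_on annulus r s" and h: "h holomorphic_on annulus r s"
    and r: "0 \<le> r" and R: "r < R" "R < s"
  shows "((\<lambda>m. laurent_coeff R f (- m) * laurent_coeff R h m) has_sum circle_mean R (\<lambda>z. f z * h z)) UNIV"
proof -
  have R0: "R > 0" using r R by simp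
  have cf: "continuous_on (sphere 0 R) f"
    using f sphere_subset_annulus[OF f r R R] holomorphic_on_imp_continuous_on continuous_on_subset by blast
  then have "bounded (f ` sphere 0 R)" by (intro compact_imp_bounded compact_continuous_image) auto
  then obtain C where C: "C > 0" "\<And>z. norm z = R \<Longrightarrow> norm (f z) \<le> C"
    by (auto simp: bounded_pos)
  define e where "e = (\<lambda>t. of_real R * exp (2 * of_real pi * \<i> * complex_of_real t))"
  have ce: "circle_mean R g = integral {0..1} (\<lambda>t. g (e t))" for g
    by (simp add: circle_mean_eq_integral[OF R0] e_def)
  let ?F = "\<lambda>m z. laurent_coeff R h m * (f z * z powi m)"
  have e: "norm (e t) = R" for t using R0 by (simp add: norm_mult e_def)
  have "((\<lambda>m. integral {0..1} (\<lambda>t. ?F m (e t))) has_sum integral {0..1} (\<lambda>t. \<Sum>\<^sub>\<infinity>m. ?F m (e t))) UNIV"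
  proof (rule has_sum_integral)
    show "continuous_on {0..1} (\<lambda>t. ?F m (e t))" for m
      unfolding e_def by (rule continuous_on_circle[OF _ R0, of "?F m"]) (use R0 in \<open>auto intro!: continuous_intros cf\<close>)
    show "norm (?F m (e t)) \<le> C * (norm (laurent_coeff R h m) * R powi m)" for m t
    proof -
      have "norm (laurent_coeff R h m) * norm (f (e t)) * R powi m \<le> norm (laurent_coeff R h m) * C * R powi m"
        using C(2)[OF e[of t]] R0 by (intro mult_right_mono mult_left_mono) auto
      moreover have "norm (?F m (e t)) = norm (laurent_coeff R h m) * norm (f (e t)) * R powi m"
        by (simp only: norm_mult norm_power_int e mult.assoc)
      ultimately show ?thesis by (simp only: mult_ac)
    qed
    show "(\<lambda>m. C * (norm (laurent_coeff R h m) * R powi m)) summable_on UNIV"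
      by (intro summable_on_cmult_right laurent_coeff_abs_summable[OF h r R])
  qed
  moreover have "(\<Sum>\<^sub>\<infinity>m. ?F m (e t)) = f (e t) * h (e t)" for t
  proof -
    have "((\<lambda>m. f (e t) * (laurent_coeff R h m * e t powi m)) has_sum f (e t) * h (e t)) UNIV"
      by (intro has_sum_cmult_right laurent_expansion[OF h r R e])
    then show ?thesis by (intro infsumI) (simp add: mult_ac)
  qed
  ultimately have "((\<lambda>m. circle_mean R (?F m)) has_sum circle_mean R (\<lambda>z. f z * h z)) UNIV"
    by (simp add: ce)
  moreover have "circle_mean R (?F m) = laurent_coeff R f (- m) * laurent_coeff R h m" for m
    unfolding circle_mean_cmult[OF R0] laurent_coeff_def[of R f] by simp
  ultimately show ?thesis by simp
qed

section \<open>Polylogarithms\<close>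

text \<open>Li_s(z)/z. With the factor z taken out, the integrand of \<open>B\<close> has no pole at
  0, and the polylogarithms visibly vanish to first order there.\<close>

definition polylog_quotient :: "real \<Rightarrow> complex \<Rightarrow> complex" where
  "polylog_quotient s z = (\<Sum>\<^sub>\<infinity>k. z ^ k / of_real (real (Suc k) powr s))"

lemma norm_polylog_quotient_summand:
  assumes "s \<ge> 0"
  shows "norm (z ^ k / of_real (real (Suc k) powr s) :: complex) \<le> norm z ^ k"
proof -
  have "1 \<le> real (Suc k) powr s" using assms by (intro ge_one_powr_ge_zero) auto
  then have "norm z ^ k / real (Suc k) powr s \<le> norm z ^ k / 1" by (intro divide_left_mono) auto
  then show ?thesis by (simp add: norm_divide norm_power)
qed

lemma
  assumes s: "s \<ge> 0" and z: "norm z < 1"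
  shows polylog_eq: "polylog s z = z * polylog_quotient s z"
    and norm_polylog_quotient_le: "norm (polylog_quotient s z) \<le> 1 / (1 - norm z)"
proof -
  let ?f = "\<lambda>k. z ^ k / of_real (real (Suc k) powr s) :: complex"
  have g: "(\<lambda>k. norm z ^ k) sums (1 / (1 - norm z))" using z by (intro geometric_sums) auto
  have ns: "summable (\<lambda>k. norm (?f k))"
    by (rule summable_comparison_test'[OF sums_summable[OF g], of 0])
      (use norm_polylog_quotient_summand[OF s] in auto)
  then have hs: "(?f has_sum polylog_quotient s z) UNIV"
    unfolding polylog_quotient_def by (intro has_sum_infsum norm_summable_imp_summable_on)
  then have sm: "?f sums polylog_quotient s z" by (rule has_sum_imp_sums)
  show "polylog s z = z * polylog_quotient s z"
    using sums_mult[OF sm, of z] z by (simp add: polylog_def polylog_series_def sums_iff)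
  have "norm (suminf ?f) \<le> (\<Sum>k. norm z ^ k)"
    by (rule norm_suminf_le) (use norm_polylog_quotient_summand[OF s] sums_summable[OF g] in auto)
  then show "norm (polylog_quotient s z) \<le> 1 / (1 - norm z)" using sm g by (simp add: sums_iff)
qed

lemma norm_polylog_le:
  assumes "s \<ge> 0" "norm z < 1"
  shows "norm (polylog s z) \<le> norm z / (1 - norm z)"
  using mult_left_mono[OF norm_polylog_quotient_le[OF assms], of "norm z"] polylog_eq[OF assms]
  by (simp add: norm_mult)

lemma holomorphic_polylog_quotient:
  assumes "s \<ge> 0"
  shows "polylog_quotient s holomorphic_on ball 0 1"
proof -
  have "polylog_quotient s field_differentiable at z" if z: "norm z < 1" for z
  proof -
    define r where "r = (1 + norm z) / 2"
    have r: "norm z < r" "r < 1" "r > 0" using z norm_ge_zero[of z] by (auto simp: r_def field_simps simp del: norm_ge_zero)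
    have "(\<lambda>z. \<Sum>\<^sub>\<infinity>k. z ^ k / of_real (real (Suc k) powr s)) holomorphic_on ball 0 r"
    proof (rule holomorphic_on_infsum)
      show "norm (z ^ k / of_real (real (Suc k) powr s)) \<le> r ^ k" if "z \<in> ball 0 r" for k and z :: complex
        using norm_polylog_quotient_summand[OF assms, of z k] power_mono[of "norm z" r k] that by auto
      show "(\<lambda>k. r ^ k) summable_on UNIV"
        using r by (intro summable_nonneg_imp_summable_on summable_geometric) auto
    qed (auto intro!: holomorphic_intros)
    then show ?thesis
      unfolding polylog_quotient_def using r by (auto intro: holomorphic_on_imp_differentiable_at)
  qed
  then show ?thesis by (simp add: holomorphic_on_def field_differentiable_at_within)
qed

lemma holomorphic_polylog:
  assumes "s \<ge> 0"
  shows "polylog s holomorphic_on ball 0 1"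
proof -
  have "(\<lambda>z. z * polylog_quotient s z) holomorphic_on ball 0 1"
    by (intro holomorphic_intros holomorphic_polylog_quotient assms)
  then show ?thesis by (rule holomorphic_transform) (simp add: polylog_eq assms)
qed

lemma cnj_polylog:
  assumes "norm z < 1" "s \<ge> 0"
  shows "polylog s (cnj z) = cnj (polylog s z)"
  using assms by (simp add: polylog_eq polylog_quotient_def flip: infsum_cnj)

text \<open>The integrand equals y times the squared \<open>polylog_quotient\<close>, so
  \<open>B\<close> is a multiple of a primitive on the disc. For |y| \<le> 1/2 the quotient is at
  most 2, hence the integrand at most 2, and 2/(4 pi) \<le> 1.\<close>

lemma holomorphic_B_and_bound:
  shows "B holomorphic_on ball 0 1" and "norm z \<le> 1/2 \<Longrightarrow> norm (B z) \<le> norm z"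
proof -
  let ?h = "\<lambda>y. (polylog (1/2) y)\<^sup>2 / y"
  have he: "?h y = y * (polylog_quotient (1/2) y)\<^sup>2" if "norm y < 1" for y
    using polylog_eq[of "1/2" y] that by (simp add: power2_eq_square)
  have "(\<lambda>y. y * (polylog_quotient (1/2) y)\<^sup>2) holomorphic_on ball 0 1"
    by (intro holomorphic_intros holomorphic_polylog_quotient) auto
  then have hol: "?h holomorphic_on ball 0 1" by (rule holomorphic_transform) (simp add: he)
  obtain H where H: "\<And>y. y \<in> ball 0 1 \<Longrightarrow> (H has_field_derivative ?h y) (at y within ball 0 1)"
    using holomorphic_convex_primitive'[OF convex_ball open_ball hol] by blast
  have seg: "closed_segment 0 z \<subseteq> ball 0 1" if "norm z < 1" for z :: complex
    using that by (intro closed_segment_subset) auto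
  have ci: "(?h has_contour_integral (H z - H 0)) (linepath 0 z)" if z: "norm z < 1" for z
    using contour_integral_primitive[OF H, of "linepath 0 z"] seg[OF z] by auto
  have "(\<lambda>z. (H z - H 0) / of_real (4 * pi)) holomorphic_on ball 0 1"
  proof -
    have "H holomorphic_on ball 0 1" unfolding holomorphic_on_def field_differentiable_def using H by blast
    then show ?thesis by (intro holomorphic_intros) auto
  qed
  then show "B holomorphic_on ball 0 1"
    by (rule holomorphic_transform) (simp add: B_def contour_integral_unique[OF ci])
  show "norm (B z) \<le> norm z" if z: "norm z \<le> 1/2"
  proof -
    have z1: "norm z < 1" using z by simp
    have "norm (H z - H 0) \<le> 2 * norm (z - 0)"
    proof (rule has_contour_integral_bound_linepath[OF ci[OF z1]])
      fix y assume "y \<in> closed_segment 0 z"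
      then have y: "norm y \<le> 1/2" using z segment_bound1[of y 0 z] by simp
      have "norm (polylog_quotient (1/2) y) \<le> 1 / (1 - norm y)" using y by (intro norm_polylog_quotient_le) auto
      also have "\<dots> \<le> 1 / (1/2)" using y by (intro divide_left_mono) auto
      finally have "(norm (polylog_quotient (1/2) y))\<^sup>2 \<le> 2\<^sup>2" by (intro power_mono) auto
      then have "norm y * (norm (polylog_quotient (1/2) y))\<^sup>2 \<le> 1/2 * 2\<^sup>2" using y by (intro mult_mono) auto
      then show "norm (?h y) \<le> 2" using y by (subst he) (auto simp: norm_mult norm_power)
    qed simp
    then have "norm (B z) \<le> 2 * norm z / (4 * pi)"
      using ci[OF z1] by (simp add: B_def contour_integral_unique norm_divide field_simps)
    also have "\<dots> \<le> norm z * 1"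
    proof -
      have "norm z * 1 \<le> norm z * (2 * pi)" using pi_gt3 by (intro mult_left_mono) auto
      then show ?thesis by (simp add: field_simps)
    qed
    finally show ?thesis by simp
  qed
qed

section \<open>The exponent of the weight\<close>

definition log_weight :: "real \<Rightarrow> real \<Rightarrow> complex \<Rightarrow> complex" where
  "log_weight x \<tau> z = of_real x * A1 z + of_real \<tau> * A2 z + 2 * B z"

lemma holomorphic_log_weight: "log_weight x \<tau> holomorphic_on ball 0 1"
  unfolding log_weight_def A1_def A2_def
  by (intro holomorphic_intros holomorphic_polylog holomorphic_B_and_bound) auto

text \<open>First-order vanishing at 0 makes the exponent of size x exp(-x/(2 \<tau>)) on the saddle
  circle, so the weight is 1 up to that error.\<close>

lemma norm_log_weight_le:
  assumes z: "norm z \<le> 1/2" and "x \<ge> 0" "\<tau> \<ge> 0"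
  shows "norm (log_weight x \<tau> z) \<le> (2 * x + 2 * \<tau> + 2) * norm z"
proof -
  have P: "norm (polylog s z / of_real (sqrt (2 * pi))) \<le> 2 * norm z" if "s \<ge> 0" for s
  proof -
    have 1: "norm (polylog s z) \<le> norm z / (1 - norm z)" using z that by (intro norm_polylog_le) auto
    also have "\<dots> \<le> norm z / (1/2)" using z by (intro divide_left_mono) auto
    finally have "norm (polylog s z) \<le> 2 * norm z" by simp
    moreover have "1 \<le> sqrt (2 * pi)" using pi_gt3 by simp
    then have "norm (polylog s z) / sqrt (2 * pi) \<le> norm (polylog s z) / 1" by (intro divide_left_mono) auto
    ultimately show ?thesis by (simp add: norm_divide)
  qed
  have "norm (log_weight x \<tau> z) \<le> x * (2 * norm z) + \<tau> * (2 * norm z) + 2 * norm z"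
    unfolding log_weight_def A1_def A2_def
  proof (intro norm_triangle_mono)
    show "norm (of_real x * (- polylog (3/2) z / of_real (sqrt (2 * pi)))) \<le> x * (2 * norm z)"
      using mult_left_mono[OF P[of "3/2"], of x] assms by (simp add: norm_mult norm_divide)
    show "norm (of_real \<tau> * (- polylog (5/2) z / of_real (sqrt (2 * pi)))) \<le> \<tau> * (2 * norm z)"
      using mult_left_mono[OF P[of "5/2"], of \<tau>] assms by (simp add: norm_mult norm_divide)
    show "norm (2 * B z) \<le> 2 * norm z"
      using holomorphic_B_and_bound(2)[OF z] by (simp add: norm_mult)
  qed
  then show ?thesis by (simp add: algebra_simps)
qed

lemma log_weight_0: "log_weight x \<tau> 0 = 0"
  using norm_log_weight_le[of 0 "\<bar>x\<bar>" "\<bar>\<tau>\<bar>"] holomorphic_B_and_bound(2)[of 0]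
  by (simp add: log_weight_def A1_def A2_def polylog_eq)

section \<open>The sector of the nodes and the function Q\<close>

text \<open>The sector 3 pi/4 < arg s < 5 pi/4. By \<open>left_sector_iff\<close> it is the part of
  Re s < 0 on which exp(-s^2/2) lies in the open unit disc.\<close>

definition left_sector :: "complex set" where
  "left_sector = {s. \<bar>Im s\<bar> < - Re s}"

lemma open_left_sector: "open left_sector" and convex_left_sector: "convex left_sector"
proof -
  have eq: "left_sector = {s. Re s + Im s < 0} \<inter> {s. Re s - Im s < 0}"
    by (auto simp: left_sector_def abs_less_iff)
  show "open left_sector" unfolding eq
    by (intro open_Int open_Collect_less continuous_intros)
  show "convex left_sector" unfolding eq
    using convex_halfspace_lt[of "Complex 1 1" 0] convex_halfspace_lt[of "Complex 1 (- 1)" 0]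
    by (intro convex_Int) (simp_all add: inner_complex_def)
qed

lemma left_sector_iff: "s \<in> left_sector \<longleftrightarrow> Re s < 0 \<and> Re (s\<^sup>2) > 0"
proof -
  have "Re (s\<^sup>2) = (Re s)\<^sup>2 - (Im s)\<^sup>2" by (simp add: power2_eq_square)
  moreover have "(Im s)\<^sup>2 < (Re s)\<^sup>2 \<longleftrightarrow> \<bar>Im s\<bar> < \<bar>Re s\<bar>" by (metis abs_le_square_iff linorder_not_le)
  ultimately show ?thesis by (auto simp: left_sector_def)
qed

text \<open>Moving left by t increases Re (s^2) by at least t^2. The Gaussian exp(-t^2/2) is then
  traded, through (t - 1)^2 \<ge> 0, for exp(1/2 - t) \<le> 2 exp(-t), which is easier to
  integrate.\<close>

lemma left_sector_shift:
  assumes "s \<in> left_sector" "t \<ge> 0"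
  shows "s - of_real t \<in> left_sector"
    and "norm (exp (- (s - of_real t)\<^sup>2 / 2)) \<le> exp (- Re (s\<^sup>2) / 2) * (2 * exp (- t))"
proof -
  show "s - of_real t \<in> left_sector" using assms by (auto simp: left_sector_def)
  have "Re ((s - of_real t)\<^sup>2) = Re (s\<^sup>2) - 2 * t * Re s + t\<^sup>2" by (simp add: power2_eq_square algebra_simps)
  moreover have "t * Re s \<le> 0" using assms by (auto simp: left_sector_def mult_nonneg_nonpos)
  moreover have "0 \<le> t\<^sup>2 - 2 * t + 1" using zero_le_power2[of "t - 1"] by (simp add: power2_eq_square algebra_simps)
  ultimately have "- Re ((s - of_real t)\<^sup>2) / 2 \<le> - Re (s\<^sup>2) / 2 + (1/2 - t)" by linarith
  then have "norm (exp (- (s - of_real t)\<^sup>2 / 2)) \<le> exp (- Re (s\<^sup>2) / 2 + (1/2 - t))" by simp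
  also have "\<dots> = exp (- Re (s\<^sup>2) / 2) * (exp (1/2) * exp (- t))" by (simp flip: exp_add)
  also have "\<dots> \<le> exp (- Re (s\<^sup>2) / 2) * (2 * exp (- t))"
    using exp_bound_half[of "1/2 :: real"] exp_half_le2 by (intro mult_left_mono mult_right_mono) auto
  finally show "norm (exp (- (s - of_real t)\<^sup>2 / 2)) \<le> exp (- Re (s\<^sup>2) / 2) * (2 * exp (- t))" .
qed

text \<open>The integrand has a primitive \<open>G\<close> on the convex sector, so the ray integral
  cut off at n is G s - G (s - n), holomorphic in s; an exponential tail bound makes the convergence
  locally uniform. The size of \<open>Q\<close> follows from the bound |w|/(1 - |w|) for the
  polylogarithm at w and from sqrt (2/pi) \<le> 1.\<close>

lemma Q_estimates:
  shows holomorphic_Q: "Q holomorphic_on left_sector"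
    and norm_Q_le: "s \<in> left_sector \<Longrightarrow> norm (Q s) \<le> 2 * exp (- Re (s\<^sup>2) / 2) / (1 - exp (- Re (s\<^sup>2) / 2))"
    and cnj_Q: "s \<in> left_sector \<Longrightarrow> Q (cnj s) = cnj (Q s)"
proof -
  define f where "f = (\<lambda>s. polylog (1/2) (exp (- s\<^sup>2 / 2)))"
  define M where "M = (\<lambda>s. 2 * exp (- Re (s\<^sup>2) / 2) / (1 - exp (- Re (s\<^sup>2) / 2)))"
  have lt1: "norm (exp (- s\<^sup>2 / 2)) < 1" if "s \<in> left_sector" for s
    using that by (simp add: left_sector_iff)
  have hf: "f holomorphic_on left_sector"
    unfolding f_def
    by (rule holomorphic_on_compose_gen[OF _ holomorphic_polylog, of _ _ "1/2", unfolded o_def])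
      (use lt1 in \<open>auto intro!: holomorphic_intros\<close>)
  obtain G where G: "\<And>s. s \<in> left_sector \<Longrightarrow> (G has_field_derivative f s) (at s within left_sector)"
    using holomorphic_convex_primitive'[OF convex_left_sector open_left_sector hf] by blast
  have Ghol: "G holomorphic_on left_sector"
    unfolding holomorphic_on_def field_differentiable_def using G by blast
  have fin: "((\<lambda>t. f (s - of_real t)) has_integral (G s - G (s - of_real n))) {0..n}"
    if s: "s \<in> left_sector" and n: "n \<ge> 0" for s n
  proof -
    have "((\<lambda>t. f (s - of_real t)) has_integral ((\<lambda>t. - G (s - of_real t)) n - (\<lambda>t. - G (s - of_real t)) 0)) {0..n}"
    proof (rule fundamental_theorem_of_calculus[OF n])
      fix t assume "t \<in> {0..n}"
      then have st: "s - of_real t \<in> left_sector" using left_sector_shift(1)[OF s] by auto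
      have "(G has_field_derivative f (s - of_real t)) (at (s - of_real t))"
        using G[OF st] at_within_open[OF st open_left_sector] by simp
      moreover have "((\<lambda>t. s - of_real t) has_vector_derivative (- 1)) (at t)"
        by (auto intro!: derivative_eq_intros simp: has_vector_derivative_def scaleR_conv_of_real)
      ultimately have "((\<lambda>t. G (s - of_real t)) has_vector_derivative (- 1 * f (s - of_real t))) (at t)"
        using field_vector_diff_chain_at[of "\<lambda>t. s - of_real t" "- 1" t G] by (simp add: o_def)
      from has_vector_derivative_minus[OF this]
      show "((\<lambda>t. - G (s - of_real t)) has_vector_derivative f (s - of_real t)) (at t within {0..n})"
        by (simp add: has_vector_derivative_at_within)
    qed
    then show ?thesis by simp
  qed
  have fb: "norm (f (s - of_real t)) \<le> M s * exp (- 1 * t)" if s: "s \<in> left_sector" and t: "t \<ge> 0" for s t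
  proof -
    let ?z = "exp (- (s - of_real t)\<^sup>2 / 2)"
    have st: "s - of_real t \<in> left_sector" using left_sector_shift(1)[OF s t] .
    have r: "Re ((s - of_real t)\<^sup>2) \<ge> Re (s\<^sup>2)"
    proof -
      have "Re ((s - of_real t)\<^sup>2) = Re (s\<^sup>2) - 2 * (t * Re s) + t\<^sup>2" by (simp add: power2_eq_square algebra_simps)
      moreover have "t * Re s \<le> 0" using s t by (auto simp: left_sector_def mult_nonneg_nonpos)
      ultimately show ?thesis using zero_le_power2[of t] by linarith
    qed
    have a: "norm ?z \<le> exp (- Re (s\<^sup>2) / 2)" using r by simp
    have b: "exp (- Re (s\<^sup>2) / 2) < 1" using s by (simp add: left_sector_iff)
    have "norm (f (s - of_real t)) \<le> norm ?z / (1 - norm ?z)"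
      unfolding f_def using lt1[OF st] by (intro norm_polylog_le) auto
    also have "\<dots> \<le> (exp (- Re (s\<^sup>2) / 2) * (2 * exp (- t))) / (1 - exp (- Re (s\<^sup>2) / 2))"
      using left_sector_shift(2)[OF s t] a b by (intro frac_le) (auto simp del: norm_exp_eq_Re)
    finally show ?thesis by (simp add: M_def mult_ac)
  qed
  have ei: "(\<lambda>t. c * exp (- 1 * t)) integrable_on {n..}" "integral {n..} (\<lambda>t. c * exp (- 1 * t)) = c * exp (- n)" for c n :: real
  proof -
    have "((\<lambda>t. c * exp (- 1 * t)) has_integral c * exp (- n)) {n..}"
      using has_integral_mult_right[OF has_integral_exp_minus_to_infinity[of 1 n], of c] by simp
    then show "(\<lambda>t. c * exp (- 1 * t)) integrable_on {n..}" "integral {n..} (\<lambda>t. c * exp (- 1 * t)) = c * exp (- n)"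
      by (rule has_integral_integrable, rule integral_unique)
  qed
  have fint: "(\<lambda>t. f (s - of_real t)) absolutely_integrable_on {n..}"
    and fn: "norm (integral {n..} (\<lambda>t. f (s - of_real t))) \<le> M s * exp (- n)"
    if s: "s \<in> left_sector" and n: "n \<ge> 0" for s n
  proof -
    show "(\<lambda>t. f (s - of_real t)) absolutely_integrable_on {n..}"
    proof (rule measurable_bounded_by_integrable_imp_absolutely_integrable[OF _ _ ei(1)])
      show "(\<lambda>t. f (s - of_real t)) \<in> borel_measurable (lebesgue_on {n..})"
      proof (intro continuous_imp_measurable_on_sets_lebesgue)
        show "continuous_on {n..} (\<lambda>t. f (s - of_real t))"
          by (rule continuous_on_compose2[OF holomorphic_on_imp_continuous_on[OF hf]])
            (use n left_sector_shift(1)[OF s] in \<open>auto intro!: continuous_intros\<close>)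
      qed auto
      show "norm (f (s - of_real t)) \<le> M s * exp (- 1 * t)" if "t \<in> {n..}" for t using fb[OF s, of t] that n by auto
    qed auto
    then show "norm (integral {n..} (\<lambda>t. f (s - of_real t))) \<le> M s * exp (- n)"
      unfolding ei(2)[symmetric]
      using fb[OF s] n by (intro Henstock_Kurzweil_Integration.integral_norm_bound_integral ei set_lebesgue_integral_eq_integral(1)) auto
  qed
  define J where "J = (\<lambda>s. integral {0..} (\<lambda>t. f (s - of_real t)))"
  have QJ: "Q s = of_real (sqrt (2 / pi)) * J s" for s by (simp add: Q_def J_def f_def)
  have split: "J s = (G s - G (s - of_real n)) + integral {n..} (\<lambda>t. f (s - of_real t))"
    if s: "s \<in> left_sector" and n: "n \<ge> 0" for s n
  proof -
    have "((\<lambda>t. f (s - of_real t)) has_integral (G s - G (s - of_real n)) + integral {n..} (\<lambda>t. f (s - of_real t))) ({0..n} \<union> {n..})"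
    proof (rule has_integral_Un[OF fin[OF s n] integrable_integral])
      show "negligible ({0..n} \<inter> {n..})" by (rule negligible_subset[of "{n}"]) auto
    qed (use fint[OF s n] set_lebesgue_integral_eq_integral(1) in blast)
    moreover have "{0..n} \<union> {n..} = {0..}" using n by auto
    ultimately show ?thesis by (simp add: J_def integral_unique)
  qed
  have "J field_differentiable at s" if s: "s \<in> left_sector" for s
  proof -
    \<comment> \<open>Half of Re (s^2): near s the real part of w^2 stays above this value, which
      makes the constant \<open>C\<close> of the tail bound uniform.\<close>
    define \<rho> where "\<rho> = Re (s\<^sup>2) / 2"
    have \<rho>: "\<rho> > 0" using s by (simp add: left_sector_iff \<rho>_def)
    have "open (left_sector \<inter> {w. \<rho> < Re (w\<^sup>2)})"
      by (intro open_Int open_left_sector open_Collect_less continuous_intros)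
    moreover have "s \<in> left_sector \<inter> {w. \<rho> < Re (w\<^sup>2)}" using s \<rho> by (auto simp: \<rho>_def)
    ultimately obtain r where r: "r > 0" "cball s r \<subseteq> left_sector \<inter> {w. \<rho> < Re (w\<^sup>2)}"
      using open_contains_cball by blast
    define C where "C = 2 * exp (- \<rho> / 2) / (1 - exp (- \<rho> / 2))"
    have MC: "M w \<le> C" if "w \<in> cball s r" for w
      unfolding M_def C_def using that r \<rho> by (intro frac_le mult_left_mono) (auto simp: subset_iff)
    have ul: "uniform_limit (cball s r) (\<lambda>n w. G w - G (w - of_real (real n))) J sequentially"
    proof (rule uniform_limitI)
      fix e :: real assume "e > 0"
      moreover have "(\<lambda>n. C * exp (- real n)) \<longlonglongrightarrow> 0" by real_asymp
      ultimately have "\<forall>\<^sub>F n in sequentially. C * exp (- real n) < e" by (simp add: order_tendstoD)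
      then show "\<forall>\<^sub>F n in sequentially. \<forall>w\<in>cball s r. dist (G w - G (w - of_real (real n))) (J w) < e"
      proof eventually_elim
        case (elim n)
        show ?case
        proof
          fix w assume w: "w \<in> cball s r"
          then have ws: "w \<in> left_sector" using r by auto
          have "norm (integral {real n..} (\<lambda>t. f (w - of_real t))) \<le> M w * exp (- real n)" by (rule fn[OF ws]) simp
          also have "\<dots> \<le> C * exp (- real n)" using MC[OF w] by (intro mult_right_mono) auto
          finally show "dist (G w - G (w - of_real (real n))) (J w) < e"
            using elim split[OF ws, of "real n"] by (simp add: dist_norm)
        qed
      qed
    qed
    have hol: "(\<lambda>w. G w - G (w - of_real (real n))) holomorphic_on left_sector" for n
      by (intro holomorphic_intros Ghol holomorphic_on_compose_gen[OF _ Ghol, unfolded o_def])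
        (use left_sector_shift(1)[of _ "real n"] in force)+
    obtain "J holomorphic_on ball s r"
    proof (rule holomorphic_uniform_limit[OF _ ul])
      show "\<forall>\<^sub>F n in sequentially. continuous_on (cball s r) (\<lambda>w. G w - G (w - of_real (real n))) \<and>
          (\<lambda>w. G w - G (w - of_real (real n))) holomorphic_on ball s r"
      proof (intro always_eventually allI conjI)
        fix n
        have c: "cball s r \<subseteq> left_sector" using r by auto
        show "continuous_on (cball s r) (\<lambda>w. G w - G (w - of_real (real n)))"
          using holomorphic_on_imp_continuous_on[OF hol] c by (rule continuous_on_subset)
        show "(\<lambda>w. G w - G (w - of_real (real n))) holomorphic_on ball s r"
          using hol order_trans[OF ball_subset_cball c] by (rule holomorphic_on_subset)
      qed
    qed auto
    then show ?thesis using r by (auto intro: holomorphic_on_imp_differentiable_at)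
  qed
  then have "J holomorphic_on left_sector" by (simp add: holomorphic_on_def field_differentiable_at_within)
  then show "Q holomorphic_on left_sector" unfolding QJ[abs_def] by (intro holomorphic_intros)
  show "norm (Q s) \<le> 2 * exp (- Re (s\<^sup>2) / 2) / (1 - exp (- Re (s\<^sup>2) / 2))" if s: "s \<in> left_sector"
  proof -
    have "norm (J s) \<le> M s" using fn[OF s, of 0] by (simp add: J_def)
    moreover have "sqrt (2 / pi) \<le> 1" using pi_gt3 by simp
    ultimately have "sqrt (2 / pi) * norm (J s) \<le> 1 * M s" by (intro mult_mono) auto
    then show ?thesis by (simp add: QJ norm_mult M_def)
  qed
  show "Q (cnj s) = cnj (Q s)" if s: "s \<in> left_sector"
  proof -
    have "J (cnj s) = cnj (J s)"
      unfolding J_def integral_cnj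
    proof (rule integral_cong)
      fix t :: real assume "t \<in> {0..}"
      then have "s - of_real t \<in> left_sector" using left_sector_shift(1)[OF s] by auto
      from lt1[OF this] show "f (cnj s - of_real t) = cnj (f (s - of_real t))"
        unfolding f_def by (simp flip: cnj_polylog add: exp_cnj)
    qed
    then show ?thesis by (simp add: QJ)
  qed
qed

section \<open>The nodes and the kernel\<close>

text \<open>For z = exp(-\<zeta>/2) the equation exp(-\<xi>^2/2) = z reads \<xi>^2 = \<zeta> + 4 pi
  i k, and Re \<xi> < 0 selects minus the principal root. In \<zeta> every node is a holomorphic
  function of its own; along a circle in z the nodes are permuted.\<close>

definition branch :: "complex \<Rightarrow> int \<Rightarrow> complex" where
  "branch \<zeta> k = csqrt (\<zeta> + 4 * of_real pi * \<i> * of_int k)"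

lemma branch_square: "(branch \<zeta> k)\<^sup>2 = \<zeta> + 4 * of_real pi * \<i> * of_int k"
  by (simp add: branch_def)

lemma Re_branch_square: "Re ((branch \<zeta> k)\<^sup>2) = Re \<zeta>"
  by (simp add: branch_square)

lemma Re_branch:
  assumes "Re \<zeta> > 0"
  shows "Re (branch \<zeta> k) > 0" "sqrt (Re \<zeta>) \<le> Re (branch \<zeta> k)" "branch \<zeta> k \<noteq> 0"
    "- branch \<zeta> k \<in> left_sector" "norm (branch \<zeta> k) \<ge> sqrt (Re \<zeta>)"
proof -
  let ?w = "branch \<zeta> k"
  have 0: "0 \<le> Re ?w" unfolding branch_def by (rule Re_csqrt)
  have 1: "Re \<zeta> = (Re ?w)\<^sup>2 - (Im ?w)\<^sup>2"
    unfolding Re_branch_square[of \<zeta> k, symmetric] by (simp add: power2_eq_square)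
  then have 2: "Re \<zeta> \<le> (Re ?w)\<^sup>2" by simp
  then show s: "sqrt (Re \<zeta>) \<le> Re ?w" using 0 real_le_lsqrt real_sqrt_le_iff real_sqrt_abs by (metis abs_of_nonneg)
  show r: "Re ?w > 0" using s assms by (meson less_le_trans real_sqrt_gt_zero)
  then show "?w \<noteq> 0" by auto
  show "- ?w \<in> left_sector" using r assms by (simp add: left_sector_iff Re_branch_square)
  show "norm ?w \<ge> sqrt (Re \<zeta>)" using s complex_Re_le_cmod[of ?w] by linarith
qed

lemma holomorphic_branch: "(\<lambda>\<zeta>. branch \<zeta> k) holomorphic_on {\<zeta>. Re \<zeta> > 0}"
  unfolding branch_def
  by (intro holomorphic_on_compose_gen[OF _ holomorphic_on_csqrt, unfolded o_def] holomorphic_intros)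
    (auto simp: complex_nonpos_Reals_iff)

lemma S_minus_branch:
  assumes "Re \<zeta> > 0"
  shows "bij_betw (\<lambda>k. - branch \<zeta> k) UNIV (S_minus (exp (- \<zeta> / 2)))"
proof (rule bij_betwI')
  show "(- branch \<zeta> k = - branch \<zeta> l) = (k = l)" for k l
  proof
    assume "- branch \<zeta> k = - branch \<zeta> l"
    then have "(branch \<zeta> k)\<^sup>2 = (branch \<zeta> l)\<^sup>2" by simp
    then show "k = l" by (simp add: branch_square)
  qed simp
  show "- branch \<zeta> k \<in> S_minus (exp (- \<zeta> / 2))" for k
  proof -
    have "- (branch \<zeta> k)\<^sup>2 / 2 = - \<zeta> / 2 - 2 * of_int k * of_real pi * \<i>" by (simp add: branch_square field_simps)
    moreover have "exp (- \<zeta> / 2 - 2 * of_int k * of_real pi * \<i>) = exp (- \<zeta> / 2)"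
      unfolding exp_eq by (rule exI[of _ "- k"]) simp
    ultimately show ?thesis using Re_branch(1)[OF assms, of k] by (simp add: S_minus_def)
  qed
  show "\<exists>k\<in>UNIV. s = - branch \<zeta> k" if "s \<in> S_minus (exp (- \<zeta> / 2))" for s
  proof -
    have e: "exp (- s\<^sup>2 / 2) = exp (- \<zeta> / 2)" and s: "Re s < 0" using that by (auto simp: S_minus_def)
    from e obtain n where n: "- s\<^sup>2 / 2 = - \<zeta> / 2 + (of_int (2 * n) * of_real pi) * \<i>"
      unfolding exp_eq by auto
    have "(- s)\<^sup>2 = \<zeta> + 4 * of_real pi * \<i> * of_int (- n)"
    proof -
      have "s\<^sup>2 = (- 2) * (- s\<^sup>2 / 2)" by simp
      also have "\<dots> = \<zeta> + 4 * of_real pi * \<i> * of_int (- n)" unfolding n by (simp add: algebra_simps)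
      finally show ?thesis by simp
    qed
    then have "branch \<zeta> (- n) = csqrt ((- s)\<^sup>2)" by (simp add: branch_def)
    also have "\<dots> = - s" using s by (intro csqrt_square) auto
    finally show ?thesis by (intro bexI[of _ "- n"]) auto
  qed
qed

section \<open>The cubic phase on the hyperbola of nodes\<close>

text \<open>\<open>Phi\<close> without \<open>Q\<close>, in the variable w = -\<xi> of positive real
  part. For X > 0 its critical point there is sqrt (X/\<tau>).\<close>

definition cubic_phase :: "real \<Rightarrow> real \<Rightarrow> complex \<Rightarrow> complex" where
  "cubic_phase \<tau> X w = of_real \<tau> * w ^ 3 / 3 - of_real X * w"

definition weight :: "int \<Rightarrow> real" where "weight k = 1 / (1 + (of_int k)\<^sup>2)"

lemma weight_pos: "weight k > 0"
  unfolding weight_def by (intro divide_pos_pos) (auto intro: add_pos_nonneg)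

lemma summable_on_weight: "weight summable_on UNIV"
proof (rule summable_on_int)
  have s: "summable (\<lambda>n. 2 * (1 / (real (Suc n))\<^sup>2))"
    using inverse_squares_sums by (intro summable_mult) (auto simp: sums_iff add.commute)
  have b: "norm (weight (int n)) \<le> 2 * (1 / (real (Suc n))\<^sup>2)" for n
  proof -
    have "(real (Suc n))\<^sup>2 \<le> 2 * (1 + (real n)\<^sup>2)"
      using zero_le_power2[of "real n - 1"] by (simp add: power2_eq_square algebra_simps)
    moreover have "0 < (real (Suc n))\<^sup>2" "0 < 1 + (real n)\<^sup>2" by (auto intro: add_pos_nonneg)
    ultimately show ?thesis by (simp add: weight_def divide_simps)
  qed
  show "summable (\<lambda>n. weight (int n))" by (rule summable_comparison_test'[OF s, of 0]) (rule b)
  then show "summable (\<lambda>n. weight (- int n))" by (simp add: weight_def)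
qed (use weight_pos less_imp_le in blast)

definition weight_sum :: real where "weight_sum = (\<Sum>\<^sub>\<infinity>k. weight k)"

lemma weight_sum_pos: "weight_sum \<ge> 1"
proof -
  have "weight 0 \<le> weight_sum"
    using infsum_mono_neutral[of weight "{0}" weight UNIV] summable_on_weight weight_pos
    by (simp add: weight_sum_def less_imp_le)
  then show ?thesis by (simp add: weight_def)
qed

text \<open>On the hyperbola p^2 - q^2 = r^2 the real part depends on p alone. Written around the
  vertex p = r it is the value there, minus (\<tau>/3) (p^3 - r^3), minus the nonnegative quantity
  (\<tau>/3) (p - r)^2 (p + 2 r) + X (p - r), which is discarded. The cubic difference is kept to
  make the sum over nodes converge.\<close>

lemma Re_cubic_phase_le:
  assumes w: "Re w > 0" "Re (w\<^sup>2) = r\<^sup>2" and r: "r > 0" and X: "X \<ge> 0" and \<tau>: "\<tau> > 0"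
  shows "Re (cubic_phase \<tau> X w) \<le> - (\<tau> / 3) * ((Re w) ^ 3 - r ^ 3) + \<tau> * r ^ 3 / 3 - r * X"
    and "r \<le> Re w"
proof -
  define p q where "p = Re w" and "q = Im w"
  have pq: "p\<^sup>2 - q\<^sup>2 = r\<^sup>2" using w(2) by (simp add: p_def q_def power2_eq_square)
  then have "r\<^sup>2 \<le> p\<^sup>2" using zero_le_power2[of q] by linarith
  then show rp: "r \<le> Re w" using w(1) r by (simp add: p_def power2_le_iff_abs_le abs_le_square_iff[symmetric])
  have "Re (cubic_phase \<tau> X w) = \<tau> * (p ^ 3 - 3 * p * q\<^sup>2) / 3 - X * p"
    by (simp add: cubic_phase_def p_def q_def power3_eq_cube power2_eq_square algebra_simps)
  also have "q\<^sup>2 = p\<^sup>2 - r\<^sup>2" using pq by simp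
  also have "\<tau> * (p ^ 3 - 3 * p * (p\<^sup>2 - r\<^sup>2)) / 3 - X * p
     = - (\<tau> / 3) * (p ^ 3 - r ^ 3) + \<tau> * r ^ 3 / 3 - r * X - ((\<tau> / 3) * ((p - r)\<^sup>2 * (p + 2 * r)) + X * (p - r))"
    by (simp add: power3_eq_cube power2_eq_square field_simps)
  also have "\<dots> \<le> - (\<tau> / 3) * (p ^ 3 - r ^ 3) + \<tau> * r ^ 3 / 3 - r * X"
  proof -
    have "0 \<le> (\<tau> / 3) * ((p - r)\<^sup>2 * (p + 2 * r)) + X * (p - r)"
      using rp r X \<tau> by (intro add_nonneg_nonneg mult_nonneg_nonneg) (auto simp: p_def)
    then show ?thesis by linarith
  qed
  finally show "Re (cubic_phase \<tau> X w) \<le> - (\<tau> / 3) * ((Re w) ^ 3 - r ^ 3) + \<tau> * r ^ 3 / 3 - r * X"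
    by (simp add: p_def)
qed

text \<open>The nodes are spaced evenly in t = Im (w^2) = 2 p q, so decay in t is what summation
  needs. Here p^3 - r^3 \<ge> p q^2 = t^2/(4 p). For |t| \<le> 1 the constant 2 suffices; for |t|
  \<ge> 1 the bound exp(-y) \<le> 2/y^2 with y = \<tau> t^2/(12 p) gives 288 p^2/(\<tau>^2 t^4), and
  p^2 \<le> (1 + r^2) |t| leads to 576/\<tau>^2.\<close>

lemma exp_cubic_decay:
  assumes w: "Re w > 0" "Re (w\<^sup>2) = r\<^sup>2" and r: "r > 0" and \<tau>: "\<tau> > 0"
  shows "exp (- (\<tau> / 3) * ((Re w) ^ 3 - r ^ 3)) \<le> (2 + 576 / \<tau>\<^sup>2) * (1 + r\<^sup>2) / (1 + (Im (w\<^sup>2))\<^sup>2)"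
proof -
  define p q where "p = Re w" and "q = Im w"
  define t where "t = 2 * p * q"
  have t: "Im (w\<^sup>2) = t" by (simp add: t_def p_def q_def power2_eq_square)
  have pq: "p\<^sup>2 - q\<^sup>2 = r\<^sup>2" using w(2) by (simp add: p_def q_def power2_eq_square)
  then have "r\<^sup>2 \<le> p\<^sup>2" using zero_le_power2[of q] by linarith
  then have rp: "r \<le> p" "0 < p" using w(1) r by (simp_all add: p_def power2_le_iff_abs_le abs_le_square_iff[symmetric])
  have C: "1 \<le> (2 + 576 / \<tau>\<^sup>2) * (1 + r\<^sup>2) / 2"
  proof -
    have "1 * 1 \<le> (1 + 288 / \<tau>\<^sup>2) * (1 + r\<^sup>2)" by (intro mult_mono) auto
    then show ?thesis by (simp add: algebra_simps)
  qed
  have d: "p ^ 3 - r ^ 3 \<ge> p * q\<^sup>2"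
  proof -
    have "p ^ 3 - r ^ 3 = p * q\<^sup>2 + r\<^sup>2 * (p - r)"
    proof -
      have q2: "q\<^sup>2 = p\<^sup>2 - r\<^sup>2" using pq by simp
      show ?thesis unfolding q2 by (simp add: power3_eq_cube power2_eq_square algebra_simps)
    qed
    then show ?thesis using rp by simp
  qed
  show ?thesis
  proof (cases "\<bar>t\<bar> \<le> 1")
    case True
    then have "t\<^sup>2 \<le> 1" by (simp add: abs_square_le_1)
    then have "1 / 2 \<le> 1 / (1 + t\<^sup>2)" by (intro divide_left_mono) (auto intro: add_pos_nonneg)
    have "0 \<le> p * q\<^sup>2" using rp by simp
    then have "exp (- (\<tau> / 3) * (p ^ 3 - r ^ 3)) \<le> 1" using d \<tau> by simp
    also have "1 \<le> (2 + 576 / \<tau>\<^sup>2) * (1 + r\<^sup>2) * (1 / 2)" using C by simp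
    also have "\<dots> \<le> (2 + 576 / \<tau>\<^sup>2) * (1 + r\<^sup>2) * (1 / (1 + t\<^sup>2))"
      using \<open>1 / 2 \<le> 1 / (1 + t\<^sup>2)\<close> by (intro mult_left_mono) auto
    finally show ?thesis by (simp add: t p_def)
  next
    case False
    then have t1: "\<bar>t\<bar> \<ge> 1" "t\<^sup>2 \<ge> 1" using power_mono[of 1 "\<bar>t\<bar>" 2] by auto
    have t0: "t\<^sup>2 > 0" "\<bar>t\<bar> > 0" using t1 by linarith+
    define y where "y = (\<tau> / 3) * (p * q\<^sup>2)"
    have q2: "q\<^sup>2 = t\<^sup>2 / (4 * p\<^sup>2)" using rp by (simp add: t_def power_mult_distrib)
    have y: "y = \<tau> * t\<^sup>2 / (12 * p)" using rp unfolding y_def q2 by (simp add: power2_eq_square)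
    have y0: "y > 0" using y \<tau> rp t0 by simp
    \<comment> \<open>From (p^2 + q^2)^2 = (p^2 - q^2)^2 + (2 p q)^2 = r^4 + t^2.\<close>
    have p2: "p\<^sup>2 \<le> (1 + r\<^sup>2) * \<bar>t\<bar>"
    proof -
      have "(p\<^sup>2)\<^sup>2 \<le> (p\<^sup>2 + q\<^sup>2)\<^sup>2" by (intro power_mono) auto
      also have "\<dots> = (r\<^sup>2)\<^sup>2 + t\<^sup>2" unfolding pq[symmetric] t_def
        by (simp only: power2_eq_square) (simp add: algebra_simps)
      also have "\<dots> \<le> (r\<^sup>2 + \<bar>t\<bar>)\<^sup>2"
      proof -
        have "(r\<^sup>2 + \<bar>t\<bar>)\<^sup>2 = (r\<^sup>2)\<^sup>2 + t\<^sup>2 + 2 * r\<^sup>2 * \<bar>t\<bar>" by (simp only: power2_sum power2_abs)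
        then show ?thesis by simp
      qed
      finally have "(p\<^sup>2)\<^sup>2 \<le> (r\<^sup>2 + \<bar>t\<bar>)\<^sup>2" .
      then have "p\<^sup>2 \<le> r\<^sup>2 + \<bar>t\<bar>" by (rule power2_le_imp_le) simp
      also have "\<dots> \<le> r\<^sup>2 * \<bar>t\<bar> + \<bar>t\<bar>" using t1 mult_left_mono[of 1 "\<bar>t\<bar>" "r\<^sup>2"] by auto
      finally have "p\<^sup>2 \<le> \<bar>t\<bar> + r\<^sup>2 * \<bar>t\<bar>" by (simp only: add.commute)
      then show ?thesis unfolding distrib_right mult_1_left .
    qed
    have "exp (- (\<tau> / 3) * (p ^ 3 - r ^ 3)) \<le> exp (- y)"
      using mult_left_mono[OF d, of "\<tau> / 3"] \<tau> by (simp add: y_def)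
    also have "\<dots> \<le> 2 / y\<^sup>2"
    proof -
      have "y\<^sup>2 / 2 \<le> exp y" using exp_lower_Taylor_quadratic[of y] y0 by simp
      then have "1 / exp y \<le> 1 / (y\<^sup>2 / 2)" using y0 by (intro divide_left_mono) auto
      then show ?thesis by (simp add: exp_minus field_simps)
    qed
    also have "\<dots> = 288 / \<tau>\<^sup>2 * (p\<^sup>2 / (t\<^sup>2 * t\<^sup>2))"
    proof -
      have "y\<^sup>2 = \<tau>\<^sup>2 * (t\<^sup>2 * t\<^sup>2) / (144 * p\<^sup>2)"
        unfolding y by (simp add: power_mult_distrib power_divide power2_eq_square)
      then show ?thesis by simp
    qed
    also have "\<dots> \<le> 288 / \<tau>\<^sup>2 * (((1 + r\<^sup>2) * \<bar>t\<bar>) / (t\<^sup>2 * t\<^sup>2))"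
      using p2 by (intro mult_left_mono divide_right_mono) auto
    also have "\<dots> \<le> 288 / \<tau>\<^sup>2 * ((1 + r\<^sup>2) * (2 / (1 + t\<^sup>2)))"
    proof (intro mult_left_mono)
      have "\<bar>t\<bar> * (1 + t\<^sup>2) \<le> t\<^sup>2 * (t\<^sup>2 + t\<^sup>2)"
      proof (rule mult_mono)
        have "\<bar>t\<bar> * 1 \<le> \<bar>t\<bar> * \<bar>t\<bar>" using t1 by (intro mult_left_mono) auto
        then show "\<bar>t\<bar> \<le> t\<^sup>2" by (simp add: power2_eq_square)
      qed (use t1 in auto)
      then have "\<bar>t\<bar> / (t\<^sup>2 * t\<^sup>2) \<le> 2 / (1 + t\<^sup>2)"
        using t0 by (simp add: divide_simps add_pos_pos) (simp add: algebra_simps)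
      then have "(1 + r\<^sup>2) * (\<bar>t\<bar> / (t\<^sup>2 * t\<^sup>2)) \<le> (1 + r\<^sup>2) * (2 / (1 + t\<^sup>2))"
        by (intro mult_left_mono) auto
      then show "(1 + r\<^sup>2) * \<bar>t\<bar> / (t\<^sup>2 * t\<^sup>2) \<le> (1 + r\<^sup>2) * (2 / (1 + t\<^sup>2))" by simp
    qed auto
    also have "\<dots> = (576 / \<tau>\<^sup>2) * (1 + r\<^sup>2) / (1 + t\<^sup>2)" by simp
    also have "\<dots> \<le> (2 + 576 / \<tau>\<^sup>2) * (1 + r\<^sup>2) / (1 + t\<^sup>2)"
      by (intro divide_right_mono mult_right_mono) auto
    finally show ?thesis by (simp add: t p_def)
  qed
qed

text \<open>
  The factor \<open>2 + 576 / \<tau>\<^sup>2\<close> is that of \<open>exp_cubic_decay\<close>; the factor \<open>6\<close> is the price of replacing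
  \<open>1 + (Im \<zeta> + 4 \<pi> k)\<^sup>2\<close> by \<open>1 + k\<^sup>2\<close> when \<open>\<bar>Im \<zeta>\<bar> \<le> 6 \<pi>\<close>.
\<close>

definition cubic_bound :: "real \<Rightarrow> real \<Rightarrow> real \<Rightarrow> real" where
  "cubic_bound \<tau> X \<rho> = 6 * (2 + 576 / \<tau>\<^sup>2) * (1 + \<rho>) * exp (\<tau> * sqrt \<rho> ^ 3 / 3 - sqrt \<rho> * X)"

lemma cubic_bound_pos: "\<rho> > 0 \<Longrightarrow> cubic_bound \<tau> X \<rho> > 0"
  unfolding cubic_bound_def by (intro mult_pos_pos) (auto intro: add_pos_nonneg)

lemma norm_exp_cubic_phase_le:
  assumes \<zeta>: "Re \<zeta> > 0" "\<bar>Im \<zeta>\<bar> \<le> 6 * pi" and X: "X \<ge> 0" and \<tau>: "\<tau> > 0"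
  shows "norm (exp (cubic_phase \<tau> X (branch \<zeta> k))) \<le> cubic_bound \<tau> X (Re \<zeta>) * weight k"
proof -
  define r w where "r = sqrt (Re \<zeta>)" and "w = branch \<zeta> k"
  have r: "r > 0" "r\<^sup>2 = Re \<zeta>" using \<zeta> by (auto simp: r_def)
  have w: "Re w > 0" "Re (w\<^sup>2) = r\<^sup>2" using Re_branch(1)[OF \<zeta>(1)] by (auto simp: w_def Re_branch_square r)
  have t: "Im (w\<^sup>2) = Im \<zeta> + 4 * pi * of_int k" by (simp add: w_def branch_square)
  \<comment> \<open>With a = Im (w^2) and b = Im \<zeta>, (4 pi k)^2 = (a - b)^2 \<le> 2 a^2 + 72
    pi^2. Division by pi^2 leaves 16 k^2 \<le> 2 a^2 + 72, which implies the claim.\<close>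
  have kt: "1 + (of_int k)\<^sup>2 \<le> 6 * (1 + (Im (w\<^sup>2))\<^sup>2)"
  proof -
    define a b where "a = Im (w\<^sup>2)" and "b = Im \<zeta>"
    have "(4 * pi * of_int k)\<^sup>2 = (a - b)\<^sup>2" by (simp add: a_def b_def t)
    also have "\<dots> \<le> 2 * a\<^sup>2 + 2 * b\<^sup>2" using zero_le_power2[of "a + b"] by (simp add: power2_eq_square algebra_simps)
    also have "b\<^sup>2 \<le> (6 * pi)\<^sup>2" using \<zeta>(2) power_mono[of "\<bar>b\<bar>" "6 * pi" 2] by (simp add: b_def)
    finally have "16 * pi\<^sup>2 * (of_int k)\<^sup>2 \<le> 2 * a\<^sup>2 + 72 * pi\<^sup>2" by (simp add: power_mult_distrib)
    moreover have "a\<^sup>2 * 1 \<le> a\<^sup>2 * pi\<^sup>2" using pi_gt3 by (intro mult_left_mono one_le_power) auto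
    ultimately have "pi\<^sup>2 * (16 * (of_int k)\<^sup>2) \<le> pi\<^sup>2 * (2 * a\<^sup>2 + 72)" by (simp add: algebra_simps)
    then have "16 * (of_int k)\<^sup>2 \<le> 2 * a\<^sup>2 + (72::real)" by (simp add: mult_le_cancel_left)
    have lin: "K \<le> 5 + 6 * A" if "16 * K \<le> 2 * A + 72" "0 \<le> A" for K A :: real using that by linarith
    have "(of_int k)\<^sup>2 \<le> 5 + 6 * a\<^sup>2" by (rule lin) (fact, simp)
    then show ?thesis by (simp add: a_def)
  qed
  have "norm (exp (cubic_phase \<tau> X w)) = exp (Re (cubic_phase \<tau> X w))" by simp
  also have "\<dots> \<le> exp (- (\<tau> / 3) * ((Re w) ^ 3 - r ^ 3) + (\<tau> * r ^ 3 / 3 - r * X))"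
    using Re_cubic_phase_le(1)[OF w r(1) X \<tau>] by simp
  also have "\<dots> = exp (- (\<tau> / 3) * ((Re w) ^ 3 - r ^ 3)) * exp (\<tau> * r ^ 3 / 3 - r * X)" by (rule exp_add)
  also have "\<dots> \<le> ((2 + 576 / \<tau>\<^sup>2) * (1 + r\<^sup>2) * (6 * weight k)) * exp (\<tau> * r ^ 3 / 3 - r * X)"
  proof (rule mult_right_mono)
    have "exp (- (\<tau> / 3) * ((Re w) ^ 3 - r ^ 3)) \<le> (2 + 576 / \<tau>\<^sup>2) * (1 + r\<^sup>2) * (1 / (1 + (Im (w\<^sup>2))\<^sup>2))"
      using exp_cubic_decay[OF w r(1) \<tau>] by simp
    also have "\<dots> \<le> (2 + 576 / \<tau>\<^sup>2) * (1 + r\<^sup>2) * (6 * weight k)"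
    proof (rule mult_left_mono)
      have "0 < 1 + (Im (w\<^sup>2))\<^sup>2" "0 < 1 + (real_of_int k)\<^sup>2" by (auto intro: add_pos_nonneg)
      then show "1 / (1 + (Im (w\<^sup>2))\<^sup>2) \<le> 6 * weight k"
        using kt unfolding weight_def by (simp add: divide_simps)
    qed auto
    finally show "exp (- (\<tau> / 3) * ((Re w) ^ 3 - r ^ 3)) \<le> (2 + 576 / \<tau>\<^sup>2) * (1 + r\<^sup>2) * (6 * weight k)" .
  qed auto
  also have "\<dots> = cubic_bound \<tau> X (Re \<zeta>) * weight k"
    by (simp add: cubic_bound_def r(2) flip: r_def)
  finally show ?thesis by (simp add: w_def)
qed

section \<open>Bounds for the kernel entries\<close>

definition tail_bound :: "real \<Rightarrow> real" where
  "tail_bound \<rho> = 2 * exp (- \<rho> / 2) / (1 - exp (- \<rho> / 2))"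

definition branch_phase :: "real \<Rightarrow> real \<Rightarrow> complex \<Rightarrow> int \<Rightarrow> complex" where
  "branch_phase \<tau> x \<zeta> k = cubic_phase \<tau> x (branch \<zeta> k) - Q (- branch \<zeta> k)"

lemma Phi_branch: "Phi \<tau> x (- branch \<zeta> k) = branch_phase \<tau> x \<zeta> k"
  by (simp add: Phi_def branch_phase_def cubic_phase_def power3_eq_cube)

lemma norm_Q_branch_le: "Re \<zeta> > 0 \<Longrightarrow> norm (Q (- branch \<zeta> k)) \<le> tail_bound (Re \<zeta>)"
  using norm_Q_le[OF Re_branch(4)[of \<zeta> k]] by (simp add: tail_bound_def Re_branch_square)

lemma norm_exp_branch_phase_le:
  assumes \<zeta>: "Re \<zeta> > 0" "\<bar>Im \<zeta>\<bar> \<le> 6 * pi" and X: "X \<ge> 0" and \<tau>: "\<tau> > 0"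
    and N: "cubic_bound \<tau> X (Re \<zeta>) * exp (tail_bound (Re \<zeta>)) \<le> N"
  shows "norm (exp (branch_phase \<tau> X \<zeta> k)) \<le> N * weight k"
proof -
  have "Re (- Q (- branch \<zeta> k)) \<le> norm (Q (- branch \<zeta> k))"
    using complex_Re_le_cmod[of "- Q (- branch \<zeta> k)"] by simp
  also have "\<dots> \<le> tail_bound (Re \<zeta>)" using \<zeta> by (intro norm_Q_branch_le)
  finally have q: "norm (exp (- Q (- branch \<zeta> k))) \<le> exp (tail_bound (Re \<zeta>))" by simp
  have "norm (exp (branch_phase \<tau> X \<zeta> k)) = norm (exp (cubic_phase \<tau> X (branch \<zeta> k))) * norm (exp (- Q (- branch \<zeta> k)))"
    unfolding branch_phase_def diff_conv_add_uminus exp_add norm_mult ..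
  also have "\<dots> \<le> (cubic_bound \<tau> X (Re \<zeta>) * weight k) * exp (tail_bound (Re \<zeta>))"
    using norm_exp_cubic_phase_le[OF \<zeta> X \<tau>, of k] q cubic_bound_pos[OF \<zeta>(1), of \<tau> X] weight_pos[of k]
    by (intro mult_mono) auto
  also have "\<dots> \<le> N * weight k"
    using mult_right_mono[OF N, of "weight k"] weight_pos[of k] by (simp add: mult_ac)
  finally show ?thesis .
qed

definition kernel_summand :: "real \<Rightarrow> real \<Rightarrow> real \<Rightarrow> complex \<Rightarrow> int \<Rightarrow> int \<Rightarrow> int \<Rightarrow> complex" where
  "kernel_summand x \<tau> \<gamma> \<zeta> k m l =
     exp (1/2 * branch_phase \<tau> x \<zeta> k + branch_phase \<tau> x \<zeta> m + 1/2 * branch_phase \<tau> x \<zeta> l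
        + of_real \<gamma> / 4 * ((branch \<zeta> k)\<^sup>2 - 2 * (branch \<zeta> m)\<^sup>2 + (branch \<zeta> l)\<^sup>2))
     / (csqrt (branch \<zeta> k) * branch \<zeta> m * (branch \<zeta> k + branch \<zeta> m) * (branch \<zeta> m + branch \<zeta> l) * csqrt (branch \<zeta> l))"

definition kernel_matrix :: "real \<Rightarrow> real \<Rightarrow> real \<Rightarrow> complex \<Rightarrow> int \<Rightarrow> int \<Rightarrow> complex" where
  "kernel_matrix x \<tau> \<gamma> \<zeta> k l = (\<Sum>\<^sub>\<infinity>m. kernel_summand x \<tau> \<gamma> \<zeta> k m l)"

lemma K_kernel_branch:
  assumes "Re \<zeta> > 0"
  shows "K_kernel x \<tau> \<gamma> (exp (- \<zeta> / 2)) (- branch \<zeta> k) (- branch \<zeta> l) = kernel_matrix x \<tau> \<gamma> \<zeta> k l"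
proof -
  \<comment> \<open>The nodes are minus the branches: the two sums of nodes change sign together, so
    the denominator is unchanged.\<close>
  have d: "c * w * (- u + - w) * (- w + - v) * d = c * w * (u + w) * (w + v) * d" for c d u v w :: complex
    by (simp add: algebra_simps)
  show ?thesis
    unfolding K_kernel_def kernel_matrix_def
    by (subst infsum_reindex_bij_betw[OF S_minus_branch[OF assms], symmetric], rule infsum_cong)
      (simp only: kernel_summand_def Phi_branch power2_minus minus_minus d)
qed

text \<open>An entry of the kernel carries half the phase of each outer node, so it is dominated by
  a product u_k u_l; the second root comes from the sum over the inner node. The sum of the squares
  is the ratio of the geometric majorant of the Fredholm series.\<close>

definition kernel_factor :: "real \<Rightarrow> real \<Rightarrow> int \<Rightarrow> real" where
  "kernel_factor N \<rho> k = sqrt (N * weight k) * sqrt (N * weight_sum / (4 * \<rho>\<^sup>2))"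

lemma kernel_factor_square:
  assumes "N \<ge> 0"
  shows "(\<lambda>k. (kernel_factor N \<rho> k)\<^sup>2) summable_on UNIV"
    and "(\<Sum>\<^sub>\<infinity>k. (kernel_factor N \<rho> k)\<^sup>2) = (N * weight_sum / (2 * \<rho>))\<^sup>2"
proof -
  have e: "(kernel_factor N \<rho> k)\<^sup>2 = (N * (N * weight_sum / (4 * \<rho>\<^sup>2))) * weight k" for k
    using assms weight_pos[of k] weight_sum_pos by (simp add: kernel_factor_def power_mult_distrib less_imp_le)
  show "(\<lambda>k. (kernel_factor N \<rho> k)\<^sup>2) summable_on UNIV"
    unfolding e by (intro summable_on_cmult_right summable_on_weight)
  show "(\<Sum>\<^sub>\<infinity>k. (kernel_factor N \<rho> k)\<^sup>2) = (N * weight_sum / (2 * \<rho>))\<^sup>2"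
    unfolding e infsum_cmult_right' weight_sum_def[symmetric] by (simp add: power2_eq_square)
qed

lemma norm_kernel_denominator:
  assumes "0 < \<rho>0" "\<rho>0 \<le> Re \<zeta>"
  shows "4 * \<rho>0\<^sup>2 \<le> norm (csqrt (branch \<zeta> k) * branch \<zeta> m * (branch \<zeta> k + branch \<zeta> m) * (branch \<zeta> m + branch \<zeta> l) * csqrt (branch \<zeta> l))"
    and "csqrt (branch \<zeta> k) * branch \<zeta> m * (branch \<zeta> k + branch \<zeta> m) * (branch \<zeta> m + branch \<zeta> l) * csqrt (branch \<zeta> l) \<noteq> 0"
proof -
  define r where "r = sqrt \<rho>0"
  have r: "r > 0" "r\<^sup>2 = \<rho>0" using assms by (auto simp: r_def)
  have R0: "Re \<zeta> > 0" using assms by simp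
  have rr: "r \<le> sqrt (Re \<zeta>)" using assms by (simp add: r_def)
  have b: "r \<le> Re (branch \<zeta> k)" for k using Re_branch(2)[OF R0, of k] rr by simp
  have n: "r \<le> norm (branch \<zeta> k)" for k using b[of k] complex_Re_le_cmod[of "branch \<zeta> k"] by simp
  have s: "2 * r \<le> norm (branch \<zeta> k + branch \<zeta> m)" for k m
    using b[of k] b[of m] complex_Re_le_cmod[of "branch \<zeta> k + branch \<zeta> m"] by simp
  have c: "sqrt r \<le> norm (csqrt (branch \<zeta> k))" for k
    using n[of k] by (simp add: norm_csqrt)
  have "4 * \<rho>0\<^sup>2 = sqrt r * r * (2 * r) * (2 * r) * sqrt r"
    using r(1) unfolding r(2)[symmetric] by (simp add: power2_eq_square)
  also have "\<dots> \<le> norm (csqrt (branch \<zeta> k)) * norm (branch \<zeta> m) * norm (branch \<zeta> k + branch \<zeta> m) * norm (branch \<zeta> m + branch \<zeta> l) * norm (csqrt (branch \<zeta> l))"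
    using r(1) by (intro mult_mono n s c mult_nonneg_nonneg) auto
  finally show 1: "4 * \<rho>0\<^sup>2 \<le> norm (csqrt (branch \<zeta> k) * branch \<zeta> m * (branch \<zeta> k + branch \<zeta> m) * (branch \<zeta> m + branch \<zeta> l) * csqrt (branch \<zeta> l))"
    by (simp add: norm_mult)
  have "0 < 4 * \<rho>0\<^sup>2" using assms by simp
  then show "csqrt (branch \<zeta> k) * branch \<zeta> m * (branch \<zeta> k + branch \<zeta> m) * (branch \<zeta> m + branch \<zeta> l) * csqrt (branch \<zeta> l) \<noteq> 0"
    using 1 by (metis norm_zero not_less)
qed

lemma norm_exp_half: "norm (exp (1/2 * z)) = sqrt (norm (exp z))" for z :: complex
proof -
  have "exp (Re z) = (exp (Re z / 2))\<^sup>2" by (simp flip: exp_double)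
  then show ?thesis by simp
qed

context
  fixes x \<tau> \<gamma> N \<rho>0 :: real
  assumes x: "x \<ge> 0" and \<tau>: "\<tau> > 0" and \<rho>0: "\<rho>0 > 0"
begin

lemma norm_kernel_summand_le:
  assumes \<zeta>: "\<rho>0 \<le> Re \<zeta>" "\<bar>Im \<zeta>\<bar> \<le> 6 * pi"
    and N: "cubic_bound \<tau> x (Re \<zeta>) * exp (tail_bound (Re \<zeta>)) \<le> N"
  shows "norm (kernel_summand x \<tau> \<gamma> \<zeta> k m l)
    \<le> (sqrt (N * weight k) * sqrt (N * weight l) / (4 * \<rho>0\<^sup>2) * N) * weight m"
proof -
  have R0: "Re \<zeta> > 0" using \<zeta> \<rho>0 by simp
  have E: "norm (exp (branch_phase \<tau> x \<zeta> k)) \<le> N * weight k" for k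
    by (rule norm_exp_branch_phase_le[OF R0 \<zeta>(2) x \<tau> N])
  \<comment> \<open>All squares of nodes have real part Re \<zeta>, and 1 - 2 + 1 = 0, so the factor
    with \<gamma> has modulus 1.\<close>
  have g: "norm (exp (of_real \<gamma> / 4 * ((branch \<zeta> k)\<^sup>2 - 2 * (branch \<zeta> m)\<^sup>2 + (branch \<zeta> l)\<^sup>2))) = 1"
  proof -
    have "Re (of_real \<gamma> / 4 * ((branch \<zeta> k)\<^sup>2 - 2 * (branch \<zeta> m)\<^sup>2 + (branch \<zeta> l)\<^sup>2))
       = \<gamma> / 4 * (Re ((branch \<zeta> k)\<^sup>2) - 2 * Re ((branch \<zeta> m)\<^sup>2) + Re ((branch \<zeta> l)\<^sup>2))"
      by (simp add: Re_divide_numeral)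
    then show ?thesis by (simp only: norm_exp_eq_Re Re_branch_square) simp
  qed
  have ee: "norm (exp (1/2 * a + b + 1/2 * c + d)) = sqrt (norm (exp a)) * norm (exp b) * sqrt (norm (exp c))"
    if "norm (exp d) = 1" for a b c d :: complex
    by (simp only: exp_add norm_mult norm_exp_half that mult_1_right)
  have "norm (kernel_summand x \<tau> \<gamma> \<zeta> k m l)
     = (sqrt (norm (exp (branch_phase \<tau> x \<zeta> k))) * norm (exp (branch_phase \<tau> x \<zeta> m)) * sqrt (norm (exp (branch_phase \<tau> x \<zeta> l))))
       / norm (csqrt (branch \<zeta> k) * branch \<zeta> m * (branch \<zeta> k + branch \<zeta> m) * (branch \<zeta> m + branch \<zeta> l) * csqrt (branch \<zeta> l))"
    unfolding kernel_summand_def norm_divide ee[OF g] ..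
  also have "\<dots> \<le> (sqrt (N * weight k) * (N * weight m) * sqrt (N * weight l)) / (4 * \<rho>0\<^sup>2)"
    using \<rho>0 order_trans[OF norm_ge_zero E] by (intro frac_le norm_kernel_denominator \<zeta> mult_mono real_sqrt_le_mono E) auto
  finally show ?thesis by (simp add: mult_ac)
qed

lemma norm_kernel_matrix_le:
  assumes \<zeta>: "\<rho>0 \<le> Re \<zeta>" "\<bar>Im \<zeta>\<bar> \<le> 6 * pi"
    and N: "cubic_bound \<tau> x (Re \<zeta>) * exp (tail_bound (Re \<zeta>)) \<le> N"
  shows "norm (kernel_matrix x \<tau> \<gamma> \<zeta> k l) \<le> kernel_factor N \<rho>0 k * kernel_factor N \<rho>0 l"
    and "(\<lambda>m. kernel_summand x \<tau> \<gamma> \<zeta> k m l) summable_on UNIV"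
proof -
  let ?c = "sqrt (N * weight k) * sqrt (N * weight l) / (4 * \<rho>0\<^sup>2) * N"
  have "Re \<zeta> > 0" using \<zeta> \<rho>0 by simp
  then have N0: "N \<ge> 0" using N cubic_bound_pos[of "Re \<zeta>" \<tau> x] by (meson exp_ge_zero less_imp_le mult_nonneg_nonneg order_trans)
  have s: "(\<lambda>m. ?c * weight m) summable_on UNIV" by (intro summable_on_cmult_right summable_on_weight)
  have "(\<lambda>m. norm (kernel_summand x \<tau> \<gamma> \<zeta> k m l)) summable_on UNIV"
    by (rule Infinite_Sum.abs_summable_on_comparison_test'[OF s]) (rule norm_kernel_summand_le[OF assms])
  then show sm: "(\<lambda>m. kernel_summand x \<tau> \<gamma> \<zeta> k m l) summable_on UNIV" by (rule abs_summable_summable)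
  have "norm (kernel_matrix x \<tau> \<gamma> \<zeta> k l) \<le> (\<Sum>\<^sub>\<infinity>m. ?c * weight m)"
    unfolding kernel_matrix_def
    by (rule norm_infsum_le[OF has_sum_infsum[OF sm] has_sum_infsum[OF s]]) (rule norm_kernel_summand_le[OF assms])
  also have "\<dots> = ?c * weight_sum" by (simp only: infsum_cmult_right' weight_sum_def)
  also have "\<dots> = kernel_factor N \<rho>0 k * kernel_factor N \<rho>0 l"
  proof -
    define S where "S = N * weight_sum / (4 * \<rho>0\<^sup>2)"
    have "S \<ge> 0" using N0 weight_sum_pos by (simp add: S_def)
    then have "sqrt S * sqrt S = S" by simp
    then have "kernel_factor N \<rho>0 k * kernel_factor N \<rho>0 l = sqrt (N * weight k) * sqrt (N * weight l) * S"
      unfolding kernel_factor_def S_def[symmetric] by (metis mult.assoc mult.left_commute)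
    then show ?thesis by (simp add: S_def)
  qed
  finally show "norm (kernel_matrix x \<tau> \<gamma> \<zeta> k l) \<le> kernel_factor N \<rho>0 k * kernel_factor N \<rho>0 l" .
qed

lemma fredholm_det_branch:
  assumes \<zeta>: "\<rho>0 \<le> Re \<zeta>" "\<bar>Im \<zeta>\<bar> \<le> 6 * pi"
    and N: "cubic_bound \<tau> x (Re \<zeta>) * exp (tail_bound (Re \<zeta>)) \<le> N" and N0: "N \<ge> 0"
  shows "fredholm_det (count_space (S_minus (exp (- \<zeta> / 2)))) (K_kernel x \<tau> \<gamma> (exp (- \<zeta> / 2)))
      = (\<Sum>n. (-1) ^ n / fact n * fredholm_term (kernel_matrix x \<tau> \<gamma> \<zeta>) n)"
proof -
  have R0: "Re \<zeta> > 0" using \<zeta> \<rho>0 by simp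
  show ?thesis
    by (rule fredholm_det_count_space[OF norm_kernel_matrix_le(1)[OF \<zeta> N] kernel_factor_square(1)[OF N0]
        S_minus_branch[OF R0] K_kernel_branch[OF R0]])
qed

lemma holomorphic_kernel_summand:
  "(\<lambda>\<zeta>. kernel_summand x \<tau> \<gamma> \<zeta> k m l) holomorphic_on {\<zeta>. Re \<zeta> > 0}"
proof -
  have hQ: "(\<lambda>\<zeta>. Q (- branch \<zeta> k)) holomorphic_on {\<zeta>. Re \<zeta> > 0}" for k
    by (rule holomorphic_on_compose_gen[OF _ holomorphic_Q, unfolded o_def])
      (auto intro!: holomorphic_intros holomorphic_branch Re_branch(4))
  have hp: "(\<lambda>\<zeta>. branch_phase \<tau> x \<zeta> k) holomorphic_on {\<zeta>. Re \<zeta> > 0}" for k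
    unfolding branch_phase_def cubic_phase_def by (intro holomorphic_intros holomorphic_branch hQ) auto
  have nr: "branch \<zeta> k \<notin> \<real>\<^sub>\<le>\<^sub>0" if "Re \<zeta> > 0" for \<zeta> k
    using Re_branch(1)[OF that, of k] by (simp add: complex_nonpos_Reals_iff)
  have hc: "(\<lambda>\<zeta>. csqrt (branch \<zeta> k)) holomorphic_on {\<zeta>. Re \<zeta> > 0}" for k
    by (rule holomorphic_on_compose_gen[OF holomorphic_branch holomorphic_on_csqrt, unfolded o_def])
      (use nr in auto)
  show ?thesis
    unfolding kernel_summand_def
    by (intro holomorphic_intros hp hc holomorphic_branch) (use norm_kernel_denominator(2)[OF _ order_refl] in auto)
qed

end

section \<open>Holomorphy in z\<close>

text \<open>Determinant and theta sums are functions of z, but their summands are holomorphic only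
  in \<zeta>. Near z0 the branch -2 (Ln (z/z0) + Ln z0) of -2 log z avoids the cut, and at z0 its
  imaginary part is at most 2 pi in modulus, well inside the strip. The half width 6 pi also leaves
  room for the range 4 pi of a full turn.\<close>

lemma holomorphic_on_annulus_log:
  assumes f: "(\<lambda>\<zeta>. f (exp (- \<zeta> / 2))) holomorphic_on {\<zeta>. \<rho>1 < Re \<zeta> \<and> Re \<zeta> < \<rho>2 \<and> \<bar>Im \<zeta>\<bar> < 6 * pi}" (is "_ holomorphic_on ?U")
  shows "f holomorphic_on annulus (exp (- \<rho>2 / 2)) (exp (- \<rho>1 / 2))"
proof -
  have oU: "open ?U" by (intro open_Collect_conj open_Collect_less continuous_intros)
  have "f field_differentiable at z0" if z0: "z0 \<in> annulus (exp (- \<rho>2 / 2)) (exp (- \<rho>1 / 2))" for z0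
  proof -
    have n0: "z0 \<noteq> 0" using z0 by (auto simp: annulus_def)
    define L where "L = (\<lambda>z. - 2 * (Ln (z / z0) + Ln z0))"
    have ln: "exp (- \<rho>2 / 2) < norm z0" "norm z0 < exp (- \<rho>1 / 2)" using z0 by (auto simp: annulus_def)
    have "ln (exp (- \<rho>2 / 2)) < ln (norm z0)" using ln(1) n0 by (subst ln_less_cancel_iff) auto
    moreover have "ln (norm z0) < ln (exp (- \<rho>1 / 2))" using ln(2) n0 by (subst ln_less_cancel_iff) auto
    moreover have "\<bar>2 * Im (Ln z0)\<bar> < 6 * pi"
      using mpi_less_Im_Ln[OF n0] Im_Ln_le_pi[OF n0] pi_gt_zero by (simp add: abs_less_iff)
    ultimately have LU: "L z0 \<in> ?U" using n0 by (auto simp: L_def)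
    have dL: "L field_differentiable at z0"
      unfolding L_def using n0 by (intro derivative_intros field_differentiable_at_Ln field_differentiable_compose[of "\<lambda>z. z / z0", unfolded o_def]) (auto simp: complex_nonpos_Reals_iff)
    have df: "(\<lambda>\<zeta>. f (exp (- \<zeta> / 2))) field_differentiable at (L z0)"
      using f LU oU holomorphic_on_imp_differentiable_at by blast
    show ?thesis
    proof (rule field_differentiable_transform_within[OF _ _ _ field_differentiable_compose[OF dL df]])
      fix z assume "dist z z0 < norm z0"
      then have "z \<noteq> 0" by (auto simp: dist_norm)
      then have "exp (Ln (z / z0) + Ln z0) = z" using n0 by (simp add: exp_add)
      then show "((\<lambda>\<zeta>. f (exp (- \<zeta> / 2))) \<circ> L) z = f z"
      proof -
        assume e: "exp (Ln (z / z0) + Ln z0) = z"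
        have "- L z / 2 = Ln (z / z0) + Ln z0" by (simp add: L_def field_simps)
        with e show ?thesis by (simp only: o_def)
      qed
    qed (use n0 in auto)
  qed
  then show ?thesis by (simp add: holomorphic_on_def field_differentiable_at_within)
qed

text \<open>Smallness of the kernel, uniform over the annulus, makes the Fredholm series geometric
  there. For large \<open>x\<close> this is available on an annulus that contains both the
  prescribed circle and the saddle circle.\<close>

lemma holomorphic_fredholm_det:
  assumes x: "x \<ge> 0" and \<tau>: "\<tau> > 0" and \<rho>: "0 < \<rho>1" and N0: "N \<ge> 0"
    and N: "\<And>\<rho>. \<rho>1 < \<rho> \<Longrightarrow> \<rho> < \<rho>2 \<Longrightarrow> cubic_bound \<tau> x \<rho> * exp (tail_bound \<rho>) \<le> N"
    and s: "(N * weight_sum / (2 * \<rho>1))\<^sup>2 < 1"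
  shows "(\<lambda>z. fredholm_det (count_space (S_minus z)) (K_kernel x \<tau> \<gamma> z)) holomorphic_on annulus (exp (- \<rho>2 / 2)) (exp (- \<rho>1 / 2))"
proof (rule holomorphic_on_annulus_log)
  let ?U = "{\<zeta>. \<rho>1 < Re \<zeta> \<and> Re \<zeta> < \<rho>2 \<and> \<bar>Im \<zeta>\<bar> < 6 * pi}"
  have oU: "open ?U" by (intro open_Collect_conj open_Collect_less continuous_intros)
  have U: "\<rho>1 \<le> Re \<zeta>" "\<bar>Im \<zeta>\<bar> \<le> 6 * pi" "cubic_bound \<tau> x (Re \<zeta>) * exp (tail_bound (Re \<zeta>)) \<le> N"
    if "\<zeta> \<in> ?U" for \<zeta> using that N by auto
  have "(\<lambda>\<zeta>. kernel_matrix x \<tau> \<gamma> \<zeta> k l) holomorphic_on ?U" for k l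
    unfolding kernel_matrix_def
  proof (rule holomorphic_on_infsum[OF oU])
    show "(\<lambda>\<zeta>. kernel_summand x \<tau> \<gamma> \<zeta> k m l) holomorphic_on ?U" for m
      using holomorphic_kernel_summand[OF x \<tau> \<rho>] by (rule holomorphic_on_subset) (use \<rho> in auto)
    show "norm (kernel_summand x \<tau> \<gamma> \<zeta> k m l)
      \<le> (sqrt (N * weight k) * sqrt (N * weight l) / (4 * \<rho>1\<^sup>2) * N) * weight m" if "\<zeta> \<in> ?U" for m \<zeta>
      by (rule norm_kernel_summand_le[OF x \<tau> \<rho> U[OF that]])
    show "(\<lambda>m. (sqrt (N * weight k) * sqrt (N * weight l) / (4 * \<rho>1\<^sup>2) * N) * weight m) summable_on UNIV"
      by (intro summable_on_cmult_right summable_on_weight)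
  qed
  then have "(\<lambda>\<zeta>. \<Sum>n. (-1) ^ n / fact n * fredholm_term (kernel_matrix x \<tau> \<gamma> \<zeta>) n) holomorphic_on ?U"
    by (rule holomorphic_fredholm_series[OF oU _ norm_kernel_matrix_le(1)[OF x \<tau> \<rho> U] kernel_factor_square(1)[OF N0]])
      (use kernel_factor_square(2)[OF N0] s in auto)
  then show "(\<lambda>\<zeta>. fredholm_det (count_space (S_minus (exp (- \<zeta> / 2)))) (K_kernel x \<tau> \<gamma> (exp (- \<zeta> / 2)))) holomorphic_on ?U"
    by (rule holomorphic_transform) (rule fredholm_det_branch[OF x \<tau> \<rho> U N0, symmetric])
qed

section \<open>Theta sums\<close>

text \<open>Once the Laplace integral has removed the coupling of two nodes in the denominator, the
  trace is a product of two such sums, with a = \<gamma>/2 and a = -\<gamma>/2.\<close>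

definition theta :: "real \<Rightarrow> real \<Rightarrow> real \<Rightarrow> complex \<Rightarrow> complex" where
  "theta \<tau> X a z = (\<Sum>\<^sub>\<infinity>\<xi>\<in>S_minus z. exp (cubic_phase \<tau> X (- \<xi>) + of_real a * \<xi>\<^sup>2) / (- \<xi>))"

definition theta_summand :: "real \<Rightarrow> real \<Rightarrow> real \<Rightarrow> complex \<Rightarrow> int \<Rightarrow> complex" where
  "theta_summand \<tau> X a \<zeta> k = exp (cubic_phase \<tau> X (branch \<zeta> k) + of_real a * (branch \<zeta> k)\<^sup>2) / branch \<zeta> k"

lemma theta_branch:
  assumes "Re \<zeta> > 0"
  shows "theta \<tau> X a (exp (- \<zeta> / 2)) = (\<Sum>\<^sub>\<infinity>k. theta_summand \<tau> X a \<zeta> k)"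
  unfolding theta_def theta_summand_def
  by (subst infsum_reindex_bij_betw[OF S_minus_branch[OF assms], symmetric]) simp

lemma norm_theta_summand_le:
  assumes \<zeta>: "Re \<zeta> > 0" "\<bar>Im \<zeta>\<bar> \<le> 6 * pi" and X: "X \<ge> 0" and \<tau>: "\<tau> > 0"
  shows "norm (theta_summand \<tau> X a \<zeta> k) \<le> cubic_bound \<tau> X (Re \<zeta>) * exp (a * Re \<zeta>) / sqrt (Re \<zeta>) * weight k"
proof -
  have "norm (exp (of_real a * (branch \<zeta> k)\<^sup>2)) = exp (a * Re \<zeta>)"
  proof -
    have "Re (of_real a * z) = a * Re z" for z by simp
    then show ?thesis by (simp only: norm_exp_eq_Re Re_branch_square)
  qed
  then have "norm (theta_summand \<tau> X a \<zeta> k) = norm (exp (cubic_phase \<tau> X (branch \<zeta> k))) * exp (a * Re \<zeta>) / norm (branch \<zeta> k)"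
    unfolding theta_summand_def exp_add norm_divide norm_mult by simp
  also have "\<dots> \<le> (cubic_bound \<tau> X (Re \<zeta>) * weight k) * exp (a * Re \<zeta>) / sqrt (Re \<zeta>)"
    using \<zeta> cubic_bound_pos[OF \<zeta>(1), of \<tau> X] weight_pos[of k]
    by (intro frac_le mult_right_mono norm_exp_cubic_phase_le X \<tau> Re_branch(5)) auto
  finally show ?thesis by (simp add: mult_ac)
qed

lemma holomorphic_theta:
  assumes X: "X \<ge> 0" and \<tau>: "\<tau> > 0" and \<rho>1: "0 < \<rho>1"
  shows "theta \<tau> X a holomorphic_on annulus (exp (- \<rho>2 / 2)) (exp (- \<rho>1 / 2))"
proof (rule holomorphic_on_annulus_log)
  let ?U = "{\<zeta>. \<rho>1 < Re \<zeta> \<and> Re \<zeta> < \<rho>2 \<and> \<bar>Im \<zeta>\<bar> < 6 * pi}"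
  have oU: "open ?U" by (intro open_Collect_conj open_Collect_less continuous_intros)
  define C where "C = 6 * (2 + 576 / \<tau>\<^sup>2) * (1 + \<rho>2) * exp (\<tau> * sqrt \<rho>2 ^ 3 / 3) * exp (\<bar>a\<bar> * \<rho>2) / sqrt \<rho>1"
  have "(\<lambda>\<zeta>. \<Sum>\<^sub>\<infinity>k. theta_summand \<tau> X a \<zeta> k) holomorphic_on ?U"
  proof (rule holomorphic_on_infsum[OF oU])
    show "(\<lambda>\<zeta>. theta_summand \<tau> X a \<zeta> k) holomorphic_on ?U" for k
      unfolding theta_summand_def cubic_phase_def
      by (intro holomorphic_intros holomorphic_on_subset[OF holomorphic_branch]) (use \<rho>1 Re_branch(3) in auto)
    show "norm (theta_summand \<tau> X a \<zeta> k) \<le> C * weight k" if \<zeta>: "\<zeta> \<in> ?U" for k \<zeta>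
    proof -
      have z: "Re \<zeta> > 0" "\<bar>Im \<zeta>\<bar> \<le> 6 * pi" using \<zeta> \<rho>1 by auto
      have c: "cubic_bound \<tau> X (Re \<zeta>) \<le> 6 * (2 + 576 / \<tau>\<^sup>2) * (1 + \<rho>2) * exp (\<tau> * sqrt \<rho>2 ^ 3 / 3)"
        unfolding cubic_bound_def
      proof (rule mult_mono)
        show "6 * (2 + 576 / \<tau>\<^sup>2) * (1 + Re \<zeta>) \<le> 6 * (2 + 576 / \<tau>\<^sup>2) * (1 + \<rho>2)"
          using \<zeta> by (intro mult_left_mono) auto
        have "\<tau> * sqrt (Re \<zeta>) ^ 3 \<le> \<tau> * sqrt \<rho>2 ^ 3" using \<zeta> \<tau> z by (intro mult_left_mono power_mono) auto
        moreover have "0 \<le> sqrt (Re \<zeta>) * X" using z X by simp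
        ultimately show "exp (\<tau> * sqrt (Re \<zeta>) ^ 3 / 3 - sqrt (Re \<zeta>) * X) \<le> exp (\<tau> * sqrt \<rho>2 ^ 3 / 3)" by simp
      qed (use \<zeta> z in auto)
      have e: "exp (a * Re \<zeta>) \<le> exp (\<bar>a\<bar> * \<rho>2)"
        using \<zeta> z by (simp, intro mult_mono) auto
      have "norm (theta_summand \<tau> X a \<zeta> k) \<le> cubic_bound \<tau> X (Re \<zeta>) * exp (a * Re \<zeta>) / sqrt (Re \<zeta>) * weight k"
        by (rule norm_theta_summand_le[OF z X \<tau>])
      also have "\<dots> \<le> C * weight k"
        unfolding C_def using c e \<zeta> z \<rho>1 weight_pos[of k] cubic_bound_pos[OF z(1), of \<tau> X]
        by (intro mult_right_mono frac_le mult_mono) auto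
      finally show ?thesis .
    qed
    show "(\<lambda>k. C * weight k) summable_on UNIV" by (intro summable_on_cmult_right summable_on_weight)
  qed
  then show "(\<lambda>\<zeta>. theta \<tau> X a (exp (- \<zeta> / 2))) holomorphic_on ?U"
    by (rule holomorphic_transform) (rule theta_branch[symmetric], use \<rho>1 in auto)
qed

text \<open>
  For \<open>z = exp (- \<rho> / 2 + 2 \<pi> i t)\<close> the nodes are \<open>- circle_branch \<rho> (t - k)\<close>: as \<open>z\<close> runs around the
  circle the branches join into one branch of the hyperbola \<open>Re (w\<^sup>2) = \<rho>\<close>, so that the Laurent coefficients
  of a theta sum are Airy contour integrals.
\<close>

definition circle_branch :: "real \<Rightarrow> real \<Rightarrow> complex" where
  "circle_branch \<rho> s = csqrt (of_real \<rho> - 4 * of_real pi * \<i> * of_real s)"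

lemma circle_point:
  "of_real (exp (- \<rho> / 2)) * exp (2 * of_real pi * \<i> * of_real t) = exp (- (of_real \<rho> - 4 * of_real pi * \<i> * of_real t) / 2)"
proof -
  have "- (of_real \<rho> - 4 * of_real pi * \<i> * of_real t) / 2 = of_real (- \<rho> / 2) + 2 * of_real pi * \<i> * complex_of_real t"
    by (simp add: field_simps)
  then show ?thesis by (simp only: exp_add exp_of_real)
qed

lemma circle_log_bounds:
  assumes "0 \<le> t" "t \<le> 1"
  shows "\<bar>Im (of_real \<rho> - 4 * of_real pi * \<i> * of_real t)\<bar> \<le> 6 * pi" "Re (of_real \<rho> - 4 * of_real pi * \<i> * of_real t) = \<rho>"
proof -
  have "4 * pi * t \<le> 6 * pi * 1" using assms by (intro mult_mono) auto
  then show "\<bar>Im (of_real \<rho> - 4 * of_real pi * \<i> * of_real t)\<bar> \<le> 6 * pi" using assms by simp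
qed simp

context
  fixes \<rho> :: real
  assumes \<rho>: "\<rho> > 0"
begin

lemma circle_branch_not_nonpos: "of_real \<rho> - 4 * of_real pi * \<i> * complex_of_real s \<notin> \<real>\<^sub>\<le>\<^sub>0"
  using \<rho> by (auto simp: complex_nonpos_Reals_iff)

lemma Re_circle_branch_pos: "Re (circle_branch \<rho> s) > 0"
  using Re_branch(1)[of "of_real \<rho> - 4 * of_real pi * \<i> * of_real s" 0] \<rho>
  by (simp add: branch_def circle_branch_def)

lemma circle_branch_derivative:
  "(circle_branch \<rho> has_vector_derivative (- 2 * of_real pi * \<i> / circle_branch \<rho> s)) (at s)"
proof -
  have 1: "((\<lambda>s. of_real \<rho> - 4 * of_real pi * \<i> * of_real s) has_vector_derivative (- (4 * of_real pi * \<i>))) (at s)"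
    by (rule has_vector_derivative_real_field) (auto intro!: derivative_eq_intros)
  have 2: "(csqrt has_field_derivative inverse (2 * circle_branch \<rho> s)) (at (of_real \<rho> - 4 * of_real pi * \<i> * of_real s))"
    unfolding circle_branch_def by (rule has_field_derivative_csqrt[OF circle_branch_not_nonpos])
  have "(- (4 * of_real pi * \<i>)) * inverse (2 * circle_branch \<rho> s) = - 2 * of_real pi * \<i> / circle_branch \<rho> s"
    using Re_circle_branch_pos[of s] by (auto simp: field_simps)
  with field_vector_diff_chain_at[OF 1 2] show ?thesis by (simp add: o_def circle_branch_def[abs_def])
qed

lemma circle_branch_minus: "circle_branch \<rho> (- s) = cnj (circle_branch \<rho> s)"
  using cnj_csqrt[OF circle_branch_not_nonpos[of s]] by (simp add: circle_branch_def)

text \<open>Squaring gives p^2 = q^2 + \<rho> and p q = 2 pi n, so the points go to infinity within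
  distance sqrt \<rho> of the diagonal, as \<open>tendsto_sector_difference\<close>
  requires.\<close>

lemma circle_branch_cartesian:
  defines "p \<equiv> \<lambda>n. Re (circle_branch \<rho> (real n))" and "q \<equiv> \<lambda>n. - Im (circle_branch \<rho> (real n))"
  shows "p n > 0" "q n \<ge> 0" "p n \<le> q n + sqrt \<rho>" "q n \<le> p n" "filterlim q at_top sequentially"
proof -
  have sq: "(circle_branch \<rho> (real n))\<^sup>2 = of_real \<rho> - 4 * of_real pi * \<i> * of_real (real n)" for n
    by (simp add: circle_branch_def)
  have p: "p n > 0" for n using Re_circle_branch_pos by (simp add: p_def)
  have e1: "(p n)\<^sup>2 = (q n)\<^sup>2 + \<rho>" for n
    using arg_cong[OF sq[of n], of Re] by (simp add: p_def q_def power2_eq_square)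
  have e2: "p n * q n = 2 * pi * real n" for n
    using arg_cong[OF sq[of n], of Im] by (simp add: p_def q_def power2_eq_square algebra_simps)
  have q: "q n \<ge> 0" for n
  proof -
    have "0 \<le> p n * q n" by (simp add: e2)
    then show ?thesis using p[of n] by (simp add: zero_le_mult_iff)
  qed
  have pq: "p n \<le> q n + sqrt \<rho>" for n
  proof (rule power2_le_imp_le)
    have "(q n + sqrt \<rho>)\<^sup>2 = (q n)\<^sup>2 + \<rho> + 2 * q n * sqrt \<rho>" using \<rho> by (simp add: power2_sum)
    then show "(p n)\<^sup>2 \<le> (q n + sqrt \<rho>)\<^sup>2" using e1[of n] q[of n] \<rho> by simp
  qed (use q[of n] \<rho> in simp)
  show "p n > 0" "q n \<ge> 0" "p n \<le> q n + sqrt \<rho>" by (fact p q pq)+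
  show "q n \<le> p n" by (rule power2_le_imp_le) (use e1[of n] p[of n] \<rho> in auto)
  have lb: "sqrt (2 * pi * real n) - sqrt \<rho> \<le> q n" for n
  proof -
    have "2 * pi * real n \<le> (q n + sqrt \<rho>) * (q n + sqrt \<rho>)"
      unfolding e2[symmetric] using q[of n] pq[of n] p[of n] \<rho> by (intro mult_mono) auto
    then have "sqrt (2 * pi * real n) \<le> q n + sqrt \<rho>"
      using q[of n] \<rho> by (intro real_le_lsqrt) (auto simp: power2_eq_square)
    then show ?thesis by simp
  qed
  have lim: "filterlim (\<lambda>n. sqrt (2 * pi * real n) - sqrt \<rho>) at_top sequentially" by real_asymp
  show "filterlim q at_top sequentially"
    by (rule filterlim_at_top_mono[OF lim always_eventually[OF allI[OF lb]]])
qed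

text \<open>At a node w one has z^(-m) = exp(m w^2/2), so the power only shifts a to b. Along the
  circle dw/dt = -2 pi i/w, so each summand is a multiple of the derivative of \<open>G\<close>, a
  primitive of exp(phase + b w^2), and the sum over k telescopes to the ends of the hyperbola. An
  affine substitution turns \<open>G\<close> into the Airy primitive \<open>F\<close>, whose end
  point difference tends to 2 pi i times the Airy value.\<close>

lemma laurent_coeff_theta:
  fixes a :: real and m :: int
  assumes X: "X \<ge> 0" and \<tau>: "\<tau> > 0"
  defines "b \<equiv> a + of_int m / 2" and "\<kappa> \<equiv> \<tau> powr (1/3)"
  assumes y: "(X + b\<^sup>2 / \<tau>) / \<kappa> \<ge> 1"
  shows "laurent_coeff (exp (- \<rho> / 2)) (theta \<tau> X a) m
    = of_real (exp (2 * b ^ 3 / (3 * \<tau>\<^sup>2) + X * b / \<tau>) / \<kappa> * Ai ((X + b\<^sup>2 / \<tau>) / \<kappa>))"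
proof -
  let ?W = "circle_branch \<rho>"
  define y where "y = (X + b\<^sup>2 / \<tau>) / \<kappa>"
  have \<kappa>: "\<kappa> > 0" "\<kappa> ^ 3 = \<tau>" using \<tau> by (auto simp: \<kappa>_def powr_power)
  have y1: "y \<ge> 1" using assms by (simp add: y_def)
  obtain F where F: "\<And>u. (F has_field_derivative exp (u ^ 3 / 3 - complex_of_real y * u)) (at u)"
    using exp_cubic_primitive[of y] by blast
  define c where "c = 2 * b ^ 3 / (3 * \<tau>\<^sup>2) + X * b / \<tau>"
  define G where "G = (\<lambda>w. of_real (exp c / \<kappa>) * F (of_real \<kappa> * (w + of_real (b / \<tau>))))"
  have G: "(G has_field_derivative exp (cubic_phase \<tau> X w + of_real b * w\<^sup>2)) (at w)" for w
  proof -
    define u where "u = of_real \<kappa> * (w + of_real (b / \<tau>))"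
    have "((\<lambda>w. of_real \<kappa> * (w + of_real (b / \<tau>))) has_field_derivative of_real \<kappa>) (at w)"
      by (auto intro!: derivative_eq_intros)
    from DERIV_cmult[OF DERIV_chain2[OF F[of u, unfolded u_def] this], of "of_real (exp c / \<kappa>)"]
    have "(G has_field_derivative of_real (exp c / \<kappa>) * (exp (u ^ 3 / 3 - of_real y * u) * of_real \<kappa>)) (at w)"
      by (simp add: G_def u_def)
    also have "of_real (exp c / \<kappa>) * (exp (u ^ 3 / 3 - of_real y * u) * of_real \<kappa>) = exp (of_real c + (u ^ 3 / 3 - of_real y * u))"
      using \<kappa> by (simp add: exp_add exp_of_real)
    \<comment> \<open>Completing the cube: the shift b/\<tau> absorbs the quadratic term, \<kappa>^3
      = \<tau> normalises the cubic one, and c is the constant left over.\<close>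
    also have "of_real c + (u ^ 3 / 3 - of_real y * u) = cubic_phase \<tau> X w + of_real b * w\<^sup>2"
    proof -
      define \<beta> where "\<beta> = complex_of_real (b / \<tau>)"
      have cube: "(w + v) ^ 3 = w ^ 3 + 3 * w\<^sup>2 * v + 3 * w * v\<^sup>2 + v ^ 3" for w v :: complex
        by (simp add: power3_eq_cube power2_eq_square algebra_simps)
      have u3: "u ^ 3 = of_real \<tau> * (w + \<beta>) ^ 3"
        unfolding u_def power_mult_distrib \<kappa>(2)[symmetric] \<beta>_def by simp
      have bt: "of_real \<tau> * \<beta> = of_real b" using \<tau> by (simp add: \<beta>_def)
      have "b\<^sup>2 / \<tau> = \<tau> * (b / \<tau>)\<^sup>2" using \<tau> by (simp add: power2_eq_square)
      then have yu: "of_real y * u = (of_real X + of_real \<tau> * \<beta>\<^sup>2) * (w + \<beta>)"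
        using \<kappa> by (simp add: y_def u_def \<beta>_def)
      have "c = 2 / 3 * \<tau> * (b / \<tau>) ^ 3 + X * (b / \<tau>)"
        using \<tau> by (simp add: c_def power2_eq_square power3_eq_cube)
      then have cc: "of_real c = 2 / 3 * of_real \<tau> * \<beta> ^ 3 + of_real X * \<beta>" by (simp add: \<beta>_def)
      show ?thesis unfolding u3 cube yu cc cubic_phase_def bt[symmetric]
        by (simp add: field_simps power3_eq_cube power2_eq_square)
    qed
    finally show ?thesis .
  qed
  define h where "h = (\<lambda>s. exp (cubic_phase \<tau> X (?W s) + of_real b * (?W s)\<^sup>2) / ?W s)"
  have FT: "((\<lambda>t. h (t - of_int k)) has_integral (\<i> / (2 * of_real pi)) * (G (?W (1 - of_int k)) - G (?W (0 - of_int k)))) {0..1}" for k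
  proof -
    have "((\<lambda>t. h (t - of_int k)) has_integral ((\<i> / (2 * of_real pi)) * G (?W (1 - of_int k)) - (\<i> / (2 * of_real pi)) * G (?W (0 - of_int k)))) {0..1}"
    proof (rule fundamental_theorem_of_calculus)
      fix t :: real
      have "((\<lambda>t. ?W (t - of_int k)) has_vector_derivative (- 2 * of_real pi * \<i> / ?W (t - of_int k))) (at t)"
      proof -
        have "((\<lambda>t. t - of_int k) has_vector_derivative 1) (at t)"
          by (auto intro!: derivative_eq_intros)
        from vector_diff_chain_at[OF this circle_branch_derivative[of "t - of_int k"]]
        show ?thesis by (simp add: o_def)
      qed
      from field_vector_diff_chain_at[OF this G]
      have "((\<lambda>t. G (?W (t - of_int k))) has_vector_derivative (- 2 * of_real pi * \<i> / ?W (t - of_int k)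
          * exp (cubic_phase \<tau> X (?W (t - of_int k)) + of_real b * (?W (t - of_int k))\<^sup>2))) (at t)"
        by (simp add: o_def)
      from has_vector_derivative_mult_right[OF this, of "\<i> / (2 * of_real pi)"]
      show "((\<lambda>t. (\<i> / (2 * of_real pi)) * G (?W (t - of_int k))) has_vector_derivative h (t - of_int k)) (at t within {0..1})"
        by (simp add: h_def field_simps has_vector_derivative_at_within)
    qed simp
    then show ?thesis by (simp add: right_diff_distrib)
  qed
  let ?R = "exp (- \<rho> / 2)"
  define e where "e = (\<lambda>t. of_real ?R * exp (2 * of_real pi * \<i> * complex_of_real t))"
  define Z where "Z = (\<lambda>t. of_real \<rho> - 4 * of_real pi * \<i> * complex_of_real t)"
  have eZ: "e t = exp (- Z t / 2)" for t unfolding e_def Z_def by (rule circle_point)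
  have ReZ: "Re (Z t) > 0" for t using \<rho> by (simp add: Z_def)
  have bZ: "branch (Z t) k = ?W (t - of_int k)" for t k
    by (simp add: branch_def Z_def circle_branch_def algebra_simps)
  have summand: "theta_summand \<tau> X a (Z t) k * e t powi (- m) = h (t - of_int k)" for t k
  proof -
    \<comment> \<open>z^(-m) is exp(m Z/2), and Z differs from the squared node by 4 pi i k; since m
      k is an integer, the difference is a period of exp.\<close>
    have "e t powi (- m) = exp (of_int (- m) * (- Z t / 2))" unfolding eZ exp_power_int ..
    also have "of_int (- m) * (- Z t / 2) = of_real (of_int m / 2) * (branch (Z t) k)\<^sup>2 + of_int (2 * (- m * k)) * (of_real pi * \<i>)"
      by (simp add: branch_square algebra_simps)
    also have "exp \<dots> = exp (of_real (of_int m / 2) * (branch (Z t) k)\<^sup>2)"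
      unfolding exp_eq by (rule exI[of _ "- m * k"]) (simp add: mult_ac)
    finally have "theta_summand \<tau> X a (Z t) k * e t powi (- m)
       = exp (cubic_phase \<tau> X (branch (Z t) k) + of_real a * (branch (Z t) k)\<^sup>2 + of_real (of_int m / 2) * (branch (Z t) k)\<^sup>2) / branch (Z t) k"
      unfolding theta_summand_def by (simp add: exp_add)
    then show ?thesis by (simp add: h_def bZ b_def ring_distribs add.assoc)
  qed
  have "((\<lambda>k. integral {0..1} (\<lambda>t. h (t - of_int k))) has_sum integral {0..1} (\<lambda>t. \<Sum>\<^sub>\<infinity>k. h (t - of_int k))) UNIV"
  proof (rule has_sum_integral)
    show "continuous_on {0..1} (\<lambda>t. h (t - of_int k))" for k
    proof -
      have cW: "continuous_on UNIV ?W"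
        by (intro continuous_at_imp_continuous_on ballI has_vector_derivative_continuous[OF circle_branch_derivative])
      have "continuous_on {0..1} (\<lambda>t. ?W (t - of_int k))"
        by (intro continuous_on_compose2[OF cW] continuous_intros) auto
      moreover have "?W s \<noteq> 0" for s using Re_circle_branch_pos[of s] by auto
      ultimately show ?thesis unfolding h_def cubic_phase_def by (intro continuous_intros) auto
    qed
    show "norm (h (t - of_int k)) \<le> (cubic_bound \<tau> X \<rho> * exp (a * \<rho>) / sqrt \<rho> * ?R powi (- m)) * weight k" if "t \<in> {0..1}" for k t
    proof -
      have "norm (e t) = ?R" by (simp add: e_def norm_mult)
      then have "norm (h (t - of_int k)) = norm (theta_summand \<tau> X a (Z t) k) * ?R powi (- m)"
        by (simp only: summand[symmetric] norm_mult norm_power_int)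
      also have "norm (theta_summand \<tau> X a (Z t) k) \<le> cubic_bound \<tau> X (Re (Z t)) * exp (a * Re (Z t)) / sqrt (Re (Z t)) * weight k"
        using that unfolding Z_def by (intro norm_theta_summand_le circle_log_bounds X \<tau>) (use \<rho> in auto)
      finally show ?thesis by (simp add: Z_def mult_ac mult_right_mono)
    qed
  qed (intro summable_on_cmult_right summable_on_weight)
  moreover have "integral {0..1} (\<lambda>t. \<Sum>\<^sub>\<infinity>k. h (t - of_int k)) = laurent_coeff ?R (theta \<tau> X a) m"
  proof -
    have "(\<Sum>\<^sub>\<infinity>k. h (t - of_int k)) = theta \<tau> X a (e t) * e t powi (- m)" for t
      unfolding summand[symmetric] eZ theta_branch[OF ReZ] by (rule infsum_cmult_left')
    then show ?thesis
      unfolding laurent_coeff_def by (subst circle_mean_eq_integral) (simp_all add: e_def)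
  qed
  ultimately have S: "((\<lambda>k. (\<i> / (2 * of_real pi)) * (G (?W (1 - of_int k)) - G (?W (0 - of_int k)))) has_sum laurent_coeff ?R (theta \<tau> X a) m) UNIV"
    using integral_unique[OF FT] by simp
  have tele: "(\<Sum>k\<in>{1 - int N..int N}. (\<i> / (2 * of_real pi)) * (G (?W (1 - of_int k)) - G (?W (0 - of_int k))))
     = (\<i> / (2 * of_real pi)) * (G (?W (real N)) - G (?W (- real N)))" for N
  proof (induction N)
    case (Suc N)
    have s: "{1 - int (Suc N)..int (Suc N)} = insert (- int N) (insert (int N + 1) {1 - int N..int N})" by auto
    have "(\<Sum>k\<in>{1 - int (Suc N)..int (Suc N)}. (\<i> / (2 * of_real pi)) * (G (?W (1 - of_int k)) - G (?W (0 - of_int k))))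
      = (\<i> / (2 * of_real pi)) * (G (?W (1 + real N)) - G (?W (real N)))
      + ((\<i> / (2 * of_real pi)) * (G (?W (- real N)) - G (?W (- 1 - real N)))
      + (\<Sum>k\<in>{1 - int N..int N}. (\<i> / (2 * of_real pi)) * (G (?W (1 - of_int k)) - G (?W (0 - of_int k)))))"
      unfolding s by (subst sum.insert, simp, simp, subst sum.insert, simp, simp) (simp add: add.commute)
    then show ?case unfolding Suc.IH by (simp add: algebra_simps)
  qed simp
  define p q where "p = (\<lambda>n. Re (?W (real n)))" and "q = (\<lambda>n. - Im (?W (real n)))"
  have pq: "p n > 0" "q n \<ge> 0" "p n \<le> q n + sqrt \<rho>" "q n \<le> p n" for n
    using circle_branch_cartesian(1-4)[of n] by (simp_all add: p_def q_def)
  have qlim: "filterlim q at_top sequentially"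
    using circle_branch_cartesian(5) by (simp add: q_def)
  have Wn: "?W (real n) = of_real (p n) - \<i> * of_real (q n)" "?W (- real n) = of_real (p n) + \<i> * of_real (q n)" for n
    unfolding circle_branch_minus by (simp_all add: complex_eq_iff p_def q_def)
  have GF: "(\<i> / (2 * of_real pi)) * (G (?W (real n)) - G (?W (- real n)))
     = (\<i> / (2 * of_real pi)) * of_real (exp c / \<kappa>) * (- (F (of_real (\<kappa> * (p n + b / \<tau>)) + \<i> * of_real (\<kappa> * q n)) - F (of_real (\<kappa> * (p n + b / \<tau>)) - \<i> * of_real (\<kappa> * q n))))" for n
    unfolding Wn G_def by (simp add: algebra_simps)
  have plim: "filterlim p at_top sequentially"
    by (rule filterlim_at_top_mono[OF qlim always_eventually[OF allI[OF pq(4)]]])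
  have "((\<lambda>n. F (of_real (\<kappa> * (p n + b / \<tau>)) + \<i> * of_real (\<kappa> * q n)) - F (of_real (\<kappa> * (p n + b / \<tau>)) - \<i> * of_real (\<kappa> * q n)))
     \<longlongrightarrow> 2 * of_real pi * \<i> * of_real (Ai y)) sequentially"
  \<comment> \<open>The slack combines the distance sqrt \<rho> of the hyperbola from the diagonal
    with the shift b/\<tau>, both scaled by \<kappa>.\<close>
  proof (rule tendsto_sector_difference[OF F _ Ai_as_limit(1)[OF y1 F], where C = "\<kappa> * (sqrt \<rho> + \<bar>b\<bar> / \<tau>)"])
    have "\<forall>\<^sub>F n in sequentially. \<bar>b\<bar> / \<tau> < p n" using plim by (simp add: filterlim_at_top_dense)
    then show "\<forall>\<^sub>F n in sequentially. 0 \<le> \<kappa> * (p n + b / \<tau>) \<and> \<kappa> * (p n + b / \<tau>) \<le> \<kappa> * q n + \<kappa> * (sqrt \<rho> + \<bar>b\<bar> / \<tau>)"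
    proof eventually_elim
      case (elim n)
      have "- (b / \<tau>) \<le> \<bar>b\<bar> / \<tau>" "b / \<tau> \<le> \<bar>b\<bar> / \<tau>" using \<tau> by (auto simp: field_simps)
      then have "0 \<le> p n + b / \<tau>" "p n + b / \<tau> \<le> q n + (sqrt \<rho> + \<bar>b\<bar> / \<tau>)" using elim pq(3)[of n] by linarith+
      then show ?case using \<kappa> by (simp add: mult_left_mono flip: distrib_left)
    qed
    show "filterlim (\<lambda>n. \<kappa> * q n) at_top sequentially"
      using filterlim_tendsto_pos_mult_at_top[OF tendsto_const \<kappa>(1) qlim] .
  qed (use y1 \<kappa> \<rho> \<tau> in auto)
  from tendsto_mult_left[OF tendsto_minus[OF this], of "(\<i> / (2 * of_real pi)) * of_real (exp c / \<kappa>)"]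
  have "(\<lambda>n. (\<i> / (2 * of_real pi)) * (G (?W (real n)) - G (?W (- real n)))) \<longlonglongrightarrow> of_real (exp c / \<kappa> * Ai y)"
    unfolding GF by (simp add: mult_ac)
  with has_sum_int_symmetric(2)[OF S] have "laurent_coeff ?R (theta \<tau> X a) m = of_real (exp c / \<kappa> * Ai y)"
    unfolding tele using LIMSEQ_unique by blast
  then show ?thesis by (simp add: c_def y_def)
qed

text \<open>Coefficient -m of the first sum belongs to b = (\<gamma> - m)/2, coefficient m of the
  second to -b. The exponent of the prefactor is odd in b, so the exponentials cancel and every
  Parseval term is a square. The mean is therefore real, with nonnegative terms.\<close>

lemma circle_mean_theta:
  assumes \<tau>: "\<tau> > 0" and X: "X \<ge> \<tau> powr (1/3)"
  defines "\<kappa> \<equiv> \<tau> powr (1/3)"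
  shows "((\<lambda>m::int. (Ai ((X + ((\<gamma> - of_int m) / 2)\<^sup>2 / \<tau>) / \<kappa>) / \<kappa>)\<^sup>2) has_sum
     Re (circle_mean (exp (- \<rho> / 2)) (\<lambda>z. theta \<tau> X (\<gamma> / 2) z * theta \<tau> X (- \<gamma> / 2) z))) UNIV"
    and "Im (circle_mean (exp (- \<rho> / 2)) (\<lambda>z. theta \<tau> X (\<gamma> / 2) z * theta \<tau> X (- \<gamma> / 2) z)) = 0"
proof -
  let ?R = "exp (- \<rho> / 2)"
  let ?A = "\<lambda>m::int. (Ai ((X + ((\<gamma> - of_int m) / 2)\<^sup>2 / \<tau>) / \<kappa>) / \<kappa>)\<^sup>2"
  have \<kappa>: "\<kappa> > 0" using \<tau> by (simp add: \<kappa>_def)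
  have X0: "X \<ge> 0" using X powr_ge_zero order_trans by blast
  have y: "(X + b\<^sup>2 / \<tau>) / \<kappa> \<ge> 1" for b
  proof -
    have "0 \<le> b\<^sup>2 / \<tau>" using \<tau> by simp
    then have "\<kappa> \<le> X + b\<^sup>2 / \<tau>" using X by (simp add: \<kappa>_def)
    then show ?thesis using \<kappa> by simp
  qed
  have hol: "theta \<tau> X a holomorphic_on annulus (exp (- (2 * \<rho>) / 2)) (exp (- (\<rho> / 2) / 2))" for a
    using \<rho> by (intro holomorphic_theta X0 \<tau>) auto
  have "((\<lambda>m. laurent_coeff ?R (theta \<tau> X (\<gamma> / 2)) (- m) * laurent_coeff ?R (theta \<tau> X (- \<gamma> / 2)) m) has_sum
     circle_mean ?R (\<lambda>z. theta \<tau> X (\<gamma> / 2) z * theta \<tau> X (- \<gamma> / 2) z)) UNIV"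
    by (rule circle_mean_parseval[OF hol hol]) (use \<rho> in auto)
  moreover have "laurent_coeff ?R (theta \<tau> X (\<gamma> / 2)) (- m) * laurent_coeff ?R (theta \<tau> X (- \<gamma> / 2)) m = of_real (?A m)" for m
  proof -
    define b where "b = (\<gamma> - of_int m) / 2"
    have b1: "\<gamma> / 2 + of_int (- m) / 2 = b" and b2: "- \<gamma> / 2 + of_int m / 2 = - b" by (simp_all add: b_def field_simps)
    define c where "c = 2 * b ^ 3 / (3 * \<tau>\<^sup>2) + X * b / \<tau>"
    have c': "2 * (- b) ^ 3 / (3 * \<tau>\<^sup>2) + X * (- b) / \<tau> = - c" by (simp add: c_def)
    have l1: "laurent_coeff ?R (theta \<tau> X (\<gamma> / 2)) (- m) = of_real (exp c / \<kappa> * Ai ((X + b\<^sup>2 / \<tau>) / \<kappa>))"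
      using laurent_coeff_theta[OF X0 \<tau>, of "\<gamma> / 2" "- m"] y[of b] unfolding b1 \<kappa>_def[symmetric] c_def by simp
    have l2: "laurent_coeff ?R (theta \<tau> X (- \<gamma> / 2)) m = of_real (exp (- c) / \<kappa> * Ai ((X + b\<^sup>2 / \<tau>) / \<kappa>))"
      using laurent_coeff_theta[OF X0 \<tau>, of "- \<gamma> / 2" m] y[of "- b"] unfolding b2 \<kappa>_def[symmetric] c' by simp
    have "exp c / \<kappa> * A * (exp (- c) / \<kappa> * A) = (exp c * exp (- c)) * (A / \<kappa>)\<^sup>2" for A
      by (simp add: power2_eq_square)
    then show ?thesis unfolding l1 l2 of_real_mult[symmetric] b_def[symmetric] by (simp flip: exp_add)
  qed
  ultimately have *: "((\<lambda>m. complex_of_real (?A m)) has_sum circle_mean ?R (\<lambda>z. theta \<tau> X (\<gamma> / 2) z * theta \<tau> X (- \<gamma> / 2) z)) UNIV"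
    by simp
  from has_sum_Re[OF *] show "(?A has_sum Re (circle_mean ?R (\<lambda>z. theta \<tau> X (\<gamma> / 2) z * theta \<tau> X (- \<gamma> / 2) z))) UNIV" by simp
  from has_sum_Im[OF *] have "((\<lambda>m::int. 0) has_sum Im (circle_mean ?R (\<lambda>z. theta \<tau> X (\<gamma> / 2) z * theta \<tau> X (- \<gamma> / 2) z))) UNIV" by simp
  then show "Im (circle_mean ?R (\<lambda>z. theta \<tau> X (\<gamma> / 2) z * theta \<tau> X (- \<gamma> / 2) z)) = 0"
    by (auto dest: infsumI)
qed

end

section \<open>The trace as a Laplace integral of theta sums\<close>

text \<open>Symmetric partial sums turn the unordered sum into a sequence, to which dominated
  convergence applies; the separable majorant controls the sum and the integral at once.\<close>

lemma has_sum_integral_dominated: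
  fixes f :: "int \<Rightarrow> 'a \<Rightarrow> complex"
  assumes m: "\<And>i. f i \<in> borel_measurable M" and b: "\<And>i v. v \<in> space M \<Longrightarrow> norm (f i v) \<le> W i * g v"
    and W: "W summable_on UNIV" and g: "integrable M g"
  shows "((\<lambda>i. \<integral>v. f i v \<partial>M) has_sum (\<integral>v. (\<Sum>\<^sub>\<infinity>i. f i v) \<partial>M)) UNIV"
    and "(\<lambda>v. \<Sum>\<^sub>\<infinity>i. f i v) \<in> borel_measurable M"
proof -
  have b': "norm (f i v) \<le> \<bar>W i\<bar> * \<bar>g v\<bar>" if "v \<in> space M" for i v
    using b[OF that, of i] abs_ge_self[of "W i * g v"] unfolding abs_mult by linarith
  have sW: "(\<lambda>i. W i * g v) summable_on UNIV" for v by (intro summable_on_cmult_left W)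
  have hs: "((\<lambda>i. f i v) has_sum (\<Sum>\<^sub>\<infinity>i. f i v)) UNIV" if "v \<in> space M" for v
  proof -
    have "(\<lambda>i. norm (f i v)) summable_on UNIV"
      by (rule Infinite_Sum.abs_summable_on_comparison_test'[OF sW]) (rule b[OF that])
    then show ?thesis by (rule has_sum_infsum[OF abs_summable_summable])
  qed
  define S where "S = (\<lambda>N v. \<Sum>i\<in>{- int N..int N}. f i v)"
  have lim: "(\<lambda>N. S N v) \<longlonglongrightarrow> (\<Sum>\<^sub>\<infinity>i. f i v)" if "v \<in> space M" for v
    unfolding S_def by (rule has_sum_int_symmetric(1)[OF hs[OF that]])
  have mS: "S N \<in> borel_measurable M" for N unfolding S_def by (rule borel_measurable_sum) (rule m)
  show mm: "(\<lambda>v. \<Sum>\<^sub>\<infinity>i. f i v) \<in> borel_measurable M"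
    by (rule borel_measurable_LIMSEQ_metric[OF mS lim])
  have absW: "(\<lambda>i. \<bar>W i\<bar>) summable_on UNIV" using summable_on_iff_abs_summable_on_real[THEN iffD1, OF W] by simp
  have gi: "integrable M (\<lambda>v. infsum (\<lambda>i. \<bar>W i\<bar>) UNIV * \<bar>g v\<bar>)"
    by (rule integrable_mult_right) (rule integrable_abs[OF g])
  have "(\<lambda>N. \<integral>v. S N v \<partial>M) \<longlonglongrightarrow> (\<integral>v. (\<Sum>\<^sub>\<infinity>i. f i v) \<partial>M)"
  proof (rule integral_dominated_convergence[OF mm mS gi])
    show "AE v in M. (\<lambda>N. S N v) \<longlonglongrightarrow> (\<Sum>\<^sub>\<infinity>i. f i v)" by (rule AE_I2) (rule lim)
    show "AE v in M. norm (S N v) \<le> infsum (\<lambda>i. \<bar>W i\<bar>) UNIV * \<bar>g v\<bar>" for N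
    proof (rule AE_I2)
      fix v assume v: "v \<in> space M"
      have "norm (S N v) \<le> (\<Sum>i\<in>{- int N..int N}. \<bar>W i\<bar> * \<bar>g v\<bar>)"
        unfolding S_def
        by (rule sum_norm_le) (rule b'[OF v])
      also have "\<dots> = (\<Sum>i\<in>{- int N..int N}. \<bar>W i\<bar>) * \<bar>g v\<bar>" by (simp add: sum_distrib_right)
      also have "\<dots> \<le> infsum (\<lambda>i. \<bar>W i\<bar>) UNIV * \<bar>g v\<bar>"
        by (intro mult_right_mono finite_sum_le_infsum absW) auto
      finally show "norm (S N v) \<le> infsum (\<lambda>i. \<bar>W i\<bar>) UNIV * \<bar>g v\<bar>" .
    qed
  qed
  moreover have fi: "integrable M (f i)" for i
    by (rule Bochner_Integration.integrable_bound[OF integrable_mult_right[OF g, of "W i"] m])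
      (rule AE_I2, simp only: real_norm_def abs_mult, rule b')
  ultimately have 1: "(\<lambda>N. \<Sum>i\<in>{- int N..int N}. \<integral>v. f i v \<partial>M) \<longlonglongrightarrow> (\<integral>v. (\<Sum>\<^sub>\<infinity>i. f i v) \<partial>M)"
    unfolding S_def by (simp add: Bochner_Integration.integral_sum)
  have "norm (\<integral>v. f i v \<partial>M) \<le> W i * (\<integral>v. g v \<partial>M)" for i
    using norm_integral_le[OF integrable_mult_right[OF g, of "W i"] b] by simp
  then have "(\<lambda>i. \<integral>v. f i v \<partial>M) summable_on UNIV"
    by (rule abs_summable_summable[OF Infinite_Sum.abs_summable_on_comparison_test'[OF summable_on_cmult_left[OF W]]])
  then have 2: "((\<lambda>i. \<integral>v. f i v \<partial>M) has_sum (\<Sum>\<^sub>\<infinity>i. \<integral>v. f i v \<partial>M)) UNIV" by (rule has_sum_infsum)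
  from LIMSEQ_unique[OF has_sum_int_symmetric(1)[OF this] 1] 2
  show "((\<lambda>i. \<integral>v. f i v \<partial>M) has_sum (\<integral>v. (\<Sum>\<^sub>\<infinity>i. f i v) \<partial>M)) UNIV" by simp
qed

lemma measurable_pos_lborel_continuous:
  fixes f :: "real \<Rightarrow> complex"
  assumes "continuous_on UNIV f"
  shows "f \<in> borel_measurable pos_lborel"
  using borel_measurable_continuous_onI[OF assms] by (intro measurable_restrict_space1) simp

lemma integral_pos_lborel_eq_HK:
  fixes f :: "real \<Rightarrow> complex"
  assumes "integrable pos_lborel f"
  shows "(\<integral>v. f v \<partial>pos_lborel) = integral {0..} f" and "f integrable_on {0..}"
proof -
  have s: "set_integrable lborel {0<..} f"
    using assms unfolding set_integrable_def by (subst (asm) integrable_restrict_space) auto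
  have "(\<integral>v. f v \<partial>pos_lborel) = (LINT v:{0<..}|lborel. f v)"
    unfolding set_lebesgue_integral_def by (subst integral_restrict_space) auto
  also have "\<dots> = integral {0<..} f" by (rule set_borel_integral_eq_integral(2)[OF s])
  finally have 1: "(\<integral>v. f v \<partial>pos_lborel) = integral {0<..} f" .
  have 2: "(f has_integral integral {0<..} f) {0<..}"
    using set_borel_integral_eq_integral(1)[OF s] by (rule integrable_integral)
  have "(f has_integral integral {0<..} f) {0..}"
  proof -
    have "(f has_integral integral {0<..} f + 0) ({0<..} \<union> {0})"
      by (rule has_integral_Un[OF 2 has_integral_refl(2)]) (auto intro: negligible_subset[of "{0}"])
    moreover have "{0<..} \<union> {0} = {0::real..}" by auto
    ultimately show ?thesis by simp
  qed
  then show "(\<integral>v. f v \<partial>pos_lborel) = integral {0..} f" "f integrable_on {0..}"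
    using 1 by (auto simp: integral_unique)
qed

lemma integral_exp_laplace:
  fixes s :: complex
  assumes s: "Re s > 0"
  shows "integrable pos_lborel (\<lambda>v. of_real v * exp (- (of_real v * s)))"
    and "(\<integral>v. of_real v * exp (- (of_real v * s)) \<partial>pos_lborel) = 1 / s\<^sup>2"
proof -
  let ?f = "\<lambda>v. of_real v * exp (- (of_real v * s))"
  show i: "integrable pos_lborel ?f"
  proof (rule Bochner_Integration.integrable_bound)
    show "integrable pos_lborel (\<lambda>v. v * exp (- (Re s * v)))"
      using has_bochner_integral_exp_ray(2)[OF s] by (simp add: has_bochner_integral_iff)
    show "?f \<in> borel_measurable pos_lborel"
      by (rule measurable_pos_lborel_continuous) (auto intro!: continuous_intros)
    show "AE v in pos_lborel. norm (?f v) \<le> norm (v * exp (- (Re s * v)))"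
      by (rule AE_I2) (simp add: norm_mult abs_mult mult.commute)
  qed
  have s0: "s \<noteq> 0" using s by auto
  define H where "H = (\<lambda>v. - ((of_real v / s + 1 / s\<^sup>2) * exp (- (of_real v * s))))"
  have FTC: "(?f has_integral (H n - H 0)) {0..n}" if "n \<ge> 0" for n
  proof (rule fundamental_theorem_of_calculus[OF that])
    fix v :: real
    have "((\<lambda>z. - ((z * k + c) * exp (- (z * s)))) has_field_derivative (- k * exp (- (z * s)) + (z * k + c) * s * exp (- (z * s)))) (at z)" for z c k
      by (auto intro!: derivative_eq_intros simp: algebra_simps)
    note D = this[of "1 / s" "1 / s\<^sup>2" "of_real v"]
    have "((\<lambda>z. - ((z * (1 / s) + 1 / s\<^sup>2) * exp (- (z * s)))) has_field_derivative ?f v) (at (of_real v))"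
    proof -
      have "(of_real v * (1 / s) + 1 / s\<^sup>2) * s = of_real v + 1 / s"
        using s0 by (simp add: power2_eq_square ring_distribs)
      then have "- (1 / s) * E + (of_real v * (1 / s) + 1 / s\<^sup>2) * s * E = of_real v * E" for E
        by (simp add: ring_distribs)
      then show ?thesis using D by (simp only:)
    qed
    from has_vector_derivative_real_field[OF this]
    show "(H has_vector_derivative ?f v) (at v within {0..n})" by (simp add: H_def)
  qed
  have "\<forall>\<^sub>F n in at_top. H n - H 0 = integral {0..n} ?f"
    by (rule eventually_mono[OF eventually_ge_at_top[of 0]]) (rule integral_unique[OF FTC, symmetric])
  moreover have "((\<lambda>n. H n - H 0) \<longlongrightarrow> 0 - H 0) at_top"
  proof (intro tendsto_intros tendsto_norm_zero_cancel[of H])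
    have n: "norm (H v) = norm (of_real v / s + 1 / s\<^sup>2) * exp (- (v * Re s))" for v
      by (simp add: H_def norm_mult)
    have "((\<lambda>v. (v / norm s + 1 / (norm s)\<^sup>2) * exp (- (v * Re s))) \<longlongrightarrow> 0) at_top"
      using s s0 by real_asymp
    then show "((\<lambda>v. norm (H v)) \<longlongrightarrow> 0) at_top"
    proof (rule Lim_null_comparison[rotated])
      show "\<forall>\<^sub>F v in at_top. norm (norm (H v)) \<le> (v / norm s + 1 / (norm s)\<^sup>2) * exp (- (v * Re s))"
        using eventually_ge_at_top[of 0]
      proof eventually_elim
        case (elim v)
        have "norm (of_real v / s + 1 / s\<^sup>2) \<le> norm (of_real v / s) + norm (1 / s\<^sup>2)" by (rule norm_triangle_ineq)
        then show ?case using elim by (simp add: n norm_divide norm_power mult_right_mono)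
      qed
    qed
  qed
  ultimately have "((\<lambda>n. integral {0..n} ?f) \<longlongrightarrow> 0 - H 0) at_top" by (rule Lim_transform_eventually[rotated])
  with integral_tendsto_improper[OF integral_pos_lborel_eq_HK(2)[OF i]]
  have "integral {0..} ?f = 0 - H 0" by (intro tendsto_unique[OF trivial_limit_at_top_linorder])
  then show "(\<integral>v. ?f v \<partial>pos_lborel) = 1 / s\<^sup>2"
    using integral_pos_lborel_eq_HK(1)[OF i] by (simp add: H_def)
qed

text \<open>The trace of the kernel with \<open>Q\<close> deleted. Replacing x by x + v multiplies
  the summand of the node -w by exp(-v w), so integration against v restores the denominator (w_k +
  w_l)^2.\<close>

definition reduced_trace :: "real \<Rightarrow> real \<Rightarrow> real \<Rightarrow> complex \<Rightarrow> complex" where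
  "reduced_trace \<tau> x \<gamma> z =
     (\<integral>v. of_real v * (theta \<tau> (x + v) (\<gamma> / 2) z * theta \<tau> (x + v) (- \<gamma> / 2) z) \<partial>pos_lborel)"

definition trace_summand :: "real \<Rightarrow> real \<Rightarrow> real \<Rightarrow> complex \<Rightarrow> int \<Rightarrow> int \<Rightarrow> complex" where
  "trace_summand \<tau> x \<gamma> \<zeta> k l = theta_summand \<tau> x (\<gamma> / 2) \<zeta> k * theta_summand \<tau> x (- \<gamma> / 2) \<zeta> l / (branch \<zeta> k + branch \<zeta> l)\<^sup>2"

lemma theta_summand_shift:
  "theta_summand \<tau> (x + v) a \<zeta> k = theta_summand \<tau> x a \<zeta> k * exp (- (of_real v * branch \<zeta> k))"
proof -
  have "cubic_phase \<tau> (x + v) w + c = (cubic_phase \<tau> x w + c) + (- (of_real v * w))" for w c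
    by (simp add: cubic_phase_def algebra_simps)
  then show ?thesis unfolding theta_summand_def by (simp only: exp_add) simp
qed

context
  fixes \<zeta> :: complex and \<tau> x \<gamma> :: real
  assumes \<zeta>: "Re \<zeta> > 0" "\<bar>Im \<zeta>\<bar> \<le> 6 * pi" and x: "x \<ge> 0" and \<tau>: "\<tau> > 0"
begin

definition "theta_factor = cubic_bound \<tau> x (Re \<zeta>) * exp (\<bar>\<gamma>\<bar> / 2 * Re \<zeta>) / sqrt (Re \<zeta>)"

lemma norm_theta_summand_shift_le:
  assumes v: "v \<ge> 0" and a: "a = \<gamma> / 2 \<or> a = - \<gamma> / 2"
  shows "norm (theta_summand \<tau> (x + v) a \<zeta> k) \<le> theta_factor * exp (- (sqrt (Re \<zeta>) * v)) * weight k"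
proof -
  have 1: "norm (exp (- (of_real v * branch \<zeta> k))) \<le> exp (- (sqrt (Re \<zeta>) * v))"
    using mult_left_mono[OF Re_branch(2)[OF \<zeta>(1), of k] v] by (simp add: mult.commute)
  have "norm (theta_summand \<tau> x a \<zeta> k) \<le> cubic_bound \<tau> x (Re \<zeta>) * exp (a * Re \<zeta>) / sqrt (Re \<zeta>) * weight k"
    by (rule norm_theta_summand_le[OF \<zeta> x \<tau>])
  also have "\<dots> \<le> theta_factor * weight k"
    unfolding theta_factor_def
  proof (intro mult_right_mono divide_right_mono mult_left_mono)
    have "a * Re \<zeta> \<le> \<bar>\<gamma>\<bar> / 2 * Re \<zeta>" using a \<zeta> by (intro mult_right_mono) auto
    then show "exp (a * Re \<zeta>) \<le> exp (\<bar>\<gamma>\<bar> / 2 * Re \<zeta>)" by simp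
  qed (use \<zeta> cubic_bound_pos[OF \<zeta>(1), of \<tau> x] weight_pos[of k] in auto)
  finally have 2: "norm (theta_summand \<tau> x a \<zeta> k) \<le> theta_factor * weight k" .
  have "norm (theta_summand \<tau> (x + v) a \<zeta> k) \<le> (theta_factor * weight k) * exp (- (sqrt (Re \<zeta>) * v))"
    unfolding theta_summand_shift norm_mult using 1 2 by (intro mult_mono) (auto intro: order_trans[OF norm_ge_zero])
  then show ?thesis by (simp add: mult_ac)
qed

lemma theta_summand_measurable: "(\<lambda>v. theta_summand \<tau> (x + v) a \<zeta> k) \<in> borel_measurable pos_lborel"
  unfolding theta_summand_shift
  by (rule measurable_pos_lborel_continuous) (auto intro!: continuous_intros)

lemma norm_theta_shift_le:
  assumes v: "v \<ge> 0" and a: "a = \<gamma> / 2 \<or> a = - \<gamma> / 2"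
  shows "norm (theta \<tau> (x + v) a (exp (- \<zeta> / 2))) \<le> theta_factor * exp (- (sqrt (Re \<zeta>) * v)) * weight_sum"
    and "(\<lambda>k. theta_summand \<tau> (x + v) a \<zeta> k) summable_on UNIV"
proof -
  let ?c = "theta_factor * exp (- (sqrt (Re \<zeta>) * v))"
  have s: "(\<lambda>k. ?c * weight k) summable_on UNIV" by (intro summable_on_cmult_right summable_on_weight)
  show sm: "(\<lambda>k. theta_summand \<tau> (x + v) a \<zeta> k) summable_on UNIV"
    by (rule abs_summable_summable[OF Infinite_Sum.abs_summable_on_comparison_test'[OF s]])
      (rule norm_theta_summand_shift_le[OF v a])
  have "norm (theta \<tau> (x + v) a (exp (- \<zeta> / 2))) \<le> (\<Sum>\<^sub>\<infinity>k. ?c * weight k)"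
    unfolding theta_branch[OF \<zeta>(1)]
    by (rule norm_infsum_le[OF has_sum_infsum[OF sm] has_sum_infsum[OF s]]) (rule norm_theta_summand_shift_le[OF v a])
  then show "norm (theta \<tau> (x + v) a (exp (- \<zeta> / 2))) \<le> ?c * weight_sum"
    by (simp only: infsum_cmult_right' weight_sum_def)
qed

lemma theta_shift_measurable:
  assumes a: "a = \<gamma> / 2 \<or> a = - \<gamma> / 2"
  shows "(\<lambda>v. theta \<tau> (x + v) a (exp (- \<zeta> / 2))) \<in> borel_measurable pos_lborel"
  unfolding theta_branch[OF \<zeta>(1)]
proof (rule has_sum_integral_dominated(2))
  show "norm (theta_summand \<tau> (x + v) a \<zeta> k) \<le> weight k * (theta_factor * exp (- (sqrt (Re \<zeta>) * v)))" if "v \<in> space pos_lborel" for k v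
    using norm_theta_summand_shift_le[of v a k] a that by (simp add: space_restrict_space mult_ac)
  show "integrable pos_lborel (\<lambda>v. theta_factor * exp (- (sqrt (Re \<zeta>) * v)))"
    using has_bochner_integral_exp_ray(1)[of "sqrt (Re \<zeta>)"] \<zeta> by (intro integrable_mult_right) (simp add: has_bochner_integral_iff)
qed (rule theta_summand_measurable summable_on_weight)+

text \<open>The integral is exchanged with the sum over l for fixed k, then with the sum over k.
  Each theta factor decays at least like exp(-sqrt (Re \<zeta>) v), so v exp(-2 sqrt (Re \<zeta>) v)
  dominates in v.\<close>

lemma reduced_trace_branch:
  "reduced_trace \<tau> x \<gamma> (exp (- \<zeta> / 2)) = (\<Sum>\<^sub>\<infinity>k. \<Sum>\<^sub>\<infinity>l. trace_summand \<tau> x \<gamma> \<zeta> k l)"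
proof -
  let ?r = "sqrt (Re \<zeta>)"
  let ?p = "\<lambda>v k. theta_summand \<tau> (x + v) (\<gamma> / 2) \<zeta> k" and ?n = "\<lambda>v k. theta_summand \<tau> (x + v) (- \<gamma> / 2) \<zeta> k"
  let ?N = "\<lambda>v. theta \<tau> (x + v) (- \<gamma> / 2) (exp (- \<zeta> / 2))"
  have r: "?r > 0" using \<zeta> by simp
  have gi: "integrable pos_lborel (\<lambda>v. C * (v * exp (- (2 * ?r * v))))" for C
    using has_bochner_integral_exp_ray(2)[of "2 * ?r"] r by (intro integrable_mult_right) (simp add: has_bochner_integral_iff)
  have mv: "(\<lambda>v. complex_of_real v) \<in> borel_measurable pos_lborel"
    by (rule measurable_pos_lborel_continuous) (auto intro!: continuous_intros)
  have ee: "exp (- (?r * v)) * exp (- (?r * v)) = exp (- (2 * ?r * v))" for v by (simp flip: exp_add)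
  have prod_le: "norm (of_real v * (A * B)) \<le> a * b * (v * exp (- (2 * ?r * v)))"
    if "v > 0" "norm A \<le> a * exp (- (?r * v))" "norm B \<le> b * exp (- (?r * v))" for A B :: complex and a b v
  proof -
    have "norm A * norm B \<le> (a * exp (- (?r * v))) * (b * exp (- (?r * v)))"
      using that by (intro mult_mono) (auto intro: order_trans[OF norm_ge_zero])
    also have "\<dots> = a * b * exp (- (2 * ?r * v))" unfolding ee[symmetric] by (simp add: mult_ac)
    finally have "v * (norm A * norm B) \<le> v * (a * b * exp (- (2 * ?r * v)))" using that by (intro mult_left_mono) auto
    then show ?thesis using that by (simp add: norm_mult mult_ac)
  qed
  have inner: "(\<Sum>\<^sub>\<infinity>l. trace_summand \<tau> x \<gamma> \<zeta> k l) = (\<integral>v. of_real v * (?p v k * ?N v) \<partial>pos_lborel)" for k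
  proof -
    have "((\<lambda>l. \<integral>v. of_real v * (?p v k * ?n v l) \<partial>pos_lborel) has_sum (\<integral>v. (\<Sum>\<^sub>\<infinity>l. of_real v * (?p v k * ?n v l)) \<partial>pos_lborel)) UNIV"
    proof (rule has_sum_integral_dominated(1)[where f = "\<lambda>l v. of_real v * (?p v k * ?n v l)" and W = weight
          and g = "\<lambda>v. theta_factor * weight k * theta_factor * (v * exp (- (2 * ?r * v)))"])
      show "(\<lambda>v. of_real v * (?p v k * ?n v l)) \<in> borel_measurable pos_lborel" for l
        by (intro borel_measurable_times mv theta_summand_measurable)
      show "norm (of_real v * (?p v k * ?n v l)) \<le> weight l * (theta_factor * weight k * theta_factor * (v * exp (- (2 * ?r * v))))"
        if "v \<in> space pos_lborel" for l v
        using prod_le[of v "?p v k" "theta_factor * weight k" "?n v l" "theta_factor * weight l"]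
          norm_theta_summand_shift_le[of v "\<gamma> / 2" k] norm_theta_summand_shift_le[of v "- \<gamma> / 2" l] that
        by (simp add: space_restrict_space mult_ac)
    qed (rule summable_on_weight gi)+
    moreover have "(\<integral>v. of_real v * (?p v k * ?n v l) \<partial>pos_lborel) = trace_summand \<tau> x \<gamma> \<zeta> k l" for l
    proof -
      let ?s = "branch \<zeta> k + branch \<zeta> l"
      have s: "Re ?s > 0" using Re_branch(1)[OF \<zeta>(1), of k] Re_branch(1)[OF \<zeta>(1), of l] by simp
      have "of_real v * (?p v k * ?n v l) = (theta_summand \<tau> x (\<gamma> / 2) \<zeta> k * theta_summand \<tau> x (- \<gamma> / 2) \<zeta> l) * (of_real v * exp (- (of_real v * ?s)))" for v
      proof -
        have "exp (- (of_real v * ?s)) = exp (- (of_real v * branch \<zeta> k)) * exp (- (of_real v * branch \<zeta> l))"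
          by (simp add: ring_distribs flip: exp_add)
        then show ?thesis unfolding theta_summand_shift by (simp only: mult_ac)
      qed
      then have "(\<integral>v. of_real v * (?p v k * ?n v l) \<partial>pos_lborel)
        = (\<integral>v. (theta_summand \<tau> x (\<gamma> / 2) \<zeta> k * theta_summand \<tau> x (- \<gamma> / 2) \<zeta> l) * (of_real v * exp (- (of_real v * ?s))) \<partial>pos_lborel)" by (simp only:)
      also have "\<dots> = (theta_summand \<tau> x (\<gamma> / 2) \<zeta> k * theta_summand \<tau> x (- \<gamma> / 2) \<zeta> l) * (1 / ?s\<^sup>2)"
        by (subst integral_mult_right_zero, subst integral_exp_laplace(2)[OF s]) (rule refl)
      finally show ?thesis by (simp add: trace_summand_def)
    qed
    moreover have "(\<integral>v. (\<Sum>\<^sub>\<infinity>l. of_real v * (?p v k * ?n v l)) \<partial>pos_lborel) = (\<integral>v. of_real v * (?p v k * ?N v) \<partial>pos_lborel)"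
      unfolding theta_branch[OF \<zeta>(1)] infsum_cmult_right' ..
    ultimately show ?thesis by (simp add: infsumI)
  qed
  have "((\<lambda>k. \<integral>v. of_real v * (?p v k * ?N v) \<partial>pos_lborel) has_sum (\<integral>v. (\<Sum>\<^sub>\<infinity>k. of_real v * (?p v k * ?N v)) \<partial>pos_lborel)) UNIV"
  proof (rule has_sum_integral_dominated(1)[where f = "\<lambda>k v. of_real v * (?p v k * ?N v)" and W = weight
          and g = "\<lambda>v. theta_factor * (theta_factor * weight_sum) * (v * exp (- (2 * ?r * v)))"])
    show "(\<lambda>v. of_real v * (?p v k * ?N v)) \<in> borel_measurable pos_lborel" for k
      by (intro borel_measurable_times mv theta_summand_measurable theta_shift_measurable) auto
    show "norm (of_real v * (?p v k * ?N v)) \<le> weight k * (theta_factor * (theta_factor * weight_sum) * (v * exp (- (2 * ?r * v))))"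
      if "v \<in> space pos_lborel" for k v
      using prod_le[of v "?p v k" "theta_factor * weight k" "?N v" "theta_factor * weight_sum"]
        norm_theta_summand_shift_le[of v "\<gamma> / 2" k] norm_theta_shift_le(1)[of v "- \<gamma> / 2"] that
      by (simp add: space_restrict_space mult_ac)
  qed (rule summable_on_weight gi)+
  moreover have "(\<integral>v. (\<Sum>\<^sub>\<infinity>k. of_real v * (?p v k * ?N v)) \<partial>pos_lborel) = reduced_trace \<tau> x \<gamma> (exp (- \<zeta> / 2))"
    unfolding reduced_trace_def theta_branch[OF \<zeta>(1), of _ _ "\<gamma> / 2"] infsum_cmult_right' infsum_cmult_left' ..
  ultimately show ?thesis unfolding inner by (simp add: infsumI)
qed

end

section \<open>Reduction of the determinant to its trace\<close>

lemma norm_exp_minus_one_le: "norm (exp u - 1) \<le> norm u * exp (norm u)" for u :: complex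
proof -
  have "norm (exp u - exp 0) \<le> exp (norm u) * norm (u - 0)"
  proof (rule field_differentiable_bound[where S = "cball 0 (norm u)" and f' = exp])
    show "norm (exp z) \<le> exp (norm u)" if "z \<in> cball 0 (norm u)" for z
      using norm_exp[of z] that by (auto intro: order_trans)
  qed (auto intro: DERIV_exp has_field_derivative_at_within)
  then show ?thesis by (simp add: mult.commute)
qed

lemma infsum_of_diff:
  fixes f g :: "'i \<Rightarrow> 'a::real_normed_vector"
  assumes "f summable_on A" "g summable_on A"
  shows "(\<Sum>\<^sub>\<infinity>i\<in>A. f i - g i) = infsum f A - infsum g A"
proof -
  have "(\<lambda>i. - g i) summable_on A" using assms(2) by (simp add: summable_on_uminus)
  from infsum_add[OF assms(1) this] show ?thesis by (simp add: infsum_uminus)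
qed

lemma double_infsum_bound:
  fixes d :: "int \<Rightarrow> int \<Rightarrow> complex"
  assumes d: "\<And>k l. norm (d k l) \<le> C * weight k * weight l"
  shows "d k summable_on UNIV" and "(\<lambda>k. \<Sum>\<^sub>\<infinity>l. d k l) summable_on UNIV"
    and "norm (\<Sum>\<^sub>\<infinity>k. \<Sum>\<^sub>\<infinity>l. d k l) \<le> C * weight_sum\<^sup>2"
proof -
  have s: "(\<lambda>l. c * weight l) summable_on UNIV" for c by (rule summable_on_cmult_right[OF summable_on_weight])
  have 1: "d k summable_on UNIV" for k
    by (rule abs_summable_summable[OF Infinite_Sum.abs_summable_on_comparison_test'[OF s]]) (rule d)
  then show "d k summable_on UNIV" .
  have 2: "norm (\<Sum>\<^sub>\<infinity>l. d k l) \<le> (C * weight_sum) * weight k" for k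
  proof -
    have "norm (\<Sum>\<^sub>\<infinity>l. d k l) \<le> (\<Sum>\<^sub>\<infinity>l. (C * weight k) * weight l)"
      by (rule norm_infsum_le[OF has_sum_infsum[OF 1] has_sum_infsum[OF s]]) (rule d)
    also have "\<dots> = (C * weight k) * weight_sum" by (simp only: infsum_cmult_right' weight_sum_def)
    finally show ?thesis by (simp only: mult_ac)
  qed
  show 3: "(\<lambda>k. \<Sum>\<^sub>\<infinity>l. d k l) summable_on UNIV"
    by (rule abs_summable_summable[OF Infinite_Sum.abs_summable_on_comparison_test'[OF s]]) (rule 2)
  have "norm (\<Sum>\<^sub>\<infinity>k. \<Sum>\<^sub>\<infinity>l. d k l) \<le> (\<Sum>\<^sub>\<infinity>k. (C * weight_sum) * weight k)"
    by (rule norm_infsum_le[OF has_sum_infsum[OF 3] has_sum_infsum[OF s]]) (rule 2)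
  also have "\<dots> = (C * weight_sum) * weight_sum" by (simp only: infsum_cmult_right' weight_sum_def)
  finally show "norm (\<Sum>\<^sub>\<infinity>k. \<Sum>\<^sub>\<infinity>l. d k l) \<le> C * weight_sum\<^sup>2" by (simp add: power2_eq_square)
qed

text \<open>On the diagonal the two half phases of the outer node recombine, its two square roots
  multiply to the node itself, and the \<gamma> terms become \<gamma>/2 times the difference of the
  squares. Only the factor with \<open>Q\<close> separates it from a product of theta
  summands.\<close>

lemma kernel_summand_diagonal:
  "kernel_summand x \<tau> \<gamma> \<zeta> k m k = trace_summand \<tau> x \<gamma> \<zeta> k m * exp (- Q (- branch \<zeta> k) - Q (- branch \<zeta> m))"
proof -
  define w u p q where "w = branch \<zeta> k" and "u = branch \<zeta> m"
    and "p = Q (- w)" and "q = Q (- u)"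
  have e: "1/2 * (cubic_phase \<tau> x w - p) + (cubic_phase \<tau> x u - q) + 1/2 * (cubic_phase \<tau> x w - p)
        + of_real \<gamma> / 4 * (w\<^sup>2 - 2 * u\<^sup>2 + w\<^sup>2)
     = (cubic_phase \<tau> x w + of_real (\<gamma> / 2) * w\<^sup>2) + (cubic_phase \<tau> x u + of_real (- \<gamma> / 2) * u\<^sup>2) + (- p - q)"
    by (simp add: field_simps)
  have d: "csqrt w * u * (w + u) * (u + w) * csqrt w = w * u * (w + u)\<^sup>2"
  proof -
    have "csqrt w * u * (w + u) * (u + w) * csqrt w = (csqrt w)\<^sup>2 * u * (w + u)\<^sup>2"
      by (simp only: power2_eq_square mult_ac add.commute[of u w])
    then show ?thesis by simp
  qed
  show ?thesis
    unfolding kernel_summand_def branch_phase_def trace_summand_def theta_summand_def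
      w_def[symmetric] u_def[symmetric] p_def[symmetric] q_def[symmetric] e d exp_add
    by (simp only: times_divide_eq_left times_divide_eq_right divide_divide_eq_left mult_ac)
qed

definition reduced_bound :: "real \<Rightarrow> real \<Rightarrow> real \<Rightarrow> real" where
  "reduced_bound \<tau> x \<rho> = (cubic_bound \<tau> x \<rho>)\<^sup>2 / (4 * \<rho>\<^sup>2)"

text \<open>The sum of the squares of \<open>kernel_factor\<close> with its constants taken at this
  \<rho>.\<close>

definition fredholm_tail :: "real \<Rightarrow> real \<Rightarrow> real \<Rightarrow> real" where
  "fredholm_tail \<tau> x \<rho> = (cubic_bound \<tau> x \<rho> * exp (tail_bound \<rho>) * weight_sum / (2 * \<rho>))\<^sup>2"

context
  fixes \<zeta> :: complex and \<tau> x \<gamma> :: real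
  assumes \<zeta>: "Re \<zeta> > 0" "\<bar>Im \<zeta>\<bar> \<le> 6 * pi" and x: "x \<ge> 0" and \<tau>: "\<tau> > 0"
begin

lemma norm_trace_summand_le:
  "norm (trace_summand \<tau> x \<gamma> \<zeta> k l) \<le> reduced_bound \<tau> x (Re \<zeta>) * weight k * weight l"
proof -
  define r c where "r = sqrt (Re \<zeta>)" and "c = cubic_bound \<tau> x (Re \<zeta>)"
  have r: "r > 0" "r\<^sup>2 = Re \<zeta>" using \<zeta> by (auto simp: r_def)
  have c: "c > 0" unfolding c_def by (rule cubic_bound_pos[OF \<zeta>(1)])
  have 1: "norm (theta_summand \<tau> x a \<zeta> k) \<le> c * exp (a * Re \<zeta>) / r * weight k" for a k
    unfolding r_def c_def by (rule norm_theta_summand_le[OF \<zeta> x \<tau>])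
  have "2 * r \<le> norm (branch \<zeta> k + branch \<zeta> l)"
    using Re_branch(2)[OF \<zeta>(1), of k] Re_branch(2)[OF \<zeta>(1), of l] complex_Re_le_cmod[of "branch \<zeta> k + branch \<zeta> l"]
    by (simp add: r_def)
  then have 2: "(2 * r)\<^sup>2 \<le> norm ((branch \<zeta> k + branch \<zeta> l)\<^sup>2)"
    unfolding norm_power using r by (intro power_mono) auto
  have "norm (trace_summand \<tau> x \<gamma> \<zeta> k l)
    \<le> (c * exp (\<gamma> / 2 * Re \<zeta>) / r * weight k) * (c * exp (- \<gamma> / 2 * Re \<zeta>) / r * weight l) / (2 * r)\<^sup>2"
  proof -
    have m: "norm (theta_summand \<tau> x (\<gamma> / 2) \<zeta> k) * norm (theta_summand \<tau> x (- \<gamma> / 2) \<zeta> l)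
      \<le> (c * exp (\<gamma> / 2 * Re \<zeta>) / r * weight k) * (c * exp (- \<gamma> / 2 * Re \<zeta>) / r * weight l)"
      by (rule mult_mono[OF 1[of "\<gamma> / 2" k] 1[of "- \<gamma> / 2" l]])
        (use r c weight_pos[of k] weight_pos[of l] in auto)
    show ?thesis
      unfolding trace_summand_def norm_divide norm_mult
      by (rule frac_le[OF _ m _ 2]) (use \<zeta> r c weight_pos[of k] weight_pos[of l] in auto)
  qed
  \<comment> \<open>The two exponentials cancel. Bounding each by its absolute value would cost
    exp(|\<gamma>| \<rho>) with \<rho> = Re \<zeta>, which at |\<gamma>| = 1/2 would use up the
    whole gain exp(-\<rho>/2).\<close>
  also have "\<dots> = (exp (\<gamma> / 2 * Re \<zeta>) * exp (- \<gamma> / 2 * Re \<zeta>)) * (c\<^sup>2 / (4 * (r\<^sup>2)\<^sup>2) * weight k * weight l)"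
    using r(1) by (simp add: power2_eq_square field_simps)
  also have "exp (\<gamma> / 2 * Re \<zeta>) * exp (- \<gamma> / 2 * Re \<zeta>) = 1" by (simp flip: exp_add)
  finally show ?thesis by (simp add: r(2) c_def reduced_bound_def)
qed

text \<open>Weight and \<open>Q\<close> enter through one exponent, E minus two values of
  \<open>Q\<close>, of modulus at most y. The bound |exp u - 1| \<le> |u| exp |u| is applied summand
  by summand, so the error is y exp y times the absolute bound of the trace.\<close>

lemma reduced_trace_comparison:
  fixes E :: complex
  defines "y \<equiv> norm E + 2 * tail_bound (Re \<zeta>)"
  shows "norm (exp E * (\<Sum>\<^sub>\<infinity>k. kernel_matrix x \<tau> \<gamma> \<zeta> k k) - reduced_trace \<tau> x \<gamma> (exp (- \<zeta> / 2)))
    \<le> reduced_bound \<tau> x (Re \<zeta>) * (y * exp y) * weight_sum\<^sup>2"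
proof -
  let ?b = "reduced_bound \<tau> x (Re \<zeta>)"
  let ?t = "trace_summand \<tau> x \<gamma> \<zeta>" and ?q = "\<lambda>k m. exp (- Q (- branch \<zeta> k) - Q (- branch \<zeta> m))"
  have b0: "?b \<ge> 0" by (simp add: reduced_bound_def)
  have u: "norm (E + (- Q (- branch \<zeta> k) - Q (- branch \<zeta> m))) \<le> y" for k m
    using norm_triangle_ineq[of E "- Q (- branch \<zeta> k) - Q (- branch \<zeta> m)"]
      norm_triangle_ineq4[of "- Q (- branch \<zeta> k)" "Q (- branch \<zeta> m)"]
      norm_Q_branch_le[OF \<zeta>(1), of k] norm_Q_branch_le[OF \<zeta>(1), of m]
    unfolding y_def by (simp only: norm_minus_cancel)
  have y0: "y \<ge> 0" using u[of 0 0] norm_ge_zero order_trans by blast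
  have s1: "norm (exp E * ?q k m - 1) \<le> y * exp y" for k m
  proof -
    have "norm (exp (E + (- Q (- branch \<zeta> k) - Q (- branch \<zeta> m))) - 1) \<le> y * exp y"
      using norm_exp_minus_one_le[of "E + (- Q (- branch \<zeta> k) - Q (- branch \<zeta> m))"] u[of k m] y0
      by (elim order_trans) (intro mult_mono, auto)
    then show ?thesis by (simp only: exp_add)
  qed
  have s2: "norm (exp E * ?q k m) \<le> 1 + y * exp y" for k m
    using s1[of k m] norm_triangle_ineq2[of "exp E * ?q k m" 1] by simp
  have tb: "norm (?t k l) \<le> ?b * weight k * weight l" for k l by (rule norm_trace_summand_le)
  have w0: "0 \<le> ?b * weight k * weight l" for k l using b0 weight_pos[of k] weight_pos[of l] by simp
  have d1: "norm (exp E * (?t k l * ?q k l)) \<le> (?b * (1 + y * exp y)) * weight k * weight l" for k l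
  proof -
    have "norm (?t k l) * norm (exp E * ?q k l) \<le> (?b * weight k * weight l) * (1 + y * exp y)"
      by (intro mult_mono tb s2 w0) auto
    then show ?thesis by (simp add: norm_mult mult_ac)
  qed
  have d2: "norm (exp E * (?t k l * ?q k l) - ?t k l) \<le> (?b * (y * exp y)) * weight k * weight l" for k l
  proof -
    have "norm (?t k l) * norm (exp E * ?q k l - 1) \<le> (?b * weight k * weight l) * (y * exp y)"
      by (intro mult_mono tb s1 w0) auto
    moreover have "exp E * (?t k l * ?q k l) - ?t k l = ?t k l * (exp E * ?q k l - 1)" by (simp add: algebra_simps)
    ultimately show ?thesis by (simp add: norm_mult mult_ac)
  qed
  have "exp E * (\<Sum>\<^sub>\<infinity>k. kernel_matrix x \<tau> \<gamma> \<zeta> k k) = (\<Sum>\<^sub>\<infinity>k. \<Sum>\<^sub>\<infinity>l. exp E * (?t k l * ?q k l))"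
    unfolding kernel_matrix_def kernel_summand_diagonal infsum_cmult_right' ..
  then have "exp E * (\<Sum>\<^sub>\<infinity>k. kernel_matrix x \<tau> \<gamma> \<zeta> k k) - reduced_trace \<tau> x \<gamma> (exp (- \<zeta> / 2))
     = (\<Sum>\<^sub>\<infinity>k. \<Sum>\<^sub>\<infinity>l. exp E * (?t k l * ?q k l)) - (\<Sum>\<^sub>\<infinity>k. \<Sum>\<^sub>\<infinity>l. ?t k l)"
    unfolding reduced_trace_branch[OF \<zeta> x \<tau>] by simp
  also have "\<dots> = (\<Sum>\<^sub>\<infinity>k. (\<Sum>\<^sub>\<infinity>l. exp E * (?t k l * ?q k l)) - (\<Sum>\<^sub>\<infinity>l. ?t k l))"
    by (rule infsum_of_diff[symmetric]) (rule double_infsum_bound(2)[OF d1] double_infsum_bound(2)[OF tb])+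
  also have "\<dots> = (\<Sum>\<^sub>\<infinity>k. \<Sum>\<^sub>\<infinity>l. exp E * (?t k l * ?q k l) - ?t k l)"
    by (rule infsum_cong, rule infsum_of_diff[symmetric]) (rule double_infsum_bound(1)[OF d1] double_infsum_bound(1)[OF tb])+
  finally show ?thesis using double_infsum_bound(3)[OF d2] by simp
qed

text \<open>E stands for the exponent of the weight. The trace is replaced by
  \<open>reduced_trace\<close>, and the remaining Fredholm terms, of second order in s, are only
  bounded.\<close>

lemma fredholm_det_comparison:
  fixes E :: complex
  defines "y \<equiv> norm E + 2 * tail_bound (Re \<zeta>)" and "s \<equiv> fredholm_tail \<tau> x (Re \<zeta>)"
  assumes s: "s < 1"
  shows "norm (exp E * (1 - fredholm_det (count_space (S_minus (exp (- \<zeta> / 2)))) (K_kernel x \<tau> \<gamma> (exp (- \<zeta> / 2))))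
       - reduced_trace \<tau> x \<gamma> (exp (- \<zeta> / 2)))
    \<le> reduced_bound \<tau> x (Re \<zeta>) * (y * exp y) * weight_sum\<^sup>2 + exp (norm E) * (s\<^sup>2 / (1 - s))"
proof -
  let ?N = "cubic_bound \<tau> x (Re \<zeta>) * exp (tail_bound (Re \<zeta>))"
  let ?D = "fredholm_det (count_space (S_minus (exp (- \<zeta> / 2)))) (K_kernel x \<tau> \<gamma> (exp (- \<zeta> / 2)))"
  let ?T = "\<Sum>\<^sub>\<infinity>k. kernel_matrix x \<tau> \<gamma> \<zeta> k k"
  have N0: "?N \<ge> 0" using cubic_bound_pos[OF \<zeta>(1), of \<tau> x] by simp
  have D: "norm (?D - 1 + ?T) \<le> s\<^sup>2 / (1 - s)"
    unfolding fredholm_det_branch[OF x \<tau> \<zeta>(1) order_refl \<zeta>(2) order_refl N0]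
  proof (rule fredholm_series_bound(1)[OF norm_kernel_matrix_le(1)[OF x \<tau> \<zeta>(1) order_refl \<zeta>(2) order_refl] kernel_factor_square(1)[OF N0] _ s])
    show "(\<Sum>\<^sub>\<infinity>k. (kernel_factor ?N (Re \<zeta>) k)\<^sup>2) \<le> s"
      unfolding kernel_factor_square(2)[OF N0] s_def fredholm_tail_def by simp
  qed
  have "exp E * (1 - ?D) - reduced_trace \<tau> x \<gamma> (exp (- \<zeta> / 2))
     = (exp E * ?T - reduced_trace \<tau> x \<gamma> (exp (- \<zeta> / 2))) - exp E * (?D - 1 + ?T)"
    by (simp add: algebra_simps)
  also have "norm \<dots> \<le> reduced_bound \<tau> x (Re \<zeta>) * (y * exp y) * weight_sum\<^sup>2 + exp (norm E) * (s\<^sup>2 / (1 - s))"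
  proof (rule norm_triangle_le_diff[OF add_mono])
    show "norm (exp E * ?T - reduced_trace \<tau> x \<gamma> (exp (- \<zeta> / 2))) \<le> reduced_bound \<tau> x (Re \<zeta>) * (y * exp y) * weight_sum\<^sup>2"
      unfolding y_def by (rule reduced_trace_comparison)
    show "norm (exp E * (?D - 1 + ?T)) \<le> exp (norm E) * (s\<^sup>2 / (1 - s))"
      unfolding norm_mult using D by (intro mult_mono norm_exp) auto
  qed
  finally show ?thesis .
qed

end

section \<open>Fubini for the angle and the Laplace variable\<close>

text \<open>Joint continuity supplies the measurability on the product that Fubini asks for. The
  majorant is the one at v = 0, since growing v only adds decay.\<close>

lemma theta_shift_continuous:
  assumes \<rho>: "\<rho> > 0" and x: "x \<ge> 0" and \<tau>: "\<tau> > 0" and a: "a = \<gamma> / 2 \<or> a = - \<gamma> / 2"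
  shows "continuous_on ({0..1} \<times> {0..}) (\<lambda>(t, v). theta \<tau> (x + v) a (of_real (exp (- \<rho> / 2)) * exp (2 * of_real pi * \<i> * of_real t)))"
proof -
  define Z where "Z = (\<lambda>t. of_real \<rho> - 4 * of_real pi * \<i> * complex_of_real t)"
  have Z: "Re (Z t) = \<rho>" for t by (simp add: Z_def)
  have Z2: "Re (Z t) > 0" "\<bar>Im (Z t)\<bar> \<le> 6 * pi" if "t \<in> {0..1}" for t
    using \<rho> that unfolding Z_def by (simp, intro circle_log_bounds) auto
  have bZ: "branch (Z t) k = circle_branch \<rho> (t - of_int k)" for t k
    by (simp add: branch_def Z_def circle_branch_def algebra_simps)
  have cb: "continuous_on UNIV (circle_branch \<rho>)"
    by (intro continuous_at_imp_continuous_on ballI has_vector_derivative_continuous[OF circle_branch_derivative[OF \<rho>]])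
  let ?C = "cubic_bound \<tau> x \<rho> * exp (\<bar>\<gamma>\<bar> / 2 * \<rho>) / sqrt \<rho>"
  have C0: "?C \<ge> 0" using cubic_bound_pos[OF \<rho>, of \<tau> x] \<rho> by simp
  have "continuous_on ({0..1} \<times> {0..}) (\<lambda>p. \<Sum>\<^sub>\<infinity>k. theta_summand \<tau> (x + snd p) a (Z (fst p)) k)"
  proof (rule continuous_on_infsum)
    show "continuous_on ({0..1} \<times> {0..}) (\<lambda>p. theta_summand \<tau> (x + snd p) a (Z (fst p)) k)" for k
    proof -
      have c: "continuous_on ({0..1} \<times> {0..}) (\<lambda>p::real \<times> real. circle_branch \<rho> (fst p - of_int k))"
        by (rule continuous_on_compose2[OF cb]) (auto intro!: continuous_intros)
      have "circle_branch \<rho> s \<noteq> 0" for s using Re_circle_branch_pos[OF \<rho>, of s] by auto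
      then show ?thesis unfolding theta_summand_def cubic_phase_def bZ by (intro continuous_intros c) auto
    qed
    show "norm (theta_summand \<tau> (x + snd p) a (Z (fst p)) k) \<le> ?C * weight k" if "p \<in> {0..1} \<times> {0..}" for k p
    proof -
      have p: "fst p \<in> {0..1}" "snd p \<ge> 0" using that by auto
      have "norm (theta_summand \<tau> (x + snd p) a (Z (fst p)) k) \<le> ?C * exp (- (sqrt \<rho> * snd p)) * weight k"
        using norm_theta_summand_shift_le[OF Z2[OF p(1)] x \<tau> p(2) a, of k]
        unfolding theta_factor_def[OF Z2[OF p(1)] x \<tau>] Z .
      also have "\<dots> \<le> ?C * 1 * weight k"
        using C0 p(2) \<rho> weight_pos[of k] by (intro mult_right_mono mult_left_mono) auto
      finally show ?thesis by simp
    qed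
    show "(\<lambda>k. ?C * weight k) summable_on UNIV" by (rule summable_on_cmult_right[OF summable_on_weight])
  qed
  then show ?thesis
    unfolding circle_point case_prod_unfold
  proof (rule continuous_on_eq)
    fix p :: "real \<times> real" assume "p \<in> {0..1} \<times> {0..}"
    then have "fst p \<in> {0..1}" by auto
    from theta_branch[OF Z2(1)[OF this], of \<tau> "x + snd p" a]
    show "(\<Sum>\<^sub>\<infinity>k. theta_summand \<tau> (x + snd p) a (Z (fst p)) k)
      = theta \<tau> (x + snd p) a (exp (- (of_real \<rho> - 4 * of_real pi * \<i> * of_real (fst p)) / 2))"
      by (simp only: Z_def)
  qed
qed

lemma integrable_product_lborel:
  fixes g h :: "real \<Rightarrow> real"
  assumes g: "integrable lborel g" and h: "integrable lborel h"
  shows "integrable (lborel \<Otimes>\<^sub>M lborel) (\<lambda>(t, v). g t * h v)"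
proof (rule lborel_pair.Fubini_integrable)
  show "(\<lambda>(t, v). g t * h v) \<in> borel_measurable (lborel \<Otimes>\<^sub>M lborel)"
    using borel_measurable_integrable[OF g] borel_measurable_integrable[OF h] by measurable
  have "(\<integral>v. norm (g t * h v) \<partial>lborel) = norm (g t) * (\<integral>v. norm (h v) \<partial>lborel)" for t
    by (simp add: abs_mult)
  then show "integrable lborel (\<lambda>t. \<integral>v. norm (case (t, v) of (t, v) \<Rightarrow> g t * h v) \<partial>lborel)"
    using integrable_mult_left[OF integrable_norm[OF g], of "\<integral>v. norm (h v) \<partial>lborel"] by simp
  show "AE t in lborel. integrable lborel (\<lambda>v. case (t, v) of (t, v) \<Rightarrow> g t * h v)"
    using h by (auto intro!: AE_I2)
qed

text \<open>Fubini on the circle times the half line, for the integrand extended by 0. Integrability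
  of \<open>reduced_trace\<close> along the circle comes out as well, in the form in which
  \<open>circle_mean_diff_le\<close> takes its second function.\<close>

lemma circle_mean_reduced_trace:
  assumes \<rho>: "\<rho> > 0" and x: "x \<ge> 0" and \<tau>: "\<tau> > 0"
  defines "R \<equiv> exp (- \<rho> / 2)"
  shows "circle_mean R (reduced_trace \<tau> x \<gamma>)
     = (\<integral>v. of_real v * circle_mean R (\<lambda>z. theta \<tau> (x + v) (\<gamma> / 2) z * theta \<tau> (x + v) (- \<gamma> / 2) z) \<partial>pos_lborel)"
    and "(\<lambda>t. reduced_trace \<tau> x \<gamma> (of_real R * exp (2 * of_real pi * \<i> * of_real t))) integrable_on {0..1}"
    and "integrable pos_lborel (\<lambda>v. of_real v * circle_mean R (\<lambda>z. theta \<tau> (x + v) (\<gamma> / 2) z * theta \<tau> (x + v) (- \<gamma> / 2) z))"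
proof -
  define e where "e = (\<lambda>t. of_real R * exp (2 * of_real pi * \<i> * complex_of_real t))"
  have R0: "R > 0" by (simp add: R_def)
  define \<Theta> where "\<Theta> = (\<lambda>t v. theta \<tau> (x + v) (\<gamma> / 2) (e t) * theta \<tau> (x + v) (- \<gamma> / 2) (e t))"
  define Z where "Z = (\<lambda>t. of_real \<rho> - 4 * of_real pi * \<i> * complex_of_real t)"
  have Z: "Re (Z t) = \<rho>" for t by (simp add: Z_def)
  have Z2: "Re (Z t) > 0" "\<bar>Im (Z t)\<bar> \<le> 6 * pi" if "t \<in> {0..1}" for t
    using \<rho> that unfolding Z_def by (simp, intro circle_log_bounds) auto
  have eZ: "e t = exp (- Z t / 2)" for t unfolding e_def R_def Z_def by (rule circle_point)
  define C where "C = (cubic_bound \<tau> x \<rho> * exp (\<bar>\<gamma>\<bar> / 2 * \<rho>) / sqrt \<rho> * weight_sum)\<^sup>2"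
  have ct: "continuous_on ({0..1} \<times> {0..}) (\<lambda>(t, v). of_real v * \<Theta> t v)"
  proof -
    have 1: "continuous_on ({0..1} \<times> {0..}) (\<lambda>(t, v). theta \<tau> (x + v) (\<gamma> / 2) (e t))"
      unfolding e_def R_def by (rule theta_shift_continuous[OF \<rho> x \<tau>, of _ \<gamma>]) simp
    have 2: "continuous_on ({0..1} \<times> {0..}) (\<lambda>(t, v). theta \<tau> (x + v) (- \<gamma> / 2) (e t))"
      unfolding e_def R_def by (rule theta_shift_continuous[OF \<rho> x \<tau>, of _ \<gamma>]) simp
    show ?thesis using 1 2 unfolding \<Theta>_def case_prod_unfold by (intro continuous_intros) auto
  qed
  have b: "norm (of_real v * \<Theta> t v) \<le> C * (v * exp (- (2 * sqrt \<rho> * v)))" if t: "t \<in> {0..1}" and v: "v \<ge> 0" for t v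
  proof -
    let ?b = "cubic_bound \<tau> x \<rho> * exp (\<bar>\<gamma>\<bar> / 2 * \<rho>) / sqrt \<rho> * exp (- (sqrt \<rho> * v)) * weight_sum"
    have 1: "norm (theta \<tau> (x + v) a (e t)) \<le> ?b" if "a = \<gamma> / 2 \<or> a = - \<gamma> / 2" for a
      using norm_theta_shift_le(1)[OF Z2[OF t] x \<tau> v that]
      unfolding theta_factor_def[OF Z2[OF t] x \<tau>] Z eZ[symmetric] .
    have "norm (\<Theta> t v) \<le> ?b * ?b"
      unfolding \<Theta>_def norm_mult using 1[of "\<gamma> / 2"] 1[of "- \<gamma> / 2"]
      by (intro mult_mono) (auto intro: order_trans[OF norm_ge_zero])
    also have "\<dots> = C * (exp (- (sqrt \<rho> * v)) * exp (- (sqrt \<rho> * v)))" by (simp add: C_def power2_eq_square)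
    also have "exp (- (sqrt \<rho> * v)) * exp (- (sqrt \<rho> * v)) = exp (- (2 * sqrt \<rho> * v))" by (simp flip: exp_add)
    finally have "v * norm (\<Theta> t v) \<le> v * (C * exp (- (2 * sqrt \<rho> * v)))" using v by (intro mult_left_mono)
    then show ?thesis using v by (simp add: norm_mult mult_ac)
  qed
  define A where "A = ({0..1} :: real set) \<times> ({0<..} :: real set)"
  define G where "G = (\<lambda>p. indicator A p *\<^sub>R (case p of (t, v) \<Rightarrow> of_real v * \<Theta> t v))"
  have Ab: "A \<in> sets borel" unfolding A_def by (rule borel_Times) auto
  have Gm: "G \<in> borel_measurable (lborel \<Otimes>\<^sub>M lborel)"
  proof -
    have "G \<in> borel_measurable borel" unfolding G_def
      by (rule borel_measurable_continuous_on_indicator[OF Ab continuous_on_subset[OF ct]]) (auto simp: A_def)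
    then show ?thesis by (simp add: lborel_prod)
  qed
  have Gsplit: "G (t, v) = indicator {0..1} t *\<^sub>R (indicator {0<..} v *\<^sub>R (of_real v * \<Theta> t v))" for t v
    by (simp add: G_def A_def indicator_def)
  have hv: "integrable lborel (\<lambda>v. indicator {0<..} v * (C * (v * exp (- (2 * sqrt \<rho> * v)))))"
  proof -
    have "integrable pos_lborel (\<lambda>v. C * (v * exp (- (2 * sqrt \<rho> * v))))"
      using has_bochner_integral_exp_ray(2)[of "2 * sqrt \<rho>"] \<rho> by (intro integrable_mult_right) (simp add: has_bochner_integral_iff)
    then show ?thesis by (subst (asm) integrable_restrict_space) auto
  qed
  have Gi: "integrable (lborel \<Otimes>\<^sub>M lborel) G"
  proof (rule Bochner_Integration.integrable_bound[OF integrable_product_lborel[OF _ hv] Gm])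
    show "integrable lborel (indicator {0..1::real} :: real \<Rightarrow> real)" by (intro integrable_real_indicator) auto
    show "AE p in lborel \<Otimes>\<^sub>M lborel. norm (G p) \<le> norm (case p of (t, v) \<Rightarrow> indicator {0..1} t * (indicator {0<..} v * (C * (v * exp (- (2 * sqrt \<rho> * v))))))"
    proof (rule AE_I2)
      fix p :: "real \<times> real"
      obtain t v where p: "p = (t, v)" by (cases p)
      show "norm (G p) \<le> norm (case p of (t, v) \<Rightarrow> indicator {0..1} t * (indicator {0<..} v * (C * (v * exp (- (2 * sqrt \<rho> * v))))))"
        using b[of t v] unfolding p Gsplit by (auto simp: indicator_def)
    qed
  qed
  have in_v: "(\<integral>v. G (t, v) \<partial>lborel) = indicator {0..1} t *\<^sub>R reduced_trace \<tau> x \<gamma> (e t)" for t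
  proof -
    have "(\<integral>v. G (t, v) \<partial>lborel) = indicator {0..1} t *\<^sub>R (\<integral>v. indicator {0<..} v *\<^sub>R (of_real v * \<Theta> t v) \<partial>lborel)"
      unfolding Gsplit by (cases "t \<in> {0..1}") auto
    also have "(\<integral>v. indicator {0<..} v *\<^sub>R (of_real v * \<Theta> t v) \<partial>lborel) = reduced_trace \<tau> x \<gamma> (e t)"
      unfolding reduced_trace_def \<Theta>_def by (subst integral_restrict_space) auto
    finally show ?thesis .
  qed
  have Fv: "set_integrable lborel {0..1} (\<lambda>t. reduced_trace \<tau> x \<gamma> (e t))"
    using lborel_pair.integrable_fst'[OF Gi] unfolding in_v set_integrable_def .
  then show "(\<lambda>t. reduced_trace \<tau> x \<gamma> (of_real R * exp (2 * of_real pi * \<i> * of_real t))) integrable_on {0..1}"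
    using set_borel_integral_eq_integral(1) unfolding e_def by blast
  have cm: "circle_mean R g = integral {0..1} (\<lambda>t. g (e t))" for g
    unfolding e_def by (rule circle_mean_eq_integral[OF R0])
  have in_t: "(\<integral>t. G (t, v) \<partial>lborel) = indicator {0<..} v *\<^sub>R (of_real v * circle_mean R (\<lambda>z. theta \<tau> (x + v) (\<gamma> / 2) z * theta \<tau> (x + v) (- \<gamma> / 2) z))" for v
  proof (cases "v > 0")
    case True
    have "continuous_on {0..1} (\<lambda>t. of_real v * \<Theta> t v)"
    proof -
      have c1: "continuous_on {0..1} (\<lambda>t::real. (t, v))" by (intro continuous_intros)
      have c2: "(\<lambda>t. (t, v)) ` {0..1} \<subseteq> {0..1} \<times> {0..}" using True by auto
      from continuous_on_compose2[OF ct c1 c2] show ?thesis by (simp only: prod.case)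
    qed
    then have "set_integrable lborel {0..1} (\<lambda>t. of_real v * \<Theta> t v)"
      unfolding set_integrable_def by (rule borel_integrable_compact[OF compact_Icc])
    from set_borel_integral_eq_integral(2)[OF this]
    have "(\<integral>t. G (t, v) \<partial>lborel) = integral {0..1} (\<lambda>t. of_real v * \<Theta> t v)"
      using True unfolding Gsplit set_lebesgue_integral_def by simp
    also have "\<dots> = of_real v * integral {0..1} (\<lambda>t. \<Theta> t v)" by (rule integral_mult_right)
    finally show ?thesis using True by (simp add: cm \<Theta>_def)
  qed (simp add: Gsplit)
  show "integrable pos_lborel (\<lambda>v. of_real v * circle_mean R (\<lambda>z. theta \<tau> (x + v) (\<gamma> / 2) z * theta \<tau> (x + v) (- \<gamma> / 2) z))"
    using lborel_pair.integrable_snd[of "\<lambda>t v. G (t, v)"] Gi unfolding in_t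
    by (subst integrable_restrict_space) auto
  have "circle_mean R (reduced_trace \<tau> x \<gamma>) = (LINT t:{0..1}|lborel. reduced_trace \<tau> x \<gamma> (e t))"
    unfolding cm by (rule set_borel_integral_eq_integral(2)[OF Fv, symmetric])
  also have "\<dots> = (\<integral>t. (\<integral>v. G (t, v) \<partial>lborel) \<partial>lborel)"
    unfolding in_v set_lebesgue_integral_def ..
  also have "\<dots> = (\<integral>v. (\<integral>t. G (t, v) \<partial>lborel) \<partial>lborel)"
    using lborel_pair.Fubini_integral[of "\<lambda>t v. G (t, v)"] Gi by simp
  also have "\<dots> = (\<integral>v. of_real v * circle_mean R (\<lambda>z. theta \<tau> (x + v) (\<gamma> / 2) z * theta \<tau> (x + v) (- \<gamma> / 2) z) \<partial>pos_lborel)"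
    unfolding in_t by (subst integral_restrict_space) auto
  finally show "circle_mean R (reduced_trace \<tau> x \<gamma>)
     = (\<integral>v. of_real v * circle_mean R (\<lambda>z. theta \<tau> (x + v) (\<gamma> / 2) z * theta \<tau> (x + v) (- \<gamma> / 2) z) \<partial>pos_lborel)" .
qed

section \<open>Conjugation symmetry\<close>

text \<open>The substitution of 1 - t for t conjugates the circle. This will show that F is real, so
  that the relative error can be a real function.\<close>

lemma circle_mean_real:
  assumes R: "R > 0" and c: "continuous_on (sphere 0 R) f" and f: "\<And>z. norm z = R \<Longrightarrow> f (cnj z) = cnj (f z)"
  shows "Im (circle_mean R f) = 0"
proof -
  define e where "e = (\<lambda>t. of_real R * exp (2 * of_real pi * \<i> * complex_of_real t))"
  have ne: "norm (e t) = R" for t using R by (simp add: e_def norm_mult)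
  have ec: "cnj (e t) = e (1 - t)" for t
  proof -
    have "2 * of_real pi * \<i> * complex_of_real (1 - t) = 2 * of_real pi * \<i> + - (2 * of_real pi * \<i> * complex_of_real t)"
      by (simp add: algebra_simps)
    then have "e (1 - t) = of_real R * exp (- (2 * of_real pi * \<i> * complex_of_real t))"
      unfolding e_def by (simp only: exp_add exp_two_pi_i mult_1_left)
    moreover have "cnj (e t) = of_real R * exp (- (2 * of_real pi * \<i> * complex_of_real t))"
      by (simp add: e_def exp_cnj)
    ultimately show ?thesis by simp
  qed
  let ?h = "\<lambda>t. f (e t)"
  have m: "circle_mean R f = integral {0..1} ?h" by (simp add: circle_mean_eq_integral[OF R] e_def)
  have "continuous_on {0..1} ?h" unfolding e_def by (rule continuous_on_circle[OF c R])
  then have h: "(?h has_integral circle_mean R f) {0..1}" unfolding m by (intro integrable_integral integrable_continuous_real)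
  have "(\<lambda>x. (1 / (-1)) *\<^sub>R x + - ((1 / (-1)) *\<^sub>R 1)) ` cbox 0 (1::real) = {0..1}"
    by (auto simp: image_iff intro!: bexI[of _ "1 - _"])
  with has_integral_affinity[of ?h "circle_mean R f" 0 1 "- 1" 1] h
  have "((\<lambda>t. ?h (- t + 1)) has_integral circle_mean R f) {0..1}" by simp
  moreover have "?h (- t + 1) = cnj (?h t)" for t using f[OF ne] ec[of t] by (metis add.commute diff_conv_add_uminus)
  ultimately have "((\<lambda>t. cnj (?h t)) has_integral circle_mean R f) {0..1}" by simp
  moreover have "((\<lambda>t. cnj (?h t)) has_integral cnj (circle_mean R f)) {0..1}"
    using h has_integral_cnj[of ?h "circle_mean R f" "{0..1}"] by (simp add: o_def)
  ultimately have "cnj (circle_mean R f) = circle_mean R f" by (rule has_integral_unique[rotated])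
  then show ?thesis by (simp add: complex_eq_iff)
qed

lemma cnj_log_weight:
  assumes z: "norm z < 1"
  shows "log_weight x \<tau> (cnj z) = cnj (log_weight x \<tau> z)"
proof -
  have Bi: "B w = integral {0..1} (\<lambda>t. (polylog (1/2) (of_real t * w))\<^sup>2 / (of_real t * w) * w) / of_real (4 * pi)" for w
    unfolding B_def contour_integral_integral by (simp add: linepath_def scaleR_conv_of_real)
  have "integral {0..1} (\<lambda>t. (polylog (1/2) (of_real t * cnj z))\<^sup>2 / (of_real t * cnj z) * cnj z)
     = cnj (integral {0..1} (\<lambda>t. (polylog (1/2) (of_real t * z))\<^sup>2 / (of_real t * z) * z))"
    unfolding integral_cnj
  proof (rule integral_cong)
    fix t :: real assume t: "t \<in> {0..1}"
    have "norm (of_real t * z) < 1" using t z mult_left_le_one_le[of "norm z" t] by (auto simp: norm_mult)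
    from cnj_polylog[OF this, of "1/2"]
    show "(polylog (1/2) (of_real t * cnj z))\<^sup>2 / (of_real t * cnj z) * cnj z
      = cnj ((polylog (1/2) (of_real t * z))\<^sup>2 / (of_real t * z) * z)" by simp
  qed
  then have "B (cnj z) = cnj (B z)" unfolding Bi by simp
  then show ?thesis by (simp add: log_weight_def A1_def A2_def cnj_polylog[OF z])
qed

lemma S_minus_left_sector:
  assumes "norm z < 1" "\<xi> \<in> S_minus z"
  shows "\<xi> \<in> left_sector"
proof -
  have "norm (exp (- \<xi>\<^sup>2 / 2)) < 1" using assms by (auto simp: S_minus_def)
  then show ?thesis using assms by (auto simp: left_sector_iff S_minus_def)
qed

lemma bij_betw_cnj_S_minus: "bij_betw cnj (S_minus z) (S_minus (cnj z))"
proof (rule bij_betwI[where g = cnj])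
  have "exp (- (cnj \<xi>)\<^sup>2 / 2) = cnj (exp (- \<xi>\<^sup>2 / 2))" for \<xi> by (simp add: exp_cnj)
  then show "cnj \<in> S_minus z \<rightarrow> S_minus (cnj z)" "cnj \<in> S_minus (cnj z) \<rightarrow> S_minus z"
    by (auto simp: S_minus_def)
qed auto

lemma cnj_K_kernel:
  assumes z: "norm z < 1" and \<xi>: "\<xi>1 \<in> S_minus z" "\<xi>2 \<in> S_minus z"
  shows "K_kernel x \<tau> \<gamma> (cnj z) (cnj \<xi>1) (cnj \<xi>2) = cnj (K_kernel x \<tau> \<gamma> z \<xi>1 \<xi>2)"
proof -
  have P: "Phi \<tau> x (cnj \<xi>) = cnj (Phi \<tau> x \<xi>)" if "\<xi> \<in> S_minus z" for \<xi>
    using cnj_Q[OF S_minus_left_sector[OF z that]] by (simp add: Phi_def)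
  have c: "csqrt (- cnj \<xi>) = cnj (csqrt (- \<xi>))" if "\<xi> \<in> S_minus z" for \<xi>
    using cnj_csqrt[of "- \<xi>"] that by (auto simp: complex_nonpos_Reals_iff S_minus_def)
  show ?thesis
    unfolding K_kernel_def infsum_cnj[symmetric]
    by (subst infsum_reindex_bij_betw[OF bij_betw_cnj_S_minus, symmetric], rule infsum_cong)
      (simp add: P \<xi> c exp_cnj)
qed

lemma cnj_fredholm_term: "fredholm_term (\<lambda>k l. cnj (K k l)) n = cnj (fredholm_term K n)"
proof -
  have "Determinant.det (Matrix.mat n n (\<lambda>(i, j). cnj (K (\<kappa> i) (\<kappa> j)))) = cnj (Determinant.det (Matrix.mat n n (\<lambda>(i, j). K (\<kappa> i) (\<kappa> j))))" for \<kappa>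
  proof -
    have s: "cnj (signof p) = (signof p :: complex)" for p by (simp add: sign_def)
    have "Determinant.det (Matrix.mat n n (\<lambda>(i, j). cnj (K (\<kappa> i) (\<kappa> j))))
      = (\<Sum>p\<in>{p. p permutes {0..<n}}. signof p * (\<Prod>i = 0..<n. cnj (K (\<kappa> i) (\<kappa> (p i)))))"
      by (subst det_def') (auto intro!: sum.cong prod.cong simp: permutes_in_image)
    also have "\<dots> = cnj (\<Sum>p\<in>{p. p permutes {0..<n}}. signof p * (\<Prod>i = 0..<n. K (\<kappa> i) (\<kappa> (p i))))"
      by (simp add: s)
    also have "(\<Sum>p\<in>{p. p permutes {0..<n}}. signof p * (\<Prod>i = 0..<n. K (\<kappa> i) (\<kappa> (p i))))
      = Determinant.det (Matrix.mat n n (\<lambda>(i, j). K (\<kappa> i) (\<kappa> j)))"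
      by (subst det_def') (auto intro!: sum.cong prod.cong simp: permutes_in_image)
    finally show ?thesis .
  qed
  then show ?thesis unfolding fredholm_term_def by (simp only: infsum_cnj)
qed

text \<open>Conjugation maps the nodes of z onto those of \<open>cnj z\<close>, and the conjugated
  numbering is as good as any for \<open>fredholm_det_count_space\<close>. Smallness of
  \<open>fredholm_tail\<close> makes the series converge, so \<open>cnj\<close> passes through
  it.\<close>

lemma cnj_fredholm_det:
  assumes \<zeta>: "Re \<zeta> > 0" "\<bar>Im \<zeta>\<bar> \<le> 6 * pi" and x: "x \<ge> 0" and \<tau>: "\<tau> > 0"
    and s: "fredholm_tail \<tau> x (Re \<zeta>) < 1"
  defines "z \<equiv> exp (- \<zeta> / 2)"
  shows "fredholm_det (count_space (S_minus (cnj z))) (K_kernel x \<tau> \<gamma> (cnj z))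
    = cnj (fredholm_det (count_space (S_minus z)) (K_kernel x \<tau> \<gamma> z))"
proof -
  let ?N = "cubic_bound \<tau> x (Re \<zeta>) * exp (tail_bound (Re \<zeta>))"
  let ?K = "kernel_matrix x \<tau> \<gamma> \<zeta>"
  have N0: "?N \<ge> 0" using cubic_bound_pos[OF \<zeta>(1), of \<tau> x] by simp
  note kb = norm_kernel_matrix_le(1)[OF x \<tau> \<zeta>(1) order_refl \<zeta>(2) order_refl]
  have z1: "norm z < 1" using \<zeta> by (simp add: z_def)
  have D: "fredholm_det (count_space (S_minus z)) (K_kernel x \<tau> \<gamma> z) = (\<Sum>n. (-1) ^ n / fact n * fredholm_term ?K n)"
    unfolding z_def by (rule fredholm_det_branch[OF x \<tau> \<zeta>(1) order_refl \<zeta>(2) order_refl N0])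
  have bij: "bij_betw (\<lambda>k. cnj (- branch \<zeta> k)) UNIV (S_minus (cnj z))"
    using bij_betw_trans[OF S_minus_branch[OF \<zeta>(1)] bij_betw_cnj_S_minus] by (simp add: o_def z_def)
  have mem: "- branch \<zeta> k \<in> S_minus z" for k
    using S_minus_branch[OF \<zeta>(1)] by (auto simp: z_def bij_betw_def)
  have kc: "K_kernel x \<tau> \<gamma> (cnj z) (cnj (- branch \<zeta> k)) (cnj (- branch \<zeta> l)) = cnj (?K k l)" for k l
    using cnj_K_kernel[OF z1 mem mem, of x \<tau> \<gamma> k l] K_kernel_branch[OF \<zeta>(1), folded z_def, of x \<tau> \<gamma> k l] by simp
  have "fredholm_det (count_space (S_minus (cnj z))) (K_kernel x \<tau> \<gamma> (cnj z))
     = (\<Sum>n. (-1) ^ n / fact n * fredholm_term (\<lambda>k l. cnj (?K k l)) n)"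
  proof (rule fredholm_det_count_space[where u = "kernel_factor ?N (Re \<zeta>)" and g = "\<lambda>k. cnj (- branch \<zeta> k)"
        and K = "\<lambda>k l. cnj (?K k l)" and S = "S_minus (cnj z)" and L = "K_kernel x \<tau> \<gamma> (cnj z)"])
    show "norm (cnj (?K k l)) \<le> kernel_factor ?N (Re \<zeta>) k * kernel_factor ?N (Re \<zeta>) l" for k l
      by (simp only: complex_mod_cnj kb)
  qed (rule kernel_factor_square(1)[OF N0] bij kc)+
  also have "\<dots> = (\<Sum>n. cnj ((-1) ^ n / fact n * fredholm_term ?K n))"
    by (simp add: cnj_fredholm_term)
  also have "\<dots> = cnj (\<Sum>n. (-1) ^ n / fact n * fredholm_term ?K n)"
  proof (rule bounded_linear.suminf[OF bounded_linear_cnj, symmetric])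
    show "summable (\<lambda>n. (-1) ^ n / fact n * fredholm_term ?K n)"
      by (rule fredholm_series_bound(2)[OF kb kernel_factor_square(1)[OF N0] _ s])
        (simp add: kernel_factor_square(2)[OF N0] fredholm_tail_def)
  qed
  finally show ?thesis unfolding D .
qed

section \<open>Approximation of 1 - F on the saddle circle\<close>

text \<open>The exponent is holomorphic in the disc and vanishes at 0, so the mean value property
  gives exp 0 = 1. The 1 in 1 - F is thereby absorbed into the mean, and only 1 minus the
  determinant remains under it.\<close>

lemma circle_mean_exp_log_weight:
  assumes R: "0 < R" "R < 1"
  shows "circle_mean R (\<lambda>z. exp (log_weight x \<tau> z)) = 1"
proof -
  have "(\<lambda>z. exp (log_weight x \<tau> z)) holomorphic_on cball 0 R"
    using R by (intro holomorphic_intros holomorphic_on_subset[OF holomorphic_log_weight]) auto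
  from Cauchy_integral_circlepath_simple[OF this, of 0] R
  have "((\<lambda>u. exp (log_weight x \<tau> u) / u) has_contour_integral 2 * of_real pi * \<i>) (circlepath 0 R)"
    by (simp add: log_weight_0)
  from has_contour_integral_div[OF this, of "2 * of_real pi * \<i>"]
  have "((\<lambda>u. exp (log_weight x \<tau> u) / (2 * of_real pi * \<i> * u)) has_contour_integral 1) (circlepath 0 R)"
    by (simp add: mult.commute)
  then show ?thesis by (simp add: circle_mean_def contour_integral_unique)
qed

lemma F_per_eq_circle_mean:
  "F_per R x \<tau> \<gamma> = circle_mean R (\<lambda>z. exp (log_weight x \<tau> z) * fredholm_det (count_space (S_minus z)) (K_kernel x \<tau> \<gamma> z))"
  by (simp add: F_per_def circle_mean_def log_weight_def)

lemma circle_mean_diff_le: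
  assumes R: "R > 0" and f: "continuous_on (sphere 0 R) f"
    and g: "(\<lambda>t. g (of_real R * exp (2 * of_real pi * \<i> * complex_of_real t))) integrable_on {0..1}"
    and C: "\<And>t. t \<in> {0..1} \<Longrightarrow> norm (f (of_real R * exp (2 * of_real pi * \<i> * complex_of_real t))
        - g (of_real R * exp (2 * of_real pi * \<i> * complex_of_real t))) \<le> C"
  shows "norm (circle_mean R f - circle_mean R g) \<le> C"
proof -
  define e where "e = (\<lambda>t. of_real R * exp (2 * of_real pi * \<i> * complex_of_real t))"
  have fi: "(\<lambda>t. f (e t)) integrable_on {0..1}"
    unfolding e_def by (intro integrable_continuous_real continuous_on_circle f R)
  have gi: "(\<lambda>t. g (e t)) integrable_on {0..1}" using g by (simp add: e_def)
  have cm: "circle_mean R h = integral {0..1} (\<lambda>t. h (e t))" for h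
    by (simp add: circle_mean_eq_integral[OF R] e_def)
  have "circle_mean R f - circle_mean R g = integral {0..1} (\<lambda>t. f (e t) - g (e t))"
    unfolding cm
    by (rule Henstock_Kurzweil_Integration.integral_diff[OF fi gi, symmetric])
  also have "norm \<dots> \<le> integral {0..1} (\<lambda>t::real. C)"
    by (rule Henstock_Kurzweil_Integration.integral_norm_bound_integral[OF Henstock_Kurzweil_Integration.integrable_diff[OF fi gi]])
      (use C in \<open>auto simp: e_def\<close>)
  finally show ?thesis by simp
qed

text \<open>Everything is taken at \<rho> = x/\<tau>: y bounds the joint exponent of weight and
  \<open>Q\<close>, s is the ratio of the Fredholm series. The first summand is the error of the
  trace, the second that of the higher Fredholm terms.\<close>

definition saddle_error :: "real \<Rightarrow> real \<Rightarrow> real" where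
  "saddle_error \<tau> x = (let \<rho> = x / \<tau>; y = (2 * x + 2 * \<tau> + 2) * exp (- \<rho> / 2) + 2 * tail_bound \<rho>; s = fredholm_tail \<tau> x \<rho>
     in reduced_bound \<tau> x \<rho> * (y * exp y) * weight_sum\<^sup>2 + exp y * (s\<^sup>2 / (1 - s)))"

text \<open>In the coordinate \<rho> = -2 log |z| the annulus reaches from \<rho>1, outside the
  given circle, to 2 x/\<tau>, twice the value on the saddle circle, so the integrand is holomorphic
  between the two circles. On the saddle circle it commutes with conjugation, which makes F
  real.\<close>

lemma F_per_approximation:
  assumes \<tau>: "\<tau> > 0" and x: "x > 0" and half: "exp (- (x / \<tau>) / 2) \<le> 1/2"
    and s: "fredholm_tail \<tau> x (x / \<tau>) < 1"
    and R': "0 < R'" "R' < 1" and \<rho>1: "0 < \<rho>1" "\<rho>1 < x / \<tau>" "exp (- x / \<tau>) < R'" "R' < exp (- \<rho>1 / 2)"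
    and N: "\<And>\<rho>. \<rho>1 < \<rho> \<Longrightarrow> \<rho> < 2 * x / \<tau> \<Longrightarrow> cubic_bound \<tau> x \<rho> * exp (tail_bound \<rho>) \<le> N" "N \<ge> 0"
    and sN: "(N * weight_sum / (2 * \<rho>1))\<^sup>2 < 1"
  shows "norm (1 - F_per R' x \<tau> \<gamma> - circle_mean (exp (- (x / \<tau>) / 2)) (reduced_trace \<tau> x \<gamma>)) \<le> saddle_error \<tau> x"
    and "Im (F_per R' x \<tau> \<gamma>) = 0"
proof -
  define \<rho> R where "\<rho> = x / \<tau>" and "R = exp (- \<rho> / 2)"
  let ?A = "annulus (exp (- (2 * x / \<tau>) / 2)) (exp (- \<rho>1 / 2))"
  let ?D = "\<lambda>z. fredholm_det (count_space (S_minus z)) (K_kernel x \<tau> \<gamma> z)"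
  let ?E = "\<lambda>z. exp (log_weight x \<tau> z)"
  have \<rho>: "\<rho> > 0" using x \<tau> by (simp add: \<rho>_def)
  have R: "0 < R" "R < 1" "R \<le> 1/2" using half \<rho> by (auto simp: R_def \<rho>_def)
  have RA: "exp (- (2 * x / \<tau>) / 2) < R" "R < exp (- \<rho>1 / 2)" using \<rho>1 \<rho> by (auto simp: R_def \<rho>_def)
  have R'A: "exp (- (2 * x / \<tau>) / 2) < R'" using \<rho>1 by simp
  have A1: "?A \<subseteq> ball 0 1"
  proof
    fix z assume "z \<in> ?A"
    then have "norm z < exp (- \<rho>1 / 2)" by (simp add: annulus_def)
    also have "\<dots> \<le> 1" using \<rho>1 by simp
    finally show "z \<in> ball 0 1" by simp
  qed
  have hD: "?D holomorphic_on ?A"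
    by (rule holomorphic_fredholm_det[OF less_imp_le[OF x] \<tau> \<rho>1(1) N(2,1) sN])
  have hE: "?E holomorphic_on ball 0 1" by (intro holomorphic_intros holomorphic_log_weight)
  have hED: "(\<lambda>z. ?E z * ?D z) holomorphic_on ?A"
    by (intro holomorphic_intros hD holomorphic_on_subset[OF hE A1])
  have F: "F_per R' x \<tau> \<gamma> = circle_mean R (\<lambda>z. ?E z * ?D z)"
    unfolding F_per_eq_circle_mean by (rule circle_mean_shift[OF hED _ R'A \<rho>1(4) RA]) simp
  have sA: "sphere 0 R \<subseteq> ?A" using RA by (auto simp: annulus_def)
  have cE: "continuous_on (sphere 0 R) ?E"
    using holomorphic_on_imp_continuous_on[OF hE] by (rule continuous_on_subset) (use R in auto)
  have cED: "continuous_on (sphere 0 R) (\<lambda>z. ?E z * ?D z)"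
    using holomorphic_on_imp_continuous_on[OF hED] sA by (rule continuous_on_subset)
  have "1 - F_per R' x \<tau> \<gamma> = circle_mean R ?E - circle_mean R (\<lambda>z. ?E z * ?D z)"
    unfolding F circle_mean_exp_log_weight[OF R(1,2)] ..
  also have "\<dots> = circle_mean R (\<lambda>z. ?E z - ?E z * ?D z)" by (rule circle_mean_add(2)[OF R(1) cE cED, symmetric])
  finally have 1: "1 - F_per R' x \<tau> \<gamma> = circle_mean R (\<lambda>z. ?E z - ?E z * ?D z)" .
  define Z where "Z = (\<lambda>t. of_real \<rho> - 4 * of_real pi * \<i> * complex_of_real t)"
  have ReZ: "Re (Z t) = \<rho>" for t by (simp add: Z_def)
  have Z2: "Re (Z t) > 0" "\<bar>Im (Z t)\<bar> \<le> 6 * pi" if "t \<in> {0..1}" for t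
    using \<rho> that unfolding Z_def by (simp, intro circle_log_bounds) auto
  have eZ: "of_real R * exp (2 * of_real pi * \<i> * complex_of_real t) = exp (- Z t / 2)" for t
    unfolding R_def Z_def by (rule circle_point)
  have sr: "fredholm_tail \<tau> x (Re (Z t)) < 1" for t using s by (simp add: ReZ \<rho>_def)
  define y where "y = (2 * x + 2 * \<tau> + 2) * R + 2 * tail_bound \<rho>"
  define s where "s = fredholm_tail \<tau> x \<rho>"
  have "norm (circle_mean R (\<lambda>z. ?E z - ?E z * ?D z) - circle_mean R (reduced_trace \<tau> x \<gamma>))
    \<le> reduced_bound \<tau> x \<rho> * (y * exp y) * weight_sum\<^sup>2 + exp y * (s\<^sup>2 / (1 - s))"
  proof (rule circle_mean_diff_le[OF R(1)])
    show "continuous_on (sphere 0 R) (\<lambda>z. ?E z - ?E z * ?D z)" by (rule continuous_on_diff[OF cE cED])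
    show "(\<lambda>t. reduced_trace \<tau> x \<gamma> (of_real R * exp (2 * of_real pi * \<i> * complex_of_real t))) integrable_on {0..1}"
      unfolding R_def by (rule circle_mean_reduced_trace(2)[OF \<rho> less_imp_le[OF x] \<tau>])
    fix t :: real assume t: "t \<in> {0..1}"
    let ?e = "exp (- Z t / 2)" and ?L = "log_weight x \<tau> (exp (- Z t / 2))"
    have ne: "norm ?e = R" by (simp add: ReZ R_def)
    have L: "norm ?L \<le> (2 * x + 2 * \<tau> + 2) * R"
      using norm_log_weight_le[of ?e x \<tau>] R x \<tau> unfolding ne by simp
    have tb: "tail_bound \<rho> \<ge> 0" using \<rho> by (simp add: tail_bound_def)
    let ?y = "norm ?L + 2 * tail_bound \<rho>"
    have y: "0 \<le> ?y" "?y \<le> y" "norm ?L \<le> y" using L tb by (auto simp: y_def)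
    have "norm (exp ?L * (1 - ?D ?e) - reduced_trace \<tau> x \<gamma> ?e)
      \<le> reduced_bound \<tau> x \<rho> * (?y * exp ?y) * weight_sum\<^sup>2 + exp (norm ?L) * (s\<^sup>2 / (1 - s))"
      using fredholm_det_comparison[where \<gamma> = \<gamma> and E = ?L, OF Z2[OF t] less_imp_le[OF x] \<tau> sr] unfolding ReZ s_def .
    also have "\<dots> \<le> reduced_bound \<tau> x \<rho> * (y * exp y) * weight_sum\<^sup>2 + exp y * (s\<^sup>2 / (1 - s))"
      using y assms(4) by (intro add_mono mult_right_mono mult_left_mono mult_mono)
        (auto simp: reduced_bound_def s_def \<rho>_def)
    finally show "norm (?E (of_real R * exp (2 * of_real pi * \<i> * complex_of_real t)) - ?E (of_real R * exp (2 * of_real pi * \<i> * complex_of_real t)) * ?D (of_real R * exp (2 * of_real pi * \<i> * complex_of_real t))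
        - reduced_trace \<tau> x \<gamma> (of_real R * exp (2 * of_real pi * \<i> * complex_of_real t)))
      \<le> reduced_bound \<tau> x \<rho> * (y * exp y) * weight_sum\<^sup>2 + exp y * (s\<^sup>2 / (1 - s))"
      unfolding eZ by (simp only: right_diff_distrib mult_1_right)
  qed
  then show "norm (1 - F_per R' x \<tau> \<gamma> - circle_mean (exp (- (x / \<tau>) / 2)) (reduced_trace \<tau> x \<gamma>)) \<le> saddle_error \<tau> x"
    unfolding 1 saddle_error_def Let_def y_def s_def R_def \<rho>_def .
  show "Im (F_per R' x \<tau> \<gamma>) = 0"
    unfolding F
  proof (rule circle_mean_real[OF R(1) cED])
    fix z :: complex assume z: "norm z = R"
    have z0: "z \<noteq> 0" using z R by auto
    define \<zeta> where "\<zeta> = - 2 * Ln z"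
    have e: "exp (- \<zeta> / 2) = z" using z0 by (simp add: \<zeta>_def)
    have r: "Re \<zeta> = \<rho>" using z0 by (simp add: \<zeta>_def z R_def)
    have i: "\<bar>Im \<zeta>\<bar> \<le> 6 * pi"
      using mpi_less_Im_Ln[OF z0] Im_Ln_le_pi[OF z0] pi_gt_zero by (simp add: \<zeta>_def abs_le_iff)
    have "?D (cnj z) = cnj (?D z)"
      using cnj_fredholm_det[of \<zeta> x \<tau> \<gamma>] \<rho> i x \<tau> assms(4) unfolding r e by (simp add: \<rho>_def)
    moreover have "?E (cnj z) = cnj (?E z)" using cnj_log_weight[of z x \<tau>] z R by (simp add: exp_cnj)
    ultimately show "?E (cnj z) * ?D (cnj z) = cnj (?E z * ?D z)" by simp
  qed
qed

section \<open>The dominant Airy terms\<close>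

text \<open>12 is (2/pi) times 6 pi, the quotient of the constants in \<open>Ai_upper\<close> and
  \<open>Ai_lower\<close>.\<close>

lemma Ai_ratio_le:
  assumes "1 \<le> y" "y \<le> y'"
  shows "Ai y' \<le> 12 * Ai y * exp (- (sqrt y * (y' - y)))"
proof -
  have d: "airy_decay y \<le> 6 * pi * Ai y" using Ai_lower[OF assms(1)] by (simp add: field_simps)
  have "Ai y' \<le> 2 / pi * airy_decay y'" using assms by (intro Ai_upper) auto
  also have "\<dots> \<le> 2 / pi * (airy_decay y * exp (- sqrt y * (y' - y)))"
    using airy_decay_mono[OF assms] by (intro mult_left_mono) auto
  also have "\<dots> \<le> 2 / pi * (6 * pi * Ai y * exp (- sqrt y * (y' - y)))"
    using d by (intro mult_left_mono mult_right_mono) auto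
  finally show ?thesis by simp
qed

text \<open>One factor q is kept as the small parameter; the other n - 1 are at most 1/2 each and
  are traded for the summable weight, since 1 + n^2 is at most 4 times 2^(n - 1).\<close>

lemma power_le_weight:
  fixes q :: real
  assumes q: "0 \<le> q" "q \<le> 1/2" and n: "n \<ge> 1"
  shows "q ^ n \<le> 4 * q * weight (int n)"
proof -
  have *: "1 + (real (Suc m))\<^sup>2 \<le> 4 * 2 ^ m" for m
  proof (induction m)
    case (Suc m)
    show ?case
    proof (cases "m \<le> 1")
      case True
      then show ?thesis by (cases m) (auto simp: numeral_2_eq_2)
    next
      case False
      then have "2 * 2 \<le> real m * real m" by (intro mult_mono) auto
      then have "1 + (real (Suc (Suc m)))\<^sup>2 \<le> 2 * (1 + (real (Suc m))\<^sup>2)"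
        by (simp add: power2_eq_square algebra_simps)
      then show ?thesis using Suc.IH by simp
    qed
  qed simp
  obtain m where m: "n = Suc m" using n by (cases n) auto
  have "q ^ m \<le> (1/2) ^ m" using q by (intro power_mono)
  also have "\<dots> = 1 / 2 ^ m" by (simp add: power_divide)
  also have "\<dots> \<le> 4 * weight (int n)"
  proof -
    have "0 < 1 + (real n)\<^sup>2" by (auto intro: add_pos_nonneg)
    then show ?thesis using *[of m] by (simp add: weight_def m divide_simps)
  qed
  finally have "q * q ^ m \<le> q * (4 * weight (int n))" using q by (intro mult_left_mono)
  then show ?thesis by (simp add: m mult_ac)
qed

text \<open>Rescaling v by \<kappa> multiplies v dv by \<kappa>^2, which the squared factor
  1/\<kappa> cancels.\<close>

lemma airy_trace_scale:
  assumes \<kappa>: "\<kappa> > 0" and y: "y \<ge> 1"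
  shows "has_bochner_integral pos_lborel (\<lambda>v. v * (Ai (y + v / \<kappa>) / \<kappa>)\<^sup>2) (airy_trace y)"
proof -
  let ?f = "\<lambda>v. indicator {0<..} v *\<^sub>R (v * (Ai (y + v))\<^sup>2)"
  have "has_bochner_integral pos_lborel (\<lambda>v. v * (Ai (y + v))\<^sup>2) (airy_trace y)"
    using integrable_airy_trace[OF y] by (simp add: has_bochner_integral_iff airy_trace_def)
  then have f: "has_bochner_integral lborel ?f (airy_trace y)"
    by (subst (asm) has_bochner_integral_restrict_space) auto
  have "has_bochner_integral lborel (\<lambda>v. ?f (0 + (1 / \<kappa>) * v)) (airy_trace y /\<^sub>R \<bar>1 / \<kappa>\<bar>)"
    using lborel_has_bochner_integral_real_affine_iff[of "1 / \<kappa>" ?f "airy_trace y" 0] f \<kappa> by simp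
  then have "has_bochner_integral lborel (\<lambda>v. (1 / \<kappa>) * ?f (0 + (1 / \<kappa>) * v)) ((1 / \<kappa>) * (airy_trace y /\<^sub>R \<bar>1 / \<kappa>\<bar>))"
    by (rule has_bochner_integral_mult_right)
  also have "(1 / \<kappa>) * (airy_trace y /\<^sub>R \<bar>1 / \<kappa>\<bar>) = airy_trace y" using \<kappa> by simp
  also have "(\<lambda>v. (1 / \<kappa>) * ?f (0 + (1 / \<kappa>) * v)) = (\<lambda>v. indicator {0<..} v *\<^sub>R (v * (Ai (y + v / \<kappa>) / \<kappa>)\<^sup>2))"
    using \<kappa> by (auto simp: fun_eq_iff indicator_def power2_eq_square zero_less_divide_iff)
  finally show ?thesis by (subst has_bochner_integral_restrict_space) auto
qed

section \<open>Separation of y_0 from the other y_m\<close>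

text \<open>For -1/2 < \<gamma> \<le> 1/2 these are the m with (\<gamma> - m)^2 = \<gamma>^2, that
  is m (m - 2 \<gamma>) = 0. Their number is the factor in front of the tail.\<close>

definition exceptional_shifts :: "real \<Rightarrow> int set" where
  "exceptional_shifts \<gamma> = (if \<gamma> = 1/2 then {0, 1} else {0})"

text \<open>The slope in a linear lower bound for (\<gamma> - m)^2 - \<gamma>^2 over the other m. It
  tends to 0 as |\<gamma>| approaches 1/2 from below, whereas at \<gamma> = 1/2 itself m = 1 has
  joined the leading terms and the slope is 1.\<close>

definition shift_gap :: "real \<Rightarrow> real" where
  "shift_gap \<gamma> = (if \<gamma> = 1/2 then 1 else 1 - 2 * \<bar>\<gamma>\<bar>)"

lemma shift_gap_le:
  assumes \<gamma>: "-1/2 < \<gamma>" "\<gamma> \<le> 1/2" and m: "m \<notin> exceptional_shifts \<gamma>"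
  shows "shift_gap \<gamma> * real_of_int \<bar>m\<bar> \<le> (\<gamma> - of_int m)\<^sup>2 - \<gamma>\<^sup>2"
proof -
  define M where "M = real_of_int m"
  have e: "(\<gamma> - of_int m)\<^sup>2 - \<gamma>\<^sup>2 = M * M - 2 * \<gamma> * M" by (simp add: M_def power2_eq_square algebra_simps)
  have a: "real_of_int \<bar>m\<bar> = \<bar>M\<bar>" by (simp add: M_def)
  show ?thesis
  proof (cases "\<gamma> = 1/2")
    case True
    then have "m \<le> - 1 \<or> m \<ge> 2" using m by (auto simp: exceptional_shifts_def)
    then have "M \<le> - 1 \<or> M \<ge> 2" by (auto simp: M_def)
    then have "\<bar>M\<bar> \<le> M * M - M"
    proof
      assume "M \<le> - 1"
      then show ?thesis using zero_le_square[of M] by simp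
    next
      assume M: "2 \<le> M"
      then have "2 * M \<le> M * M" by (intro mult_right_mono) auto
      then show ?thesis using M by simp
    qed
    moreover have "2 * \<gamma> * M = M" using True by simp
    moreover have "shift_gap \<gamma> * \<bar>M\<bar> = \<bar>M\<bar>" using True by (simp add: shift_gap_def)
    ultimately show ?thesis unfolding e a by linarith
  next
    case False
    then have "m \<noteq> 0" using m by (auto simp: exceptional_shifts_def)
    then have M: "1 \<le> \<bar>M\<bar>" by (simp add: M_def)
    have "\<bar>M\<bar> * (1 - 2 * \<bar>\<gamma>\<bar>) \<le> \<bar>M\<bar> * (\<bar>M\<bar> - 2 * \<bar>\<gamma>\<bar>)" using M by (intro mult_left_mono) auto
    also have "\<dots> = M * M - 2 * \<bar>\<gamma> * M\<bar>" by (simp add: abs_mult algebra_simps)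
    also have "\<dots> \<le> M * M - 2 * \<gamma> * M" using abs_ge_self[of "\<gamma> * M"] by simp
    finally show ?thesis unfolding e a using False by (simp add: shift_gap_def mult.commute)
  qed
qed

lemma shift_gap_pos: "-1/2 < \<gamma> \<Longrightarrow> \<gamma> \<le> 1/2 \<Longrightarrow> shift_gap \<gamma> > 0"
  by (auto simp: shift_gap_def)

context
  fixes \<tau> \<gamma> \<kappa> :: real
  assumes \<tau>: "\<tau> > 0" and \<gamma>: "-1/2 < \<gamma>" "\<gamma> \<le> 1/2" and \<kappa>_eq: "\<kappa> = \<tau> powr (1/3)"
begin

lemma \<kappa>_pos: "\<kappa> > 0" using \<tau> by (simp add: \<kappa>_eq)

text \<open>By \<open>shift_gap_le\<close>, y_m exceeds y_0 by at least \<open>shift_gap\<close> *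
  |m|/(4 \<tau> \<kappa>), so the squared Airy ratio is at most 144 q^|m|; squaring turns the 4 into
  the 2 inside q. The factor 4 of \<open>power_le_weight\<close> gives 576. Since q is formed with x
  and not with X, the bound is uniform in X \<ge> x.\<close>

lemma circle_mean_theta_approximation:
  assumes \<rho>: "\<rho> > 0" and x: "0 \<le> x" "x \<le> X" and X: "X \<ge> \<kappa>"
    and q_def: "q = exp (- (shift_gap \<gamma> / (2 * \<tau> * \<kappa>) * sqrt (x / \<kappa>)))" and q: "q \<le> 1/2"
  defines "a \<equiv> (Ai ((X + (\<gamma> / 2)\<^sup>2 / \<tau>) / \<kappa>) / \<kappa>)\<^sup>2"
  shows "norm (circle_mean (exp (- \<rho> / 2)) (\<lambda>z. theta \<tau> X (\<gamma> / 2) z * theta \<tau> X (- \<gamma> / 2) z)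
      - of_real (real (card (exceptional_shifts \<gamma>)) * a)) \<le> 576 * weight_sum * q * a"
proof -
  let ?J = "circle_mean (exp (- \<rho> / 2)) (\<lambda>z. theta \<tau> X (\<gamma> / 2) z * theta \<tau> X (- \<gamma> / 2) z)"
  define Y where "Y = (\<lambda>m::int. (X + ((\<gamma> - of_int m) / 2)\<^sup>2 / \<tau>) / \<kappa>)"
  define A where "A = (\<lambda>m. (Ai (Y m) / \<kappa>)\<^sup>2)"
  define Y0 where "Y0 = (X + (\<gamma> / 2)\<^sup>2 / \<tau>) / \<kappa>"
  let ?M = "exceptional_shifts \<gamma>"
  have a: "a = (Ai Y0 / \<kappa>)\<^sup>2" by (simp add: a_def Y0_def)
  have fM: "finite ?M" by (simp add: exceptional_shifts_def)
  have Xx: "X \<ge> \<tau> powr (1/3)" using X by (simp add: \<kappa>_eq)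
  have hs: "(A has_sum Re ?J) UNIV" and im: "Im ?J = 0"
    using circle_mean_theta[OF \<rho> \<tau> Xx, of \<gamma>] unfolding A_def Y_def \<kappa>_eq by auto
  have Y01: "1 \<le> Y0" and Y0x: "x / \<kappa> \<le> Y0"
  proof -
    have "0 \<le> (\<gamma> / 2)\<^sup>2 / \<tau>" using \<tau> by simp
    then have "X / \<kappa> \<le> Y0" unfolding Y0_def using \<kappa>_pos by (intro divide_right_mono) auto
    moreover have "1 \<le> X / \<kappa>" using X \<kappa>_pos by simp
    moreover have "x / \<kappa> \<le> X / \<kappa>" using x \<kappa>_pos by (intro divide_right_mono) auto
    ultimately show "1 \<le> Y0" "x / \<kappa> \<le> Y0" by linarith+
  qed
  have YY: "Y m - Y0 = ((\<gamma> - of_int m)\<^sup>2 - \<gamma>\<^sup>2) / (4 * \<tau> * \<kappa>)" for m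
    using \<tau> \<kappa>_pos by (simp add: Y_def Y0_def power_divide field_simps)
  have A0: "A m = a" if "m \<in> ?M" for m
  proof -
    have "m = 0 \<or> m = 1 \<and> \<gamma> = 1/2" using that by (auto simp: exceptional_shifts_def split: if_splits)
    then have "real_of_int m * (real_of_int m - 2 * \<gamma>) = 0" by auto
    then have "(\<gamma> - of_int m)\<^sup>2 = \<gamma>\<^sup>2" by (simp add: power2_eq_square algebra_simps)
    then have "Y m = Y0" using YY[of m] by simp
    then show ?thesis by (simp add: A_def a)
  qed
  have q0: "q > 0" by (simp add: q_def)
  have small: "A m \<le> 576 * q * a * weight m" if m: "m \<notin> ?M" for m
  proof -
    define n where "n = nat \<bar>m\<bar>"
    have m0: "m \<noteq> 0" using m by (auto simp: exceptional_shifts_def split: if_splits)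
    have n1: "n \<ge> 1" using m0 by (simp add: n_def)
    have g: "shift_gap \<gamma> * real n \<le> (\<gamma> - of_int m)\<^sup>2 - \<gamma>\<^sup>2" using shift_gap_le[OF \<gamma> m] by (simp add: n_def)
    have d: "shift_gap \<gamma> * real n / (4 * \<tau> * \<kappa>) \<le> Y m - Y0"
      unfolding YY using g \<tau> \<kappa>_pos by (intro divide_right_mono) auto
    have "0 \<le> shift_gap \<gamma> * real n / (4 * \<tau> * \<kappa>)" using shift_gap_pos[OF \<gamma>] \<tau> \<kappa>_pos by simp
    with d have YM: "Y0 \<le> Y m" by linarith
    have "sqrt (x / \<kappa>) * (shift_gap \<gamma> * real n / (4 * \<tau> * \<kappa>)) \<le> sqrt Y0 * (Y m - Y0)"
      using d Y0x x \<kappa>_pos \<tau> shift_gap_pos[OF \<gamma>] YM Y01 by (intro mult_mono) auto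
    then have "2 * (- (sqrt Y0 * (Y m - Y0))) \<le> real n * (- (shift_gap \<gamma> / (2 * \<tau> * \<kappa>) * sqrt (x / \<kappa>)))"
      by (simp add: field_simps)
    then have e: "(exp (- (sqrt Y0 * (Y m - Y0))))\<^sup>2 \<le> q ^ n"
      unfolding q_def exp_of_nat_mult[symmetric] exp_double[symmetric] by (simp only: exp_le_cancel_iff)
    have "Ai (Y m) \<le> 12 * Ai Y0 * exp (- (sqrt Y0 * (Y m - Y0)))" by (rule Ai_ratio_le[OF Y01 YM])
    moreover have "0 \<le> Ai (Y m)" using Ai_pos[of "Y m"] YM Y01 by simp
    ultimately have "(Ai (Y m))\<^sup>2 \<le> (12 * Ai Y0 * exp (- (sqrt Y0 * (Y m - Y0))))\<^sup>2" by (intro power_mono)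
    also have "\<dots> = 144 * (Ai Y0)\<^sup>2 * (exp (- (sqrt Y0 * (Y m - Y0))))\<^sup>2" by (simp add: power_mult_distrib)
    also have "\<dots> \<le> 144 * (Ai Y0)\<^sup>2 * q ^ n" using e by (intro mult_left_mono) auto
    also have "\<dots> \<le> 144 * (Ai Y0)\<^sup>2 * (4 * q * weight (int n))"
      using power_le_weight[OF _ q n1] q0 by (intro mult_left_mono) auto
    also have "weight (int n) = weight m" by (simp add: weight_def n_def)
    finally have "(Ai (Y m))\<^sup>2 / \<kappa>\<^sup>2 \<le> 144 * (Ai Y0)\<^sup>2 * (4 * q * weight m) / \<kappa>\<^sup>2" by (intro divide_right_mono) auto
    then show ?thesis by (simp add: A_def a power_divide mult_ac)
  qed
  have s1: "(A has_sum sum A ?M) ?M" by (rule has_sum_finite[OF fM])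
  have "(A has_sum (Re ?J - sum A ?M)) (UNIV - ?M)" by (rule has_sum_Diff[OF hs s1]) auto
  then have r: "(A has_sum (Re ?J - real (card ?M) * a)) (UNIV - ?M)" using A0 by simp
  have "0 \<le> Re ?J - real (card ?M) * a"
    by (rule has_sum_nonneg[OF r]) (simp add: A_def)
  moreover have "Re ?J - real (card ?M) * a \<le> 576 * q * a * weight_sum"
  proof -
    have w: "((\<lambda>m. 576 * q * a * weight m) has_sum (576 * q * a * weight_sum)) UNIV"
      unfolding weight_sum_def by (intro has_sum_cmult_right has_sum_infsum summable_on_weight)
    have "0 \<le> 576 * q * a * weight m" for m
      using q0 weight_pos[of m] unfolding a by (intro mult_nonneg_nonneg) (auto simp del: zero_le_power2 intro: zero_le_power2)
    then show ?thesis by (intro has_sum_mono_neutral[OF r w]) (use small in auto)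
  qed
  moreover have "?J - of_real (real (card ?M) * a) = of_real (Re ?J - real (card ?M) * a)"
    using im by (simp add: complex_eq_iff)
  then have "norm (?J - of_real (real (card ?M) * a)) = \<bar>Re ?J - real (card ?M) * a\<bar>" by (simp only: norm_of_real)
  ultimately show ?thesis by (simp add: mult_ac)
qed

text \<open>Integrates the pointwise comparison at X = x + v against v. The same q serves for all v,
  so the error is again a multiple of \<open>airy_trace y\<close>.\<close>

lemma reduced_trace_approximation:
  assumes x: "x > 0" "x \<ge> \<kappa>"
    and q_def: "q = exp (- (shift_gap \<gamma> / (2 * \<tau> * \<kappa>) * sqrt (x / \<kappa>)))" and q: "q \<le> 1/2"
  defines "y \<equiv> (x + (\<gamma> / 2)\<^sup>2 / \<tau>) / \<kappa>"
  shows "norm (circle_mean (exp (- (x / \<tau>) / 2)) (reduced_trace \<tau> x \<gamma>) - of_real (real (card (exceptional_shifts \<gamma>)) * airy_trace y))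
      \<le> 576 * weight_sum * q * airy_trace y"
proof -
  let ?R = "exp (- (x / \<tau>) / 2)" and ?n = "real (card (exceptional_shifts \<gamma>))"
  let ?J = "\<lambda>v. circle_mean ?R (\<lambda>z. theta \<tau> (x + v) (\<gamma> / 2) z * theta \<tau> (x + v) (- \<gamma> / 2) z)"
  let ?a = "\<lambda>v. v * (Ai (y + v / \<kappa>) / \<kappa>)\<^sup>2"
  have \<rho>: "x / \<tau> > 0" using x \<tau> by simp
  have y1: "y \<ge> 1"
  proof -
    have "0 \<le> (\<gamma> / 2)\<^sup>2 / \<tau>" using \<tau> by simp
    then have "\<kappa> \<le> x + (\<gamma> / 2)\<^sup>2 / \<tau>" using x by simp
    then show ?thesis using \<kappa>_pos by (simp add: y_def)
  qed
  have T: "has_bochner_integral pos_lborel ?a (airy_trace y)" by (rule airy_trace_scale[OF \<kappa>_pos y1])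
  have Tc: "has_bochner_integral pos_lborel (\<lambda>v. complex_of_real (?n * ?a v)) (of_real (?n * airy_trace y))"
    by (intro has_bochner_integral_of_real has_bochner_integral_mult_right T)
  have Tc1: "integrable pos_lborel (\<lambda>v. complex_of_real (?n * ?a v))"
    and Tc2: "(\<integral>v. complex_of_real (?n * ?a v) \<partial>pos_lborel) = of_real (?n * airy_trace y)"
    using Tc unfolding has_bochner_integral_iff by blast+
  have m: "circle_mean ?R (reduced_trace \<tau> x \<gamma>) = (\<integral>v. of_real v * ?J v \<partial>pos_lborel)"
    and i: "integrable pos_lborel (\<lambda>v. of_real v * ?J v)"
    using circle_mean_reduced_trace(1,3)[OF \<rho> less_imp_le[OF x(1)] \<tau>] by auto
  have "(\<integral>v. (576 * weight_sum * q) * ?a v \<partial>pos_lborel) = 576 * weight_sum * q * airy_trace y"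
    using has_bochner_integral_mult_right[OF T, of "576 * weight_sum * q"] by (simp only: has_bochner_integral_iff)
  moreover have "circle_mean ?R (reduced_trace \<tau> x \<gamma>) - of_real (?n * airy_trace y) = (\<integral>v. of_real v * ?J v - of_real (?n * ?a v) \<partial>pos_lborel)"
    unfolding m Tc2[symmetric] by (rule Bochner_Integration.integral_diff[OF i Tc1, symmetric])
  moreover have "norm (\<integral>v. of_real v * ?J v - of_real (?n * ?a v) \<partial>pos_lborel) \<le> (\<integral>v. (576 * weight_sum * q) * ?a v \<partial>pos_lborel)"
  proof (rule norm_integral_le)
    show "integrable pos_lborel (\<lambda>v. (576 * weight_sum * q) * ?a v)"
      using T by (intro integrable_mult_right) (simp add: has_bochner_integral_iff)
    fix v assume "v \<in> space pos_lborel"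
    then have v: "v > 0" by (auto simp: space_restrict_space)
    have yv: "(x + v + (\<gamma> / 2)\<^sup>2 / \<tau>) / \<kappa> = y + v / \<kappa>" by (simp add: y_def add_divide_distrib)
    have "norm (?J v - of_real (?n * (Ai (y + v / \<kappa>) / \<kappa>)\<^sup>2)) \<le> 576 * weight_sum * q * (Ai (y + v / \<kappa>) / \<kappa>)\<^sup>2"
      using circle_mean_theta_approximation[OF \<rho> less_imp_le[OF x(1)] _ _ q_def q, of "x + v"] x v unfolding yv by simp
    then have "v * norm (?J v - of_real (?n * (Ai (y + v / \<kappa>) / \<kappa>)\<^sup>2)) \<le> v * (576 * weight_sum * q * (Ai (y + v / \<kappa>) / \<kappa>)\<^sup>2)"
      using v by (intro mult_left_mono) auto
    moreover have "of_real v * ?J v - of_real (?n * ?a v) = of_real v * (?J v - of_real (?n * (Ai (y + v / \<kappa>) / \<kappa>)\<^sup>2))"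
      by (simp add: algebra_simps)
    ultimately show "norm (of_real v * ?J v - of_real (?n * ?a v)) \<le> (576 * weight_sum * q) * ?a v"
      using v by (simp only: norm_mult norm_of_real abs_of_pos) (simp add: mult_ac)
  qed
  ultimately show ?thesis by (simp only:)
qed

end

section \<open>Asymptotics of the error terms\<close>

lemma airy_decay_squared: "0 \<le> y \<Longrightarrow> (airy_decay y)\<^sup>2 = exp (- (4/3) * sqrt y ^ 3) / sqrt y"
  by (simp add: airy_decay_def power_divide exp_double[symmetric])

lemma cubic_bound_saddle:
  assumes "\<tau> > 0" "x \<ge> 0"
  shows "cubic_bound \<tau> x (x / \<tau>) = 6 * (2 + 576 / \<tau>\<^sup>2) * (1 + x / \<tau>) * exp (- (2/3) * (x * sqrt (x / \<tau>)))"
proof -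
  have "\<tau> * sqrt (x / \<tau>) ^ 3 = \<tau> * (sqrt (x / \<tau>))\<^sup>2 * sqrt (x / \<tau>)" by (simp add: power3_eq_cube power2_eq_square)
  also have "\<dots> = x * sqrt (x / \<tau>)" using assms by simp
  finally have "\<tau> * sqrt (x / \<tau>) ^ 3 / 3 - sqrt (x / \<tau>) * x = - (2/3) * (x * sqrt (x / \<tau>))" by (simp add: algebra_simps)
  then show ?thesis unfolding cubic_bound_def by (simp only:)
qed

lemma tail_bound_antimono:
  assumes "0 < \<rho>" "\<rho> \<le> \<rho>'"
  shows "tail_bound \<rho>' \<le> tail_bound \<rho>"
  unfolding tail_bound_def using assms by (intro frac_le mult_left_mono diff_left_mono) auto

text \<open>For \<rho> < 2 x/\<tau> the exponent sqrt \<rho> (\<tau> \<rho>/3 - x) is at most -sqrt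
  \<rho> x/3; it would change sign only at 3 x/\<tau>. The kernel is thus exponentially small in x
  on the whole annulus.\<close>

lemma cubic_bound_uniform:
  assumes \<tau>: "\<tau> > 0" and \<rho>: "0 < \<rho>1" "\<rho>1 < \<rho>" "\<rho> < 2 * x / \<tau>"
  shows "cubic_bound \<tau> x \<rho> * exp (tail_bound \<rho>)
    \<le> 6 * (2 + 576 / \<tau>\<^sup>2) * (1 + 2 * x / \<tau>) * exp (- (sqrt \<rho>1 * x / 3)) * exp (tail_bound \<rho>1)"
proof -
  have \<tau>\<rho>: "\<tau> * \<rho> \<le> 2 * x" and x: "x > 0"
  proof -
    have "0 < 2 * x / \<tau>" using \<rho> by linarith
    then show "x > 0" using \<tau> by (simp add: zero_less_divide_iff)
    show "\<tau> * \<rho> \<le> 2 * x" using \<rho> \<tau> by (simp add: field_simps)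
  qed
  have "sqrt \<rho> ^ 3 = \<rho> * sqrt \<rho>" using \<rho> by (simp add: power3_eq_cube)
  then have "\<tau> * sqrt \<rho> ^ 3 / 3 - sqrt \<rho> * x = sqrt \<rho> * (\<tau> * \<rho> / 3 - x)" by (simp add: algebra_simps)
  also have "\<dots> \<le> sqrt \<rho> * (- (x / 3))" using \<tau>\<rho> \<rho> by (intro mult_left_mono) auto
  also have "\<dots> \<le> - (sqrt \<rho>1 * x / 3)" using \<rho> x by simp
  finally have "\<tau> * sqrt \<rho> ^ 3 / 3 - sqrt \<rho> * x \<le> - (sqrt \<rho>1 * x / 3)" .
  then show ?thesis
    unfolding cubic_bound_def using \<rho> x \<tau> tail_bound_antimono[of \<rho>1 \<rho>]
    by (intro mult_mono mult_nonneg_nonneg add_nonneg_nonneg) auto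
qed

lemma eventually_F_per_approximation:
  assumes \<tau>: "\<tau> > 0" and R: "0 < R" "R < 1"
  shows "\<forall>\<^sub>F x in at_top. norm (1 - F_per R x \<tau> \<gamma> - circle_mean (exp (- (x / \<tau>) / 2)) (reduced_trace \<tau> x \<gamma>)) \<le> saddle_error \<tau> x
    \<and> Im (F_per R x \<tau> \<gamma>) = 0"
proof -
  \<comment> \<open>R = exp(-\<rho>1) lies strictly inside the outer radius exp(-\<rho>1/2) of the
    annulus.\<close>
  define \<rho>1 where "\<rho>1 = - ln R"
  define c0 where "c0 = 6 * (2 + 576 / \<tau>\<^sup>2)"
  define C where "C = exp (tail_bound \<rho>1)"
  define a where "a = sqrt \<rho>1 / 3"
  define w where "w = weight_sum"
  define N where "N = (\<lambda>x. c0 * (1 + 2 * x / \<tau>) * exp (- (a * x)) * C)"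
  have \<rho>1: "\<rho>1 > 0" using R by (simp add: \<rho>1_def)
  have c: "c0 > 0" "C > 0" "a > 0" "w > 0"
    using \<tau> \<rho>1 weight_sum_pos by (auto simp: c0_def C_def a_def w_def intro!: add_pos_nonneg)
  have "R = exp (- \<rho>1)" using R by (simp add: \<rho>1_def)
  also have "\<dots> < exp (- \<rho>1 / 2)" using \<rho>1 by simp
  finally have R\<rho>: "R < exp (- \<rho>1 / 2)" .
  have ev1: "\<forall>\<^sub>F x in at_top. exp (- (x / \<tau>) / 2) < 1/2" using \<tau> by real_asymp
  have ev2: "\<forall>\<^sub>F x in at_top. \<rho>1 < x / \<tau>" using \<tau> by real_asymp
  have ev3: "\<forall>\<^sub>F x in at_top. exp (- x / \<tau>) < R" using \<tau> R by real_asymp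
  have ev4: "\<forall>\<^sub>F x in at_top. (N x * w / (2 * \<rho>1))\<^sup>2 < 1" unfolding N_def using \<tau> c \<rho>1 by real_asymp
  have ev5: "\<forall>\<^sub>F x in at_top. (c0 * (1 + x / \<tau>) * exp (- (2/3) * (x * sqrt (x / \<tau>)))
      * exp (2 * exp (- (x / \<tau>) / 2) / (1 - exp (- (x / \<tau>) / 2))) * w / (2 * (x / \<tau>)))\<^sup>2 < 1"
    using \<tau> c by real_asymp
  show ?thesis using ev1 ev2 ev3 ev4 ev5 eventually_gt_at_top[of 0]
  proof eventually_elim
    case (elim x)
    have s: "fredholm_tail \<tau> x (x / \<tau>) < 1"
      unfolding fredholm_tail_def cubic_bound_saddle[OF \<tau> less_imp_le[OF elim(6)]] tail_bound_def
      using elim(5) unfolding c0_def w_def by (simp only: minus_divide_left)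
    have N: "cubic_bound \<tau> x \<rho> * exp (tail_bound \<rho>) \<le> N x" if "\<rho>1 < \<rho>" "\<rho> < 2 * x / \<tau>" for \<rho>
      using cubic_bound_uniform[OF \<tau> \<rho>1 that] by (simp add: N_def c0_def C_def a_def)
    have N0: "0 \<le> N x" using c elim(6) \<tau> by (auto simp: N_def intro!: mult_nonneg_nonneg add_nonneg_nonneg)
    note F = F_per_approximation[OF \<tau> elim(6) less_imp_le[OF elim(1)] s R \<rho>1 elim(2,3) R\<rho> N N0 elim(4)[unfolded w_def]]
    show ?case using F by blast
  qed
qed

lemma powr_third_cubed: "\<tau> > 0 \<Longrightarrow> (\<tau> powr (1/3)) ^ 3 = (\<tau>::real)"
  by (simp add: powr_power)

text \<open>Up to powers of s the numerator is exp(-(4/3) s^3 - \<mu> s^2), the Fredholm part being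
  of order exp(-(8/3) s^3), while the denominator is exp(-(4/3) s^3 - 2 \<beta> s). The quadratic
  gain beats the linear loss, so any rate d is allowed.\<close>

lemma saddle_error_profile_bigo:
  fixes a b c0 d w \<beta> \<mu> :: real
  assumes "a > 0" "b > 0" "c0 > 0" "d > 0" "w > 0" "\<beta> > 0" "\<mu> > 0"
  shows "(\<lambda>s::real. 
    let C = c0 * (1 + 2 * \<mu> * s\<^sup>2) * exp (- (2/3) * s ^ 3);
        t = 2 * exp (- \<mu> * s\<^sup>2) / (1 - exp (- \<mu> * s\<^sup>2));
        y = (a * s\<^sup>2 + b) * exp (- \<mu> * s\<^sup>2) + 2 * t;
        f = (C * exp t * w / (2 * (2 * \<mu> * s\<^sup>2)))\<^sup>2 in
    (C\<^sup>2 / (4 * (2 * \<mu> * s\<^sup>2)\<^sup>2) * (y * exp y) * w\<^sup>2 + exp y * (f\<^sup>2 / (1 - f)))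
     / (exp (- (4/3) * sqrt (s\<^sup>2 + \<beta>) ^ 3) / sqrt (s\<^sup>2 + \<beta>) / 400)) \<in> O[at_top](\<lambda>s. exp (- d * s))"
  using assms unfolding Let_def by real_asymp

text \<open>With x = \<kappa> s^2 and \<tau> = \<kappa>^3 one has x/\<tau> = (s/\<kappa>)^2 and x
  sqrt (x/\<tau>) = s^3, which brings the saddle error into the form of the profile with \<mu> =
  1/(2 \<kappa>^2).\<close>

lemma saddle_error_bigo:
  assumes \<tau>: "\<tau> > 0" and \<kappa>: "\<kappa> = \<tau> powr (1/3)" and \<beta>: "\<beta> > 0" and d: "d > 0"
  shows "(\<lambda>s. saddle_error \<tau> (\<kappa> * s\<^sup>2) / ((airy_decay (s\<^sup>2 + \<beta>))\<^sup>2 / 400)) \<in> O[at_top](\<lambda>s. exp (- d * s))"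
proof -
  define \<mu> a b c0 w where "\<mu> = 1 / (2 * \<kappa>\<^sup>2)" and "a = 2 * \<kappa>" and "b = 2 * \<tau> + 2"
    and "c0 = 6 * (2 + 576 / \<tau>\<^sup>2)" and "w = weight_sum"
  let ?H = "\<lambda>s::real. let C = c0 * (1 + 2 * \<mu> * s\<^sup>2) * exp (- (2/3) * s ^ 3);
        t = 2 * exp (- \<mu> * s\<^sup>2) / (1 - exp (- \<mu> * s\<^sup>2));
        y = (a * s\<^sup>2 + b) * exp (- \<mu> * s\<^sup>2) + 2 * t;
        f = (C * exp t * w / (2 * (2 * \<mu> * s\<^sup>2)))\<^sup>2 in
    (C\<^sup>2 / (4 * (2 * \<mu> * s\<^sup>2)\<^sup>2) * (y * exp y) * w\<^sup>2 + exp y * (f\<^sup>2 / (1 - f)))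
     / (exp (- (4/3) * sqrt (s\<^sup>2 + \<beta>) ^ 3) / sqrt (s\<^sup>2 + \<beta>) / 400)"
  have \<kappa>0: "\<kappa> > 0" and \<kappa>3: "\<kappa> ^ 3 = \<tau>" using \<tau> powr_third_cubed[OF \<tau>] by (simp_all add: \<kappa>)
  have c: "\<mu> > 0" "a > 0" "b > 0" "c0 > 0" "w > 0"
    using \<tau> \<kappa>0 weight_sum_pos by (auto simp: \<mu>_def a_def b_def c0_def w_def intro!: add_pos_nonneg)
  have "?H \<in> O[at_top](\<lambda>s. exp (- d * s))"
    by (rule saddle_error_profile_bigo) (use c \<beta> d in auto)
  moreover have "\<forall>\<^sub>F s in at_top. saddle_error \<tau> (\<kappa> * s\<^sup>2) / ((airy_decay (s\<^sup>2 + \<beta>))\<^sup>2 / 400) = ?H s"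
    using eventually_gt_at_top[of 0]
  proof eventually_elim
    case (elim s)
    have r: "\<kappa> * s\<^sup>2 / \<tau> = 2 * \<mu> * s\<^sup>2" and r': "- (\<kappa> * s\<^sup>2 / \<tau>) / 2 = - \<mu> * s\<^sup>2"
      using \<kappa>0 by (simp_all add: \<mu>_def \<kappa>3[symmetric] power3_eq_cube power2_eq_square)
    have "\<kappa> * s\<^sup>2 / \<tau> = (s / \<kappa>)\<^sup>2" using \<kappa>0 by (simp add: \<kappa>3[symmetric] power3_eq_cube power2_eq_square)
    then have "sqrt (\<kappa> * s\<^sup>2 / \<tau>) = s / \<kappa>" using \<kappa>0 elim by simp
    then have e: "\<kappa> * s\<^sup>2 * sqrt (\<kappa> * s\<^sup>2 / \<tau>) = s ^ 3" using \<kappa>0 by (simp add: power3_eq_cube power2_eq_square)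
    have "0 \<le> \<kappa> * s\<^sup>2" "0 \<le> s\<^sup>2 + \<beta>" using \<kappa>0 \<beta> by auto
    then have C: "cubic_bound \<tau> (\<kappa> * s\<^sup>2) (\<kappa> * s\<^sup>2 / \<tau>) = c0 * (1 + 2 * \<mu> * s\<^sup>2) * exp (- (2/3) * s ^ 3)"
      and D: "(airy_decay (s\<^sup>2 + \<beta>))\<^sup>2 = exp (- (4/3) * sqrt (s\<^sup>2 + \<beta>) ^ 3) / sqrt (s\<^sup>2 + \<beta>)"
      using cubic_bound_saddle[OF \<tau>, of "\<kappa> * s\<^sup>2"] airy_decay_squared[of "s\<^sup>2 + \<beta>"] unfolding e unfolding r c0_def by auto
    have t: "tail_bound (\<kappa> * s\<^sup>2 / \<tau>) = 2 * exp (- \<mu> * s\<^sup>2) / (1 - exp (- \<mu> * s\<^sup>2))"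
      unfolding tail_bound_def r' ..
    have y: "2 * (\<kappa> * s\<^sup>2) + 2 * \<tau> + 2 = a * s\<^sup>2 + b" by (simp add: a_def b_def)
    show ?case
      unfolding saddle_error_def reduced_bound_def fredholm_tail_def C D t y r' w_def[symmetric] Let_def unfolding r ..
  qed
  ultimately show ?thesis by (subst landau_o.big.in_cong)
qed

text \<open>The remainder of the GUE determinant is of order exp(-(8/3) s^3), the square of the
  trace; dividing by the lower bound for the trace costs only one such factor.\<close>

lemma F_GUE_error_bigo:
  assumes \<beta>: "\<beta> > 0" and d: "d > 0"
  defines "H \<equiv> \<lambda>s. ((airy_decay (s\<^sup>2))\<^sup>2 / 4)\<^sup>2 / (1 - (airy_decay (s\<^sup>2))\<^sup>2 / 4) / ((airy_decay (s\<^sup>2 + \<beta>))\<^sup>2 / 400)"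
  shows "H \<in> O[at_top](\<lambda>s. exp (- d * s))" and "\<forall>\<^sub>F s in at_top. H s < 1/2"
    and "\<forall>\<^sub>F s in at_top. (airy_decay (s\<^sup>2))\<^sup>2 / 4 < 1"
proof -
  let ?g = "\<lambda>s::real. exp (- (4/3) * s ^ 3) / s / 4"
  let ?H = "\<lambda>s::real. (?g s)\<^sup>2 / (1 - ?g s) / (exp (- (4/3) * sqrt (s\<^sup>2 + \<beta>) ^ 3) / sqrt (s\<^sup>2 + \<beta>) / 400)"
  have g: "(airy_decay (s\<^sup>2))\<^sup>2 / 4 = ?g s" if "s > 0" for s using that airy_decay_squared[of "s\<^sup>2"] by simp
  have D: "(airy_decay (s\<^sup>2 + \<beta>))\<^sup>2 = exp (- (4/3) * sqrt (s\<^sup>2 + \<beta>) ^ 3) / sqrt (s\<^sup>2 + \<beta>)" for s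
    using \<beta> by (intro airy_decay_squared) auto
  have eq: "\<forall>\<^sub>F s in at_top. H s = ?H s"
    using eventually_gt_at_top[of 0] by eventually_elim (simp only: H_def g D)
  have "?H \<in> O[at_top](\<lambda>s. exp (- d * s))" using \<beta> d by real_asymp
  with eq show "H \<in> O[at_top](\<lambda>s. exp (- d * s))" by (subst landau_o.big.in_cong)
  have "\<forall>\<^sub>F s in at_top. ?H s < 1/2" using \<beta> by real_asymp
  with eq show "\<forall>\<^sub>F s in at_top. H s < 1/2" by eventually_elim simp
  have "\<forall>\<^sub>F s in at_top. ?g s < 1" by real_asymp
  then show "\<forall>\<^sub>F s in at_top. (airy_decay (s\<^sup>2))\<^sup>2 / 4 < 1"
    using eventually_gt_at_top[of 0] by eventually_elim (simp only: g)
qed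

section \<open>From absolute to relative errors\<close>

text \<open>P plays the role of 1 - F, G that of 1 - \<open>F_GUE\<close>, and both are close to
  multiples of the trace T. The condition h \<le> 1/2 keeps G \<ge> T/2, which permits the division
  and produces the factor 2.\<close>

lemma relative_error_le:
  fixes P G T n a h :: real
  assumes T: "T > 0" and n: "n \<ge> 1" and P: "\<bar>P - n * T\<bar> \<le> a * T" and G: "\<bar>G - T\<bar> \<le> h * T" and h: "h \<le> 1/2"
  shows "\<bar>P / (n * G) - 1\<bar> \<le> 2 * (a + h)" and "n * G \<noteq> 0"
proof -
  have "h * T \<le> 1/2 * T" using T h by (intro mult_right_mono) auto
  with G have GT: "T / 2 \<le> G" by linarith
  then have "n * (T / 2) \<le> n * G" using n by (intro mult_left_mono) auto
  moreover have nT: "0 < n * (T / 2)" using T n by simp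
  ultimately have nG: "0 < n * G" by linarith
  then show nz: "n * G \<noteq> 0" by (metis less_irrefl)
  have a0: "0 \<le> a * T" using P by linarith
  have "P - n * G = (P - n * T) - n * (G - T)" by (simp add: algebra_simps)
  then have "\<bar>P - n * G\<bar> \<le> \<bar>P - n * T\<bar> + n * \<bar>G - T\<bar>" using n abs_triangle_ineq4[of "P - n * T" "n * (G - T)"] by (simp add: abs_mult)
  also have "\<dots> \<le> n * (a * T) + n * (h * T)"
    using P mult_right_mono[OF n a0] mult_left_mono[OF G, of n] n by linarith
  also have "\<dots> = 2 * (a + h) * (n * (T / 2))" by (simp add: algebra_simps)
  also have "\<dots> \<le> 2 * (a + h) * (n * G)"
  proof (rule mult_left_mono)
    have "0 \<le> a" "0 \<le> h" using a0 G T by (auto simp: zero_le_mult_iff)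
      (smt (verit) abs_ge_zero mult_neg_pos)
    then show "0 \<le> 2 * (a + h)" by simp
  qed fact
  finally have "\<bar>P - n * G\<bar> / (n * G) \<le> 2 * (a + h)" using nG by (simp add: pos_divide_le_eq)
  moreover have "P / (n * G) - 1 = (P - n * G) / (n * G)" using nz by (simp add: diff_divide_distrib)
  ultimately show "\<bar>P / (n * G) - 1\<bar> \<le> 2 * (a + h)" using nG by (simp add: abs_divide)
qed

lemma card_exceptional_shifts:
  shows "\<gamma> \<noteq> 1/2 \<Longrightarrow> real (card (exceptional_shifts \<gamma>)) = 1"
    and "\<gamma> = 1/2 \<Longrightarrow> real (card (exceptional_shifts \<gamma>)) = 2"
  unfolding exceptional_shifts_def by (simp_all only: if_True if_False) simp_all

lemma F_per_tail:
  fixes \<tau> \<gamma> R :: real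
  assumes \<tau>: "\<tau> > 0" and \<gamma>: "-1/2 < \<gamma>" "\<gamma> \<le> 1/2" and R: "0 < R" "R < 1"
  defines "\<kappa> \<equiv> \<tau> powr (1/3)"
  defines "n \<equiv> real (card (exceptional_shifts \<gamma>))"
  defines "y \<equiv> \<lambda>x. x / \<tau> powr (1/3) + \<gamma>\<^sup>2 / (4 * \<tau> powr (4/3))"
  shows "\<exists>E :: real \<Rightarrow> real. E \<in> O[at_top](\<lambda>x. exp (- (shift_gap \<gamma> / (2 * \<tau> * \<kappa>) / sqrt \<kappa>) * sqrt x)) \<and>
    (\<forall>\<^sub>F x in at_top. 1 - F_per R x \<tau> \<gamma> = complex_of_real (n * (1 - F_GUE (y x)) * (1 + E x)))"
proof -
  define d where "d = shift_gap \<gamma> / (2 * \<tau> * \<kappa>)"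
  \<comment> \<open>Chosen so that s^2 + \<beta> = y + 2, the argument in
    \<open>airy_trace_lower\<close>.\<close>
  define \<beta> where "\<beta> = \<gamma>\<^sup>2 / (4 * \<tau> * \<kappa>) + 2"
  define s where "s = (\<lambda>x. sqrt (x / \<kappa>))"
  define H1 where "H1 = (\<lambda>s. saddle_error \<tau> (\<kappa> * s\<^sup>2) / ((airy_decay (s\<^sup>2 + \<beta>))\<^sup>2 / 400))"
  define H2 where "H2 = (\<lambda>s. ((airy_decay (s\<^sup>2))\<^sup>2 / 4)\<^sup>2 / (1 - (airy_decay (s\<^sup>2))\<^sup>2 / 4) / ((airy_decay (s\<^sup>2 + \<beta>))\<^sup>2 / 400))"
  define H where "H = (\<lambda>s. 2 * (576 * weight_sum * exp (- d * s) + H1 s + H2 s))"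
  define E where "E = (\<lambda>x. Re (1 - F_per R x \<tau> \<gamma>) / (n * (1 - F_GUE (y x))) - 1)"
  have \<kappa>0: "\<kappa> > 0" using \<tau> by (simp add: \<kappa>_def)
  have d: "d > 0" using shift_gap_pos[OF \<gamma>] \<tau> \<kappa>0 by (simp add: d_def)
  have \<beta>: "\<beta> > 0" using \<tau> \<kappa>0 by (auto simp: \<beta>_def intro!: add_nonneg_pos)
  have n1: "n \<ge> 1" by (simp add: n_def exceptional_shifts_def)
  have "H \<in> O[at_top](\<lambda>s. exp (- d * s))"
    unfolding H_def H1_def H2_def
    using saddle_error_bigo[OF \<tau> _ \<beta> d, of \<kappa>] F_GUE_error_bigo(1)[OF \<beta> d]
    by (intro landau_o.big.cmult_in_iff[THEN iffD2] sum_in_bigo) (use weight_sum_pos in \<open>auto simp: \<kappa>_def\<close>)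
  moreover have s: "filterlim s at_top at_top" unfolding s_def using \<kappa>0 by real_asymp
  ultimately have "(\<lambda>x. H (s x)) \<in> O[at_top](\<lambda>x. exp (- d * s x))" by (rule landau_o.big.compose)
  also have "(\<lambda>x. exp (- d * s x)) = (\<lambda>x. exp (- (d / sqrt \<kappa>) * sqrt x))" by (simp add: s_def real_sqrt_divide)
  finally have HO: "(\<lambda>x. H (s x)) \<in> O[at_top](\<lambda>x. exp (- (d / sqrt \<kappa>) * sqrt x))" .
  have ev1: "\<forall>\<^sub>F x in at_top. exp (- (d * s x)) < 1/2" unfolding s_def using d \<kappa>0 by real_asymp
  have ev2: "\<forall>\<^sub>F x in at_top. H2 (s x) < 1/2"
    unfolding H2_def using F_GUE_error_bigo(2)[OF \<beta> d] s by (rule eventually_compose_filterlim)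
  have ev3: "\<forall>\<^sub>F x in at_top. (airy_decay ((s x)\<^sup>2))\<^sup>2 / 4 < 1"
    using F_GUE_error_bigo(3)[OF \<beta> d] s by (rule eventually_compose_filterlim)
  have ev: "\<forall>\<^sub>F x in at_top. norm (E x) \<le> norm (H (s x)) \<and> 1 - F_per R x \<tau> \<gamma> = complex_of_real (n * (1 - F_GUE (y x)) * (1 + E x))"
    using ev1 ev2 ev3 eventually_F_per_approximation[OF \<tau> R, of \<gamma>] eventually_ge_at_top[of \<kappa>]
  proof eventually_elim
    case (elim x)
    define T where "T = airy_trace (y x)"
    define L where "L = (airy_decay ((s x)\<^sup>2 + \<beta>))\<^sup>2 / 400"
    define q where "q = exp (- (d * s x))"
    have x0: "x > 0" using elim(5) \<kappa>0 by linarith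
    have s2: "(s x)\<^sup>2 = x / \<kappa>" and xs: "\<kappa> * (s x)\<^sup>2 = x" using x0 \<kappa>0 by (simp_all add: s_def)
    have \<tau>4: "\<tau> powr (4/3) = \<tau> * \<kappa>" using \<tau> powr_add[of \<tau> 1 "1/3"] by (simp add: \<kappa>_def)
    have y: "y x = (x + (\<gamma> / 2)\<^sup>2 / \<tau>) / \<kappa>"
      unfolding y_def \<tau>4 \<kappa>_def[symmetric] using \<tau> \<kappa>0 by (simp add: field_simps power_divide)
    have y2: "y x + 2 = (s x)\<^sup>2 + \<beta>" unfolding y_def \<tau>4 \<kappa>_def[symmetric] s2 by (simp add: \<beta>_def mult_ac)
    have \<beta>2: "\<beta> \<ge> 2" using \<tau> \<kappa>0 by (simp add: \<beta>_def)
    have s1: "1 \<le> (s x)\<^sup>2" using s2 elim(5) \<kappa>0 by simp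
    then have sy: "(s x)\<^sup>2 \<le> y x" and y1: "1 \<le> y x" using y2 \<beta>2 by linarith+
    have L0: "L > 0" using airy_decay_pos[of "(s x)\<^sup>2 + \<beta>"] s1 \<beta> by (simp add: L_def)
    have LT: "L \<le> T" using airy_trace_lower[OF y1] unfolding L_def T_def y2 .
    then have T0: "T > 0" using L0 by linarith
    \<comment> \<open>An absolute error becomes a multiple of T at the price of dividing by the
      lower bound L.\<close>
    have scale: "e \<le> e / L * T" if "0 \<le> e" for e
      using mult_left_mono[OF LT, of "e / L"] that L0 by simp
    have q2: "q \<le> 1/2" using elim(1) by (simp add: q_def)
    have qd: "q = exp (- (shift_gap \<gamma> / (2 * \<tau> * \<kappa>) * sqrt (x / \<kappa>)))" by (simp add: q_def d_def s_def)
    note tr = reduced_trace_approximation[OF \<tau> \<gamma> \<kappa>_def[THEN meta_eq_to_obj_eq] x0 elim(5) qd q2]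
    have F1: "norm (1 - F_per R x \<tau> \<gamma> - circle_mean (exp (- (x / \<tau>) / 2)) (reduced_trace \<tau> x \<gamma>)) \<le> saddle_error \<tau> x"
      and Im: "Im (F_per R x \<tau> \<gamma>) = 0" using elim(4) by auto
    have tr': "norm (circle_mean (exp (- (x / \<tau>) / 2)) (reduced_trace \<tau> x \<gamma>) - of_real (n * T)) \<le> 576 * weight_sum * q * T"
      using tr unfolding n_def T_def y .
    have se: "saddle_error \<tau> x \<le> H1 (s x) * T"
      unfolding H1_def xs L_def[symmetric] by (rule scale) (use F1 norm_ge_zero order_trans in blast)
    have "norm (1 - F_per R x \<tau> \<gamma> - of_real (n * T)) \<le> (576 * weight_sum * q + H1 (s x)) * T"
      using norm_diff_triangle_le[OF F1 tr'] se unfolding distrib_right by linarith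
    moreover have "\<bar>Re (1 - F_per R x \<tau> \<gamma>) - n * T\<bar> \<le> norm (1 - F_per R x \<tau> \<gamma> - of_real (n * T))"
      using abs_Re_le_cmod[of "1 - F_per R x \<tau> \<gamma> - of_real (n * T)"] by simp
    ultimately have P: "\<bar>Re (1 - F_per R x \<tau> \<gamma>) - n * T\<bar> \<le> (576 * weight_sum * q + H1 (s x)) * T" by linarith
    \<comment> \<open>The GUE remainder is moved from y to s^2 \<le> y, where it is increasing in
      the decay function and explicit in s.\<close>
    let ?g = "(airy_decay (y x))\<^sup>2 / 4" and ?g' = "(airy_decay ((s x)\<^sup>2))\<^sup>2 / 4"
    have gg: "?g \<le> ?g'"
    proof -
      have a0: "0 \<le> airy_decay ((s x)\<^sup>2)" by (rule less_imp_le[OF airy_decay_pos]) (use s1 in linarith)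
      have "airy_decay (y x) \<le> airy_decay ((s x)\<^sup>2) * exp (- sqrt ((s x)\<^sup>2) * (y x - (s x)\<^sup>2))"
        by (rule airy_decay_mono[OF s1 sy])
      also have "\<dots> \<le> airy_decay ((s x)\<^sup>2) * 1"
        using a0 s1 sy by (intro mult_left_mono) auto
      finally show ?thesis using airy_decay_pos[of "y x"] y1 by (auto intro!: power_mono)
    qed
    have "?g\<^sup>2 / (1 - ?g) \<le> ?g'\<^sup>2 / (1 - ?g')"
      by (rule frac_le[OF _ power_mono[OF gg]]) (use gg elim(3) in auto)
    moreover have "?g'\<^sup>2 / (1 - ?g') \<le> H2 (s x) * T"
      unfolding H2_def L_def[symmetric] using elim(3) by (intro scale divide_nonneg_pos) auto
    ultimately have G: "\<bar>1 - F_GUE (y x) - T\<bar> \<le> H2 (s x) * T"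
      using F_GUE_expansion[OF y1] gg elim(3) unfolding T_def by linarith
    have r: "\<bar>E x\<bar> \<le> 2 * (576 * weight_sum * q + H1 (s x) + H2 (s x))" and nz: "n * (1 - F_GUE (y x)) \<noteq> 0"
      unfolding E_def using relative_error_le[OF T0 n1 P G less_imp_le[OF elim(2)]] by auto
    have "norm (E x) \<le> norm (H (s x))" using r by (simp add: H_def q_def)
    moreover have "Re (1 - F_per R x \<tau> \<gamma>) = n * (1 - F_GUE (y x)) * (1 + E x)" using nz by (simp add: E_def)
    then have "1 - F_per R x \<tau> \<gamma> = complex_of_real (n * (1 - F_GUE (y x)) * (1 + E x))"
      using Im by (simp add: complex_eq_iff)
    ultimately show ?case by blast
  qed
  have "E \<in> O[at_top](\<lambda>x. H (s x))" by (rule landau_o.big_mono) (use ev in eventually_elim, blast)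
  from landau_o.big_trans[OF this HO] ev show ?thesis unfolding d_def[symmetric]
    by (intro exI[of _ E] conjI) (auto elim: eventually_mono)
qed

theorem theorem1p7:
  fixes \<tau> \<gamma> :: real
  assumes "\<tau> > 0" and "-1/2 < \<gamma>" and "\<gamma> \<le> 1/2"
  shows "\<exists>c>0. \<forall>R. 0 < R \<and> R < 1 \<longrightarrow>
    (\<gamma> < 1/2 \<longrightarrow>
      (\<exists>E :: real \<Rightarrow> real. E \<in> O[at_top](\<lambda>x. exp (- c * sqrt x)) \<and>
        (\<forall>\<^sub>F x in at_top. 1 - F_per R x \<tau> \<gamma> = complex_of_real
          ((1 - F_GUE (x / \<tau> powr (1/3) + \<gamma>\<^sup>2 / (4 * \<tau> powr (4/3)))) * (1 + E x))))) \<and>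
    (\<gamma> = 1/2 \<longrightarrow>
      (\<exists>E :: real \<Rightarrow> real. E \<in> O[at_top](\<lambda>x. exp (- c * sqrt x)) \<and>
        (\<forall>\<^sub>F x in at_top. 1 - F_per R x \<tau> \<gamma> = complex_of_real
          (2 * (1 - F_GUE (x / \<tau> powr (1/3) + \<gamma>\<^sup>2 / (4 * \<tau> powr (4/3)))) * (1 + E x)))))"
\<comment> \<open>With \<kappa> = \<tau> powr (1/3), this is the exponent in q, the gap divided by 2
  \<tau> \<kappa> times sqrt (x/\<kappa>), rewritten as a multiple of sqrt x. It does not involve
  R.\<close>
proof (rule exI[of _ "shift_gap \<gamma> / (2 * \<tau> * \<tau> powr (1/3)) / sqrt (\<tau> powr (1/3))"], intro conjI allI impI)
  show "0 < shift_gap \<gamma> / (2 * \<tau> * \<tau> powr (1/3)) / sqrt (\<tau> powr (1/3))"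
    using assms shift_gap_pos[of \<gamma>] by simp
next
  fix R :: real assume R: "0 < R \<and> R < 1" and "\<gamma> < 1/2"
  then have "real (card (exceptional_shifts \<gamma>)) = 1" by (intro card_exceptional_shifts) auto
  then show "\<exists>E :: real \<Rightarrow> real. E \<in> O[at_top](\<lambda>x. exp (- (shift_gap \<gamma> / (2 * \<tau> * \<tau> powr (1/3)) / sqrt (\<tau> powr (1/3))) * sqrt x)) \<and>
        (\<forall>\<^sub>F x in at_top. 1 - F_per R x \<tau> \<gamma> = complex_of_real
          ((1 - F_GUE (x / \<tau> powr (1/3) + \<gamma>\<^sup>2 / (4 * \<tau> powr (4/3)))) * (1 + E x)))"
    using F_per_tail[OF assms, of R] R by (simp only: mult_1_left)
next
  fix R :: real assume R: "0 < R \<and> R < 1" and "\<gamma> = 1/2"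
  then have "real (card (exceptional_shifts \<gamma>)) = 2" by (intro card_exceptional_shifts)
  then show "\<exists>E :: real \<Rightarrow> real. E \<in> O[at_top](\<lambda>x. exp (- (shift_gap \<gamma> / (2 * \<tau> * \<tau> powr (1/3)) / sqrt (\<tau> powr (1/3))) * sqrt x)) \<and>
        (\<forall>\<^sub>F x in at_top. 1 - F_per R x \<tau> \<gamma> = complex_of_real
          (2 * (1 - F_GUE (x / \<tau> powr (1/3) + \<gamma>\<^sup>2 / (4 * \<tau> powr (4/3)))) * (1 + E x)))"
    using F_per_tail[OF assms, of R] R by (simp only:)
qed

end
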